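(* There is an algorithm which, given a graph $G$ with $n$ vertices that is a line graph and two distinct vertices $a,b$ of $G$, outputs a path of $G$ of odd length joining $a$ and $b$ if such a path exists, and otherwise outputs that $\{a,b\}$ is an even pair of $G$; the algorithm runs in time $O(n^3)$.
   Context: Graphs are finite, simple, undirected. A path of $G$ is an induced subgraph of $G$ that is a chordless path; its length is its number of edges. The line graph $L(R)$ of a graph $R$ has vertex set $E(R)$, two vertices being adjacent if and only if the corresponding edges of $R$ share an end; $G$ is a line graph if $G=L(R)$ for some graph $R$ (the root graph $R$ is not part of the input). A pair $\{a,b\}$ of vertices of $G$ is an even pair if every path of $G$ joining $a$ to $b$ has even length. Time is worst-case number of elementary operations, up to a multiplicative constant. *)

theory Defs
  imports Complex_Main "HOL-Library.Landau_Symbols"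
begin

section \<open>Finite simple graphs\<close>

record 'a graph =
  verts :: "'a set"
  edges :: "'a set set"

definition simple_graph :: "'a graph \<Rightarrow> bool" where
  "simple_graph G \<longleftrightarrow>
     finite (verts G) \<and>
     (\<forall>e \<in> edges G. \<exists>u \<in> verts G. \<exists>v \<in> verts G. u \<noteq> v \<and> e = {u, v})"

definition induced_subgraph :: "'a graph \<Rightarrow> 'a set \<Rightarrow> 'a graph" where
  "induced_subgraph G S = \<lparr>verts = S, edges = {e \<in> edges G. e \<subseteq> S}\<rparr>"

definition path_graph :: "'a list \<Rightarrow> 'a graph" where
  "path_graph p = \<lparr>verts = set p, edges = {{p ! i, p ! Suc i} | i. Suc i < length p}\<rparr>"

text \<open>A path of \<open>G\<close>, always meaning a chordless one, is given by the list of its vertices in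
  the order in which they are traversed.\<close>

definition is_path :: "'a graph \<Rightarrow> 'a list \<Rightarrow> bool" where
  "is_path G p \<longleftrightarrow>
     p \<noteq> [] \<and> distinct p \<and> set p \<subseteq> verts G \<and> induced_subgraph G (set p) = path_graph p"

definition path_length :: "'a list \<Rightarrow> nat" where
  "path_length p = length p - 1"

lemma path_length_eq_card_edges:
  assumes "distinct p"
  shows "path_length p = card (edges (path_graph p))"
proof -
  have inj: "inj_on (\<lambda>i. {p ! i, p ! Suc i}) {..<length p - 1}"
  proof (rule inj_onI)
    fix i j
    assume "i \<in> {..<length p - 1}" "j \<in> {..<length p - 1}"
      and eq: "{p ! i, p ! Suc i} = {p ! j, p ! Suc j}"
    then have b: "i < length p" "Suc i < length p" "j < length p" "Suc j < length p"
      by auto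
    have nth_eq: "p ! k = p ! l \<longleftrightarrow> k = l" if "k < length p" "l < length p" for k l
      using assms that by (rule nth_eq_iff_index_eq)
    show "i = j"
      using eq b by (auto simp: doubleton_eq_iff nth_eq)
  qed
  have "edges (path_graph p) = (\<lambda>i. {p ! i, p ! Suc i}) ` {..<length p - 1}"
    by (auto simp: path_graph_def)
  then show ?thesis
    using card_image[OF inj] by (simp add: path_length_def)
qed

definition path_joining :: "'a graph \<Rightarrow> 'a \<Rightarrow> 'a \<Rightarrow> 'a list \<Rightarrow> bool" where
  "path_joining G a b p \<longleftrightarrow> is_path G p \<and> hd p = a \<and> last p = b"

definition even_pair :: "'a graph \<Rightarrow> 'a \<Rightarrow> 'a \<Rightarrow> bool" where
  "even_pair G a b \<longleftrightarrow>
     a \<in> verts G \<and> b \<in> verts G \<and> a \<noteq> b \<and>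
     (\<forall>p. path_joining G a b p \<longrightarrow> even (path_length p))"

definition line_graph :: "'a graph \<Rightarrow> 'a set graph" where
  "line_graph R =
     \<lparr>verts = edges R,
      edges = {{e, f} | e f. e \<in> edges R \<and> f \<in> edges R \<and> e \<noteq> f \<and> e \<inter> f \<noteq> {}}\<rparr>"

definition graph_iso :: "'a graph \<Rightarrow> 'b graph \<Rightarrow> bool" where
  "graph_iso G H \<longleftrightarrow>
     (\<exists>f. bij_betw f (verts G) (verts H) \<and>
          (\<forall>u \<in> verts G. \<forall>v \<in> verts G. {u, v} \<in> edges G \<longleftrightarrow> {f u, f v} \<in> edges H))"

text \<open>As graphs are finite, it is no restriction to take the vertices of the root graph from
  \<^typ>\<open>nat\<close>.\<close>

definition is_line_graph :: "'a graph \<Rightarrow> bool" where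
  "is_line_graph G \<longleftrightarrow> (\<exists>R :: nat graph. simple_graph R \<and> graph_iso G (line_graph R))"


section \<open>A word RAM\<close>

text \<open>Algorithms are structured programs over natural number variables and arrays with two
  indices. Every operator, memory access, assignment and branch has cost 1. The semantics is
  relative to a word bound \<open>W\<close>: a computation in which some number exceeds \<open>W\<close> is stuck. With
  \<open>W\<close> polynomial in the size of the input, words have logarithmically many bits, so that unit
  cost is adequate even for multiplication. Subtraction is truncated at 0.\<close>

datatype aexp =
    Const nat
  | Var string
  | Read string aexp aexp
  | Plus aexp aexp
  | Minus aexp aexp
  | Times aexp aexp

datatype bexp =
    Eq aexp aexp
  | Less aexp aexp
  | Neg bexp
  | Conj bexp bexp

datatype com =
    Skip
  | Assign string aexp
  | Write string aexp aexp aexp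
  | Seq com com
  | Cond bexp com com
  | While bexp com

record state =
  var :: "string \<Rightarrow> nat"
  arr :: "string \<Rightarrow> nat \<Rightarrow> nat \<Rightarrow> nat"

fun aval :: "aexp \<Rightarrow> state \<Rightarrow> nat" where
  "aval (Const k) s = k"
| "aval (Var x) s = var s x"
| "aval (Read A i j) s = arr s A (aval i s) (aval j s)"
| "aval (Plus e f) s = aval e s + aval f s"
| "aval (Minus e f) s = aval e s - aval f s"
| "aval (Times e f) s = aval e s * aval f s"

fun bval :: "bexp \<Rightarrow> state \<Rightarrow> bool" where
  "bval (Eq e f) s \<longleftrightarrow> aval e s = aval f s"
| "bval (Less e f) s \<longleftrightarrow> aval e s < aval f s"
| "bval (Neg b) s \<longleftrightarrow> \<not> bval b s"
| "bval (Conj b c) s \<longleftrightarrow> bval b s \<and> bval c s"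

fun asubexps :: "aexp \<Rightarrow> aexp set" where
  "asubexps (Const k) = {Const k}"
| "asubexps (Var x) = {Var x}"
| "asubexps (Read A i j) = {Read A i j} \<union> asubexps i \<union> asubexps j"
| "asubexps (Plus e f) = {Plus e f} \<union> asubexps e \<union> asubexps f"
| "asubexps (Minus e f) = {Minus e f} \<union> asubexps e \<union> asubexps f"
| "asubexps (Times e f) = {Times e f} \<union> asubexps e \<union> asubexps f"

definition afits :: "nat \<Rightarrow> aexp \<Rightarrow> state \<Rightarrow> bool" where
  "afits W e s \<longleftrightarrow> (\<forall>f \<in> asubexps e. aval f s \<le> W)"

fun bfits :: "nat \<Rightarrow> bexp \<Rightarrow> state \<Rightarrow> bool" where
  "bfits W (Eq e f) s \<longleftrightarrow> afits W e s \<and> afits W f s"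
| "bfits W (Less e f) s \<longleftrightarrow> afits W e s \<and> afits W f s"
| "bfits W (Neg b) s \<longleftrightarrow> bfits W b s"
| "bfits W (Conj b c) s \<longleftrightarrow> bfits W b s \<and> bfits W c s"

fun acost :: "aexp \<Rightarrow> nat" where
  "acost (Const k) = 1"
| "acost (Var x) = 1"
| "acost (Read A i j) = 1 + acost i + acost j"
| "acost (Plus e f) = 1 + acost e + acost f"
| "acost (Minus e f) = 1 + acost e + acost f"
| "acost (Times e f) = 1 + acost e + acost f"

fun bcost :: "bexp \<Rightarrow> nat" where
  "bcost (Eq e f) = 1 + acost e + acost f"
| "bcost (Less e f) = 1 + acost e + acost f"
| "bcost (Neg b) = 1 + bcost b"
| "bcost (Conj b c) = 1 + bcost b + bcost c"

definition set_var :: "string \<Rightarrow> nat \<Rightarrow> state \<Rightarrow> state" where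
  "set_var x k s = s\<lparr>var := (var s)(x := k)\<rparr>"

definition set_arr :: "string \<Rightarrow> nat \<Rightarrow> nat \<Rightarrow> nat \<Rightarrow> state \<Rightarrow> state" where
  "set_arr A i j k s = s\<lparr>arr := (arr s)(A := (arr s A)(i := (arr s A i)(j := k)))\<rparr>"

text \<open>\<open>exec W c s t s'\<close>: started in \<open>s\<close>, the program \<open>c\<close> halts in \<open>s'\<close> after \<open>t\<close> elementary
  operations, and all numbers occurring on the way are at most \<open>W\<close>.\<close>

inductive exec :: "nat \<Rightarrow> com \<Rightarrow> state \<Rightarrow> nat \<Rightarrow> state \<Rightarrow> bool" for W where
  Skip: "exec W Skip s 1 s"
| Assign: "afits W e s \<Longrightarrow> exec W (Assign x e) s (1 + acost e) (set_var x (aval e s) s)"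
| Write: "afits W i s \<Longrightarrow> afits W j s \<Longrightarrow> afits W e s \<Longrightarrow>
    exec W (Write A i j e) s (1 + acost i + acost j + acost e)
      (set_arr A (aval i s) (aval j s) (aval e s) s)"
| Seq: "exec W c s t s' \<Longrightarrow> exec W d s' u s'' \<Longrightarrow> exec W (Seq c d) s (t + u) s''"
| CondTrue: "bfits W b s \<Longrightarrow> bval b s \<Longrightarrow> exec W c s t s' \<Longrightarrow>
    exec W (Cond b c d) s (1 + bcost b + t) s'"
| CondFalse: "bfits W b s \<Longrightarrow> \<not> bval b s \<Longrightarrow> exec W d s t s' \<Longrightarrow>
    exec W (Cond b c d) s (1 + bcost b + t) s'"
| WhileFalse: "bfits W b s \<Longrightarrow> \<not> bval b s \<Longrightarrow> exec W (While b c) s (1 + bcost b) s"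
| WhileTrue: "bfits W b s \<Longrightarrow> bval b s \<Longrightarrow> exec W c s t s' \<Longrightarrow>
    exec W (While b c) s' u s'' \<Longrightarrow> exec W (While b c) s (1 + bcost b + t + u) s''"

inductive_cases SkipE: "exec W Skip s t s'"
inductive_cases AssignE: "exec W (Assign x e) s t s'"
inductive_cases WriteE: "exec W (Write A i j e) s t s'"
inductive_cases SeqE: "exec W (Seq c d) s t s'"
inductive_cases CondE: "exec W (Cond b c d) s t s'"
inductive_cases WhileE: "exec W (While b c) s t s'"

lemma exec_deterministic:
  "exec W c s t s' \<Longrightarrow> exec W c s u s'' \<Longrightarrow> t = u \<and> s' = s''"
proof (induction arbitrary: u s'' rule: exec.induct)
  case (Skip s)
  then show ?case by (auto elim: SkipE)
next
  case (Assign e s x)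
  then show ?case by (auto elim: AssignE)
next
  case (Write i s j e A)
  then show ?case by (auto elim: WriteE)
next
  case (Seq c s t s' d u' s1)
  obtain t1 r t2 where "exec W c s t1 r" "exec W d r t2 s''" "u = t1 + t2"
    using Seq.prems by (rule SeqE) simp
  then show ?case using Seq.IH by metis
next
  case (CondTrue b s c t s' d)
  obtain t1 where "exec W c s t1 s''" "u = 1 + bcost b + t1"
    using CondTrue.prems by (rule CondE) (use CondTrue.hyps in simp_all)
  then show ?case using CondTrue.IH by metis
next
  case (CondFalse b s d t s' c)
  obtain t1 where "exec W d s t1 s''" "u = 1 + bcost b + t1"
    using CondFalse.prems by (rule CondE) (use CondFalse.hyps in simp_all)
  then show ?case using CondFalse.IH by metis
next
  case (WhileFalse b s c)
  from WhileFalse.prems show ?case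
    by (rule WhileE) (use WhileFalse.hyps in simp_all)
next
  case (WhileTrue b s c t s' u' s1)
  obtain t1 r t2 where "exec W c s t1 r" "exec W (While b c) r t2 s''"
      "u = 1 + bcost b + t1 + t2"
    using WhileTrue.prems by (rule WhileE) (use WhileTrue.hyps in simp_all)
  then show ?case using WhileTrue.IH by metis
qed


section \<open>Input and output\<close>

text \<open>A graph with vertex set \<open>{..<n}\<close> is given by its adjacency matrix; the memory is otherwise
  cleared.\<close>

definition input_state :: "nat \<Rightarrow> nat graph \<Rightarrow> nat \<Rightarrow> nat \<Rightarrow> state" where
  "input_state n G a b =
     \<lparr>var = (\<lambda>_. 0)(''n'' := n, ''a'' := a, ''b'' := b),
      arr = (\<lambda>_ _ _. 0)(''adj'' := (\<lambda>i j. if {i, j} \<in> edges G then 1 else 0))\<rparr>"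

datatype answer = Odd_Path "nat list" | Even_Pair

text \<open>A path has at least one vertex, so length 0 is free to encode the other answer.\<close>

definition answer_of :: "state \<Rightarrow> answer" where
  "answer_of s =
     (if var s ''len'' = 0 then Even_Pair
      else Odd_Path (map (arr s ''out'' 0) [0..<var s ''len'']))"

end

theory Submission
  imports Defs
begin

text \<open>
  Let \<open>G\<close> be the line graph of \<open>R\<close>. An odd path of \<open>G\<close> between nonadjacent \<open>a\<close> and \<open>b\<close> is an even
  path of \<open>R\<close> between an end \<open>s\<close> of the edge \<open>a\<close> and an end \<open>t\<close> of the edge \<open>b\<close> that avoids the
  other ends of \<open>a\<close> and \<open>b\<close>; there are four choices of \<open>(s, t)\<close>.

  A root multigraph of the component of \<open>a\<close> is found by guessing the clique of the edges at one end
  of \<open>a\<close>: it consists of \<open>a\<close>, a neighbour \<open>u\<close>, and all their common neighbours but at most one. Each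
  guess determines the remaining cliques in time \<open>O(n\<^sup>2)\<close>, and is verified in time \<open>O(n\<^sup>2)\<close>.

  To find an even path from \<open>s\<close> to \<open>t\<close>, we grow a set \<open>B\<close> with a linear order in which \<open>s\<close> is least,
  \<open>t\<close> is greatest, and every other vertex has a neighbour below and a neighbour above; initially
  \<open>B = {s, t}\<close>. An ear of \<open>B\<close>, that is, a path with distinct ends in \<open>B\<close> and interior outside, can be
  inserted into the order next to one of its ends. An edge \<open>uw\<close> with \<open>u\<close> in \<open>B\<close> from which no
  ear starts lies on no path from \<open>s\<close> to \<open>t\<close>, since \<open>u\<close> separates \<open>w\<close> from \<open>s\<close> and \<open>t\<close>. So every
  edge is examined once, in time \<open>O(n\<^sup>2)\<close>. In the end all paths from \<open>s\<close> to \<open>t\<close> run within \<open>B\<close>. An edge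
  \<open>xy\<close> of \<open>B\<close> with \<open>x\<close> below \<open>y\<close> yields the path that descends from \<open>x\<close> to \<open>s\<close> and ascends from \<open>y\<close>
  to \<open>t\<close>. If all these paths are odd, then the parity of the descent is a proper 2-colouring of \<open>B\<close>
  in which \<open>s\<close> and \<open>t\<close> differ, and so all paths from \<open>s\<close> to \<open>t\<close> are odd.

  The loops have fixed bounds, are nested at most three deep, and increase numbers only by 1. Hence
  the bounds on the time and on the word size follow from the syntax of the program alone.
\<close>

section \<open>A structured programming layer over the word RAM\<close>

text \<open>Loops count up to a variable, so that time can be bounded by recursion on the program.
  Open-ended loops are expressed by sufficiently many rounds, each of which is idle once the
  condition fails.\<close>

datatype prog =
    Nop
  | Asg string aexp
  | Wrt string aexp aexp aexp
  | Sq prog prog  (infixr ";;" 60)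
  | Ite bexp prog prog
  | For string string prog

primrec compile :: "prog \<Rightarrow> com" where
  "compile Nop = Skip"
| "compile (Asg x e) = Assign x e"
| "compile (Wrt A i j e) = Write A i j e"
| "compile (c ;; d) = Seq (compile c) (compile d)"
| "compile (Ite b c d) = Cond b (compile c) (compile d)"
| "compile (For x y c) = Seq (Assign x (Const 0))
     (While (Less (Var x) (Var y)) (Seq (compile c) (Assign x (Plus (Var x) (Const 1)))))"

text \<open>A total semantics without time and word bound. A loop fixes its number of rounds on
  entry; the compiled loop agrees if the body writes neither the counter nor the limit, which
  \<open>wf\<close> and the disjointness of \<open>limits\<close> and \<open>wvars\<close>
  ensure.\<close>

primrec sem :: "prog \<Rightarrow> state \<Rightarrow> state" where
  "sem Nop s = s"
| "sem (Asg x e) s = set_var x (aval e s) s"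
| "sem (Wrt A i j e) s = set_arr A (aval i s) (aval j s) (aval e s) s"
| "sem (c ;; d) s = sem d (sem c s)"
| "sem (Ite b c d) s = (if bval b s then sem c s else sem d s)"
| "sem (For x y c) s =
     ((\<lambda>s. set_var x (Suc (var s x)) (sem c s)) ^^ var s y) (set_var x 0 s)"

text \<open>\<open>N\<close> bounds all loop limits. The 6 pays for resetting the counter and for
  the last test, the 8 for one test and one increment.\<close>

primrec cost :: "nat \<Rightarrow> prog \<Rightarrow> nat" where
  "cost N Nop = 1"
| "cost N (Asg x e) = 1 + acost e"
| "cost N (Wrt A i j e) = 1 + acost i + acost j + acost e"
| "cost N (c ;; d) = cost N c + cost N d"
| "cost N (Ite b c d) = 1 + bcost b + cost N c + cost N d"
| "cost N (For x y c) = 6 + N * (8 + cost N c)"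

primrec wvars :: "prog \<Rightarrow> string set" where
  "wvars Nop = {}"
| "wvars (Asg x e) = {x}"
| "wvars (Wrt A i j e) = {}"
| "wvars (c ;; d) = wvars c \<union> wvars d"
| "wvars (Ite b c d) = wvars c \<union> wvars d"
| "wvars (For x y c) = insert x (wvars c)"

primrec warrs :: "prog \<Rightarrow> string set" where
  "warrs Nop = {}"
| "warrs (Asg x e) = {}"
| "warrs (Wrt A i j e) = {A}"
| "warrs (c ;; d) = warrs c \<union> warrs d"
| "warrs (Ite b c d) = warrs c \<union> warrs d"
| "warrs (For x y c) = warrs c"

primrec limits :: "prog \<Rightarrow> string set" where
  "limits Nop = {}"
| "limits (Asg x e) = {}"
| "limits (Wrt A i j e) = {}"
| "limits (c ;; d) = limits c \<union> limits d"
| "limits (Ite b c d) = limits c \<union> limits d"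
| "limits (For x y c) = insert y (limits c)"

text \<open>Sums only add 1 and products are excluded, so a value exceeds the largest stored number
  by at most the cost of the expression.\<close>

fun lin :: "aexp \<Rightarrow> bool" where
  "lin (Const k) \<longleftrightarrow> k \<le> 1"
| "lin (Var x) \<longleftrightarrow> True"
| "lin (Read A i j) \<longleftrightarrow> lin i \<and> lin j"
| "lin (Plus e f) \<longleftrightarrow> lin e \<and> f = Const 1"
| "lin (Minus e f) \<longleftrightarrow> lin e \<and> lin f"
| "lin (Times e f) \<longleftrightarrow> False"

fun blin :: "bexp \<Rightarrow> bool" where
  "blin (Eq e f) \<longleftrightarrow> lin e \<and> lin f"
| "blin (Less e f) \<longleftrightarrow> lin e \<and> lin f"
| "blin (Neg b) \<longleftrightarrow> blin b"
| "blin (Conj b c) \<longleftrightarrow> blin b \<and> blin c"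

primrec wf :: "prog \<Rightarrow> bool" where
  "wf Nop \<longleftrightarrow> True"
| "wf (Asg x e) \<longleftrightarrow> lin e"
| "wf (Wrt A i j e) \<longleftrightarrow> lin i \<and> lin j \<and> lin e"
| "wf (c ;; d) \<longleftrightarrow> wf c \<and> wf d"
| "wf (Ite b c d) \<longleftrightarrow> blin b \<and> wf c \<and> wf d"
| "wf (For x y c) \<longleftrightarrow> wf c \<and> x \<notin> wvars c"

definition bounded :: "nat \<Rightarrow> state \<Rightarrow> bool" where
  "bounded M s \<longleftrightarrow> (\<forall>x. var s x \<le> M) \<and> (\<forall>A i j. arr s A i j \<le> M)"

section \<open>Bounds on the numbers in memory\<close>

lemma bounded_mono: "bounded M s \<Longrightarrow> M \<le> M' \<Longrightarrow> bounded M' s"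
  by (meson bounded_def le_trans)

lemma var_set_var [simp]: "var (set_var x k s) y = (if y = x then k else var s y)"
  by (simp add: set_var_def)

lemma arr_set_var [simp]: "arr (set_var x k s) = arr s"
  by (simp add: set_var_def)

lemma var_set_arr [simp]: "var (set_arr A i j k s) = var s"
  by (simp add: set_arr_def)

lemma arr_set_arr [simp]:
  "arr (set_arr A i j k s) B = (if B = A then (arr s A)(i := (arr s A i)(j := k)) else arr s B)"
  by (simp add: set_arr_def)

lemma bounded_set_var: "bounded M s \<Longrightarrow> k \<le> M \<Longrightarrow> bounded M (set_var x k s)"
  by (simp add: bounded_def)

lemma bounded_set_arr: "bounded M s \<Longrightarrow> k \<le> M \<Longrightarrow> bounded M (set_arr A i j k s)"
  by (auto simp: bounded_def)

text \<open>A read returns a stored number, truncated subtraction never increases, and each addition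
  of 1 is itself charged 1.\<close>

lemma lin_aval_le: "lin e \<Longrightarrow> bounded M s \<Longrightarrow> f \<in> asubexps e \<Longrightarrow> aval f s \<le> M + acost e"
proof (induction e arbitrary: f)
  case (Read A i j)
  then show ?case
    by (auto simp: bounded_def intro: le_trans trans_le_add1) (meson le_trans le_add1 add_le_mono le_refl trans_le_add1 trans_le_add2 le_SucI Suc_le_mono)+
next
  case (Plus e1 e2)
  have "e1 \<in> asubexps e1" by (cases e1) auto
  with Plus have "aval e1 s \<le> M + acost e1" by auto
  with Plus show ?case by fastforce
next
  case (Minus e1 e2)
  have "e1 \<in> asubexps e1" by (cases e1) auto
  with Minus have "aval e1 s \<le> M + acost e1" by auto
  with Minus show ?case by fastforce
qed (auto simp: bounded_def intro: le_trans)

lemma lin_afits: "lin e \<Longrightarrow> bounded M s \<Longrightarrow> M + acost e \<le> W \<Longrightarrow> afits W e s"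
  using lin_aval_le unfolding afits_def by (meson le_trans)

lemma lin_aval: "lin e \<Longrightarrow> bounded M s \<Longrightarrow> aval e s \<le> M + acost e"
  by (rule lin_aval_le) (auto, cases e, auto)

lemma blin_bfits: "blin b \<Longrightarrow> bounded M s \<Longrightarrow> M + bcost b \<le> W \<Longrightarrow> bfits W b s"
  by (induction b) (auto intro: lin_afits)

lemma var_sem [simp]: "x \<notin> wvars c \<Longrightarrow> var (sem c s) x = var s x"
proof (induction c arbitrary: s)
  case (For z y c)
  have "var (((\<lambda>s. set_var z (Suc (var s z)) (sem c s)) ^^ k) s) x = var s x" for k s
    by (induction k) (use For in auto)
  then show ?case using For by simp
qed auto

lemma arr_sem [simp]: "A \<notin> warrs c \<Longrightarrow> arr (sem c s) A = arr s A"
proof (induction c arbitrary: s)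
  case (For z y c)
  have "arr (((\<lambda>s. set_var z (Suc (var s z)) (sem c s)) ^^ k) s) A = arr s A" for k s
    by (induction k) (use For in auto)
  then show ?case using For by simp
qed auto

text \<open>Numbers grow no faster than time: an assignment or a write raises the maximum by at most
  its own cost. So \<open>cost N c\<close> bounds both the time and the growth of the numbers, and
  one inequality on \<open>W\<close> rules out overflow.\<close>

theorem exec_compile:
  assumes "wf c" "limits c \<inter> wvars c = {}" "\<forall>y\<in>limits c. var s y \<le> N"
    "bounded M s" "M + cost N c \<le> W"
  shows "\<exists>t. exec W (compile c) s t (sem c s) \<and> t \<le> cost N c \<and> bounded (M + cost N c) (sem c s)"
  using assms
proof (induction c arbitrary: s M)
  case Nop
  then show ?case by (auto intro!: exI[of _ 1] exec.Skip[simplified] intro: bounded_mono)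
next
  case (Asg x e)
  have "exec W (Assign x e) s (1 + acost e) (set_var x (aval e s) s)"
    using Asg by (intro exec.Assign lin_afits) auto
  moreover have "bounded (M + (1 + acost e)) (set_var x (aval e s) s)"
    using Asg lin_aval[of e M s] by (intro bounded_set_var) (auto intro: bounded_mono)
  ultimately show ?case by auto
next
  case (Wrt A i j e)
  have "exec W (Write A i j e) s (1 + acost i + acost j + acost e)
      (set_arr A (aval i s) (aval j s) (aval e s) s)"
    using Wrt by (intro exec.Write lin_afits[where M = M]) auto
  moreover have "bounded (M + (1 + acost i + acost j + acost e))
      (set_arr A (aval i s) (aval j s) (aval e s) s)"
    using Wrt lin_aval[of e M s] by (intro bounded_set_arr) (auto intro: bounded_mono)
  ultimately show ?case by auto
next
  case (Sq c d)
  obtain t where t: "exec W (compile c) s t (sem c s)" "t \<le> cost N c"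
      "bounded (M + cost N c) (sem c s)"
    using Sq.IH(1)[of s M] Sq.prems by fastforce
  have "\<forall>y\<in>limits d. var (sem c s) y \<le> N"
    using Sq.prems by (auto simp: disjoint_iff)
  then obtain u where "exec W (compile d) (sem c s) u (sem d (sem c s))" "u \<le> cost N d"
      "bounded (M + cost N c + cost N d) (sem d (sem c s))"
    using Sq.IH(2)[of "sem c s" "M + cost N c"] Sq.prems t(3) by fastforce
  then show ?case
    using t by (auto intro!: exI[of _ "t + u"] exec.Seq simp: add.assoc)
next
  case (Ite b c d)
  have fits: "bfits W b s"
    using Ite.prems by (intro blin_bfits[where M = M]) auto
  show ?case
  proof (cases "bval b s")
    case True
    obtain t where "exec W (compile c) s t (sem c s)" "t \<le> cost N c"
        "bounded (M + cost N c) (sem c s)"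
      using Ite.IH(1)[of s M] Ite.prems by fastforce
    then show ?thesis
      using fits True
      by (auto intro!: exI[of _ "1 + bcost b + t"] exec.CondTrue[simplified] intro: bounded_mono)
  next
    case False
    obtain t where "exec W (compile d) s t (sem d s)" "t \<le> cost N d"
        "bounded (M + cost N d) (sem d s)"
      using Ite.IH(2)[of s M] Ite.prems by fastforce
    then show ?thesis
      using fits False
      by (auto intro!: exI[of _ "1 + bcost b + t"] exec.CondFalse[simplified] intro: bounded_mono)
  qed
next
  case (For x y c)
  define F where "F = (\<lambda>s. set_var x (Suc (var s x)) (sem c s))"
  define K where "K = var s y"
  define T where "T = cost N c + 8"
  let ?b = "Less (Var x) (Var y)"
  let ?w = "While ?b (Seq (compile c) (Assign x (Plus (Var x) (Const 1))))"
  \<comment> \<open>\<open>k\<close> rounds are still to come, so the counter stands at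
    \<open>K - k\<close>; \<open>T\<close> pays for one round with test and increment, the 4 for the
    failing test.\<close>
  have loop: "\<exists>t. exec W ?w r t ((F ^^ k) r) \<and> t \<le> k * T + 4 \<and> bounded (M' + k * T) ((F ^^ k) r)"
    if "k \<le> K" "var r x = K - k" "var r y = K" "\<forall>y\<in>limits c. var r y \<le> N" "bounded M' r"
      "M' + k * T + 4 \<le> W" for k r M'
    using that
  proof (induction k arbitrary: r M')
    case 0
    have "bfits W ?b r" using 0 by (intro blin_bfits[where M = M']) auto
    then have "exec W ?w r (1 + bcost ?b) r" using 0 by (intro exec.WhileFalse) auto
    then show ?case using 0 by auto
  next
    case (Suc k)
    have fits: "bfits W ?b r" using Suc.prems by (intro blin_bfits[where M = M']) auto
    have "M' + cost N c \<le> W" using Suc.prems by (simp add: T_def)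
    then obtain t where t: "exec W (compile c) r t (sem c r)" "t \<le> cost N c"
        "bounded (M' + cost N c) (sem c r)"
      using For.IH[of r M'] For.prems Suc.prems by (force simp: disjoint_iff)
    have x: "var (sem c r) x = var r x" using For.prems by simp
    have bF: "bounded (M' + T) (F r)"
    proof -
      have "var r x \<le> M'" using Suc.prems(5) by (simp add: bounded_def)
      then show ?thesis
        using t(3) x unfolding F_def
        by (intro bounded_set_var) (auto intro: bounded_mono simp: T_def)
    qed
    have "afits W (Plus (Var x) (Const 1)) (sem c r)"
      using t(3) Suc.prems by (intro lin_afits[where M = "M' + cost N c"]) (auto simp: T_def)
    from exec.Assign[OF this, of x] x
    have e1: "exec W (Assign x (Plus (Var x) (Const 1))) (sem c r) 4 (F r)"
      by (simp add: F_def eval_nat_numeral)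
    have lims: "\<forall>z\<in>limits c. var (F r) z \<le> N"
      using Suc.prems For.prems by (auto simp: F_def disjoint_iff)
    have vy: "var (F r) y = K"
      using Suc.prems For.prems by (auto simp: F_def disjoint_iff)
    have vx: "var (F r) x = K - k"
      using Suc.prems by (auto simp: F_def)
    obtain u where u: "exec W ?w (F r) u ((F ^^ k) (F r))" "u \<le> k * T + 4"
        "bounded (M' + T + k * T) ((F ^^ k) (F r))"
      using Suc.IH[of "F r" "M' + T"] lims vx vy bF Suc.prems by (auto simp: add.assoc)
    have "bval ?b r" using Suc.prems by simp
    then have "exec W ?w r (1 + bcost ?b + (t + 4) + u) ((F ^^ k) (F r))"
      by (rule exec.WhileTrue[OF fits _ exec.Seq[OF t(1) e1] u(1)])
    moreover have "1 + bcost ?b + (t + 4) + u \<le> Suc k * T + 4"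
      using t(2) u(2) by (simp add: T_def)
    ultimately show ?case
      using u(3) by (auto simp: funpow_swap1 add.assoc)
  qed
  have KN: "K \<le> N" using For.prems by (simp add: K_def)
  then have KT: "K * T + 6 \<le> cost N (For x y c)" by (simp add: T_def add.commute)
  have xy: "x \<noteq> y" using For.prems by auto
  have "afits W (Const 0) s" using For.prems(5) by (simp add: afits_def)
  from exec.Assign[OF this, of x]
  have e0: "exec W (Assign x (Const 0)) s 2 (set_var x 0 s)" by (simp add: numeral_2_eq_2)
  have "\<exists>t. exec W ?w (set_var x 0 s) t ((F ^^ K) (set_var x 0 s)) \<and> t \<le> K * T + 4
      \<and> bounded (M + K * T) ((F ^^ K) (set_var x 0 s))"
  proof (rule loop)
    show "M + K * T + 4 \<le> W" using For.prems(5) KT by linarith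
  qed (use For.prems xy in \<open>auto simp: K_def intro: bounded_set_var\<close>)
  then obtain t where t: "exec W ?w (set_var x 0 s) t ((F ^^ K) (set_var x 0 s))"
      "t \<le> K * T + 4" "bounded (M + K * T) ((F ^^ K) (set_var x 0 s))" by blast
  have "sem (For x y c) s = (F ^^ K) (set_var x 0 s)" by (simp add: F_def K_def)
  moreover have "2 + t \<le> cost N (For x y c)" using t(2) KT by linarith
  moreover have "bounded (M + cost N (For x y c)) ((F ^^ K) (set_var x 0 s))"
    using t(3) KT by (rule_tac bounded_mono) auto
  ultimately show ?case
    using exec.Seq[OF e0 t(1)] by (auto intro!: exI[of _ "2 + t"] simp del: cost.simps)
qed

section \<open>Cost as a polynomial in the loop bound\<close>

primrec depth :: "prog \<Rightarrow> nat" where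
  "depth Nop = 0"
| "depth (Asg x e) = 0"
| "depth (Wrt A i j e) = 0"
| "depth (c ;; d) = max (depth c) (depth d)"
| "depth (Ite b c d) = max (depth c) (depth d)"
| "depth (For x y c) = Suc (depth c)"

text \<open>Each loop contributes one factor of at most \<open>Suc N\<close>, and everything else is
  a constant of the program, so the nesting depth is the exponent.\<close>

lemma cost_le_power: "\<exists>k. \<forall>N. cost N c \<le> k * Suc N ^ depth c"
proof (induction c)
  case (Sq c d)
  then obtain k l where kl: "\<And>N. cost N c \<le> k * Suc N ^ depth c" "\<And>N. cost N d \<le> l * Suc N ^ depth d"
    by blast
  have "cost N (c ;; d) \<le> (k + l) * Suc N ^ depth (c ;; d)" for N
  proof -
    have "k * Suc N ^ depth c \<le> k * Suc N ^ depth (c ;; d)"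
      "l * Suc N ^ depth d \<le> l * Suc N ^ depth (c ;; d)"
      by (intro mult_le_mono2 power_increasing; simp)+
    with kl[of N] show ?thesis unfolding add_mult_distrib cost.simps by linarith
  qed
  then show ?case by blast
next
  case (Ite b c d)
  then obtain k l where kl: "\<And>N. cost N c \<le> k * Suc N ^ depth c" "\<And>N. cost N d \<le> l * Suc N ^ depth d"
    by blast
  have "cost N (Ite b c d) \<le> (1 + bcost b + k + l) * Suc N ^ depth (Ite b c d)" for N
  proof -
    have "k * Suc N ^ depth c \<le> k * Suc N ^ depth (Ite b c d)"
      "l * Suc N ^ depth d \<le> l * Suc N ^ depth (Ite b c d)"
      by (intro mult_le_mono2 power_increasing; simp)+
    moreover have "1 \<le> Suc N ^ depth (Ite b c d)" by (simp del: depth.simps)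
    then have "1 + bcost b \<le> (1 + bcost b) * Suc N ^ depth (Ite b c d)"
      by (metis mult.right_neutral mult_le_mono2)
    ultimately show ?thesis using kl[of N] unfolding add_mult_distrib cost.simps by linarith
  qed
  then show ?case by blast
next
  case (For x y c)
  then obtain k where k: "\<And>N. cost N c \<le> k * Suc N ^ depth c" by blast
  have "cost N (For x y c) \<le> (14 + k) * Suc N ^ depth (For x y c)" for N
  proof -
    have one: "1 \<le> Suc N ^ depth c" by simp
    \<comment> \<open>14 = 6 + 8 absorbs both constants of the loop.\<close>
    have "cost N (For x y c) \<le> Suc N * (14 + cost N c)" by (simp add: add_mult_distrib2)
    also have "\<dots> \<le> Suc N * ((14 + k) * Suc N ^ depth c)"
      using k[of N] one by (intro mult_le_mono2) (unfold add_mult_distrib, linarith)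
    finally show ?thesis by (simp add: algebra_simps)
  qed
  then show ?case by blast
qed (auto intro: exI[of _ "1::nat"])

section \<open>Invariant rules for loops\<close>

declare sem.simps(6) [simp del]

text \<open>What is known about an intermediate state of a loop without any invariant: memory that
  the program never writes keeps its contents.\<close>

definition agree :: "prog \<Rightarrow> state \<Rightarrow> state \<Rightarrow> bool" where
  "agree c s r \<longleftrightarrow> (\<forall>x. x \<notin> wvars c \<longrightarrow> var r x = var s x) \<and> (\<forall>A. A \<notin> warrs c \<longrightarrow> arr r A = arr s A)"

lemma agree_var: "agree c s r \<Longrightarrow> x \<notin> wvars c \<Longrightarrow> var r x = var s x"
  by (simp add: agree_def)

lemma agree_arr: "agree c s r \<Longrightarrow> A \<notin> warrs c \<Longrightarrow> arr r A = arr s A"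
  by (simp add: agree_def)

lemma agree_sem: "agree c S (sem c S)"
  by (simp add: agree_def)

text \<open>The step has \<open>agree\<close> at its disposal, so that an invariant can be confined
  to the memory that the loop changes.\<close>

lemma For_inv:
  assumes "x \<notin> wvars c" "y \<notin> wvars c" "x \<noteq> y"
    and init: "I 0 (set_var x 0 s)"
    and step: "\<And>k r. k < var s y \<Longrightarrow> var r x = k \<Longrightarrow> agree (For x y c) s r \<Longrightarrow> I k r \<Longrightarrow>
      I (Suc k) (set_var x (Suc k) (sem c r))"
  shows "I (var s y) (sem (For x y c) s)"
proof -
  let ?F = "\<lambda>s. set_var x (Suc (var s x)) (sem c s)"
  have "I k ((?F ^^ k) (set_var x 0 s)) \<and> var ((?F ^^ k) (set_var x 0 s)) x = k
      \<and> agree (For x y c) s ((?F ^^ k) (set_var x 0 s))" if "k \<le> var s y" for k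
    using that
  proof (induction k)
    case 0
    then show ?case using init assms(3) by (simp add: agree_def)
  next
    case (Suc k)
    then show ?case
      using step[of k "(?F ^^ k) (set_var x 0 s)"] assms by (auto simp: agree_def)
  qed
  then show ?thesis by (simp add: sem.simps(6))
qed

text \<open>A loop that runs often enough acts as a while loop with condition \<open>C\<close>: while \<open>C\<close> holds,
  \<open>\<mu>\<close> grows.\<close>

lemma For_until:
  assumes "x \<notin> wvars c" "y \<notin> wvars c" "x \<noteq> y"
    and init: "I (set_var x 0 s)"
    and step: "\<And>k r. agree (For x y c) s r \<Longrightarrow> I r \<Longrightarrow> C r \<Longrightarrow>
      I (set_var x k (sem c r)) \<and> (C (set_var x k (sem c r)) \<longrightarrow> \<mu> r < \<mu> (set_var x k (sem c r)))"
    and stop: "\<And>k r. agree (For x y c) s r \<Longrightarrow> I r \<Longrightarrow> \<not> C r \<Longrightarrow>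
      I (set_var x k (sem c r)) \<and> \<not> C (set_var x k (sem c r))"
    and bound: "\<And>r. agree (For x y c) s r \<Longrightarrow> I r \<Longrightarrow> C r \<Longrightarrow> \<mu> r < (var s y :: nat)"
  shows "I (sem (For x y c) s) \<and> \<not> C (sem (For x y c) s)"
proof -
  \<comment> \<open>While \<open>C\<close> holds, every round raises \<open>\<mu>\<close> by at
    least 1, so \<open>k \<le> \<mu> r\<close> after \<open>k\<close> rounds. After the last round
    this contradicts the bound, unless \<open>C\<close> fails.\<close>
  define J where "J = (\<lambda>k r. agree (For x y c) s r \<and> I r \<and> (C r \<longrightarrow> k \<le> \<mu> r))"
  have "J (var s y) (sem (For x y c) s)"
  proof (rule For_inv)
    show "J 0 (set_var x 0 s)" using init by (simp add: J_def agree_def)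
  next
    fix k r
    assume "var r x = k" and ag: "agree (For x y c) s r" and J: "J k r"
    have "agree (For x y c) s (set_var x (Suc k) (sem c r))"
      using ag by (auto simp: agree_def)
    then show "J (Suc k) (set_var x (Suc k) (sem c r))"
      using step[of r "Suc k"] stop[of r "Suc k"] J ag unfolding J_def by (cases "C r") auto
  qed (use assms(1-3) in auto)
  then show ?thesis using bound unfolding J_def by (meson leD)
qed

lemma arr_sem_id: "warrs c = {} \<Longrightarrow> arr (sem c s) = arr s"
  by (intro ext) simp

section \<open>Bipolar orders and the parity of paths\<close>

text \<open>\<open>l 0 e\<close> and \<open>l 1 e\<close> are the ends of the edge \<open>e\<close>
  of a multigraph; parallel edges are possible.\<close>

definition joins :: "(nat \<Rightarrow> nat \<Rightarrow> nat) \<Rightarrow> nat \<Rightarrow> nat \<Rightarrow> nat \<Rightarrow> bool" where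
  "joins l e x y \<longleftrightarrow> l 0 e = x \<and> l 1 e = y \<or> l 0 e = y \<and> l 1 e = x"

lemma joins_commute: "joins l e x y \<longleftrightarrow> joins l e y x"
  by (auto simp: joins_def)

text \<open>A walk with vertices \<open>xs\<close> and edges \<open>es\<close>; it is a path if
  \<open>xs\<close> is distinct. The edges are listed because there may be parallel ones and because
  they are what the algorithm outputs.\<close>

definition rpath :: "(nat \<Rightarrow> nat \<Rightarrow> nat) \<Rightarrow> nat set \<Rightarrow> nat list \<Rightarrow> nat list \<Rightarrow> bool" where
  "rpath l A xs es \<longleftrightarrow> length xs = Suc (length es) \<and>
     (\<forall>i < length es. es ! i \<in> A \<and> joins l (es ! i) (xs ! i) (xs ! Suc i))"

lemma rpath_Cons:
  assumes "rpath l A xs es" "e \<in> A" "joins l e x (hd xs)"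
  shows "rpath l A (x # xs) (e # es)"
proof -
  have "xs \<noteq> []" using assms(1) by (auto simp: rpath_def)
  with assms show ?thesis
    by (auto simp: rpath_def less_Suc_eq_0_disj hd_conv_nth)
qed

lemma rpath_snoc:
  assumes "rpath l A xs es" "e \<in> A" "joins l e (last xs) y"
  shows "rpath l A (xs @ [y]) (es @ [e])"
proof -
  have "xs \<noteq> []" using assms(1) by (auto simp: rpath_def)
  with assms show ?thesis
    by (auto simp: rpath_def nth_append last_conv_nth less_Suc_eq)
qed

text \<open>The arrays describe the vertices in \<open>B\<close>: \<open>rk\<close> is the rank in the linear order; for \<open>d = 0\<close> and
  \<open>d = 1\<close>, respectively, \<open>pt S d x\<close> is the chosen neighbour of \<open>x\<close> below and above \<open>x\<close>, joined to \<open>x\<close> by the edge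
  \<open>pe S d x\<close>; \<open>dp S d x\<close> is the number of steps from \<open>x\<close> along \<open>pt S d\<close> to \<open>s\<close> and to \<open>t\<close>; and
  \<open>pa S d x\<close> is its parity.\<close>

abbreviation "rk S \<equiv> arr S ''rk'' 0"
abbreviation "pt S \<equiv> arr S ''P''"
abbreviation "pe S \<equiv> arr S ''E''"
abbreviation "dp S \<equiv> arr S ''dp''"
abbreviation "pa S \<equiv> arr S ''pa''"

text \<open>Direction 1 reverses the order, so that descending towards \<open>s\<close> and
  ascending towards \<open>t\<close> are covered by the same lemmas.\<close>

definition lt :: "nat \<Rightarrow> state \<Rightarrow> nat \<Rightarrow> nat \<Rightarrow> bool" where
  "lt d S x y \<longleftrightarrow> (if d = 0 then rk S x < rk S y else rk S y < rk S x)"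

locale terminals =
  fixes n m :: nat and l :: "nat \<Rightarrow> nat \<Rightarrow> nat" and A :: "nat set" and s t :: nat
  assumes edges_less: "e \<in> A \<Longrightarrow> e < n"
    and ends_less: "e \<in> A \<Longrightarrow> l 0 e < m \<and> l 1 e < m"
    and no_loop: "e \<in> A \<Longrightarrow> l 0 e \<noteq> l 1 e"
    and st: "s < m" "t < m" "s \<noteq> t"
begin

lemma joins_less: "e \<in> A \<Longrightarrow> joins l e x y \<Longrightarrow> x < m \<and> y < m"
  using ends_less by (auto simp: joins_def)

section \<open>Edges that lie on no path between the terminals\<close>

definition dead :: "nat \<Rightarrow> bool" where
  "dead e \<longleftrightarrow> (\<exists>u w K. joins l e u w \<and> w \<in> K \<and> u \<notin> K \<and> s \<notin> K \<and> t \<notin> K \<and>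
     (\<forall>f \<in> A. \<forall>x y. joins l f x y \<longrightarrow> x \<in> K \<longrightarrow> y \<in> K \<or> y = u))"

text \<open>Edges leave \<open>K\<close> only towards \<open>u\<close>. A path that takes the edge
  from \<open>u\<close> into \<open>K\<close> cannot return to \<open>u\<close>, so it is caught in
  \<open>K\<close> and never reaches \<open>t\<close>. If it takes the edge from \<open>K\<close> to
  \<open>u\<close>, the same argument applies backwards, towards \<open>s\<close>.\<close>

lemma dead_not_on_path:
  assumes path: "rpath l A xs es" "distinct xs" "hd xs = s" "last xs = t" and i: "i < length es"
  shows "\<not> dead (es ! i)"
proof
  assume "dead (es ! i)"
  then obtain u w K where K: "joins l (es ! i) u w" "w \<in> K" "u \<notin> K" "s \<notin> K" "t \<notin> K"
      and closed: "\<And>f x y. f \<in> A \<Longrightarrow> joins l f x y \<Longrightarrow> x \<in> K \<Longrightarrow> y \<in> K \<or> y = u"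
    unfolding dead_def by blast
  have len: "length xs = Suc (length es)" and
    edge: "\<And>j. j < length es \<Longrightarrow> es ! j \<in> A \<and> joins l (es ! j) (xs ! j) (xs ! Suc j)"
    using path(1) by (auto simp: rpath_def)
  then have "xs \<noteq> []" by auto
  then have ends: "xs ! 0 = s" "xs ! length es = t"
    using path(3,4) len by (auto simp: hd_conv_nth last_conv_nth)
  have "joins l (es ! i) (xs ! i) (xs ! Suc i)" using edge i by blast
  with K(1) consider "u = xs ! i" "w = xs ! Suc i" | "u = xs ! Suc i" "w = xs ! i"
    by (auto simp: joins_def)
  then show False
  proof cases
    case 1
    have "xs ! j \<in> K" if "Suc i \<le> j" "j \<le> length es" for j
      using that
    proof (induction j rule: dec_induct)
      case base
      then show ?case using K 1 by simp
    next
      case (step j)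
      then have "xs ! Suc j \<noteq> xs ! i" using path(2) len i by (simp add: nth_eq_iff_index_eq)
      with step show ?case using closed[of "es ! j" "xs ! j" "xs ! Suc j"] edge[of j] 1 by auto
    qed
    with i ends K(5) show False by (metis Suc_leI le_refl)
  next
    case 2
    have "xs ! (i - j) \<in> K" if "j \<le> i" for j
      using that
    proof (induction j)
      case 0
      then show ?case using K 2 by simp
    next
      case (Suc j)
      define k where "k = i - Suc j"
      have k: "Suc k = i - j" "k < length es" using Suc.prems i by (auto simp: k_def)
      then have "xs ! k \<noteq> xs ! Suc i" using path(2) len i by (auto simp: nth_eq_iff_index_eq)
      then show ?case
        using closed[of "es ! k" "xs ! Suc k" "xs ! k"] edge[of k] Suc k 2
        by (auto simp: joins_commute k_def)
    qed
    from this[of i] ends K(4) show False by simp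
  qed
qed

section \<open>Bipolar orders and the 2-colouring\<close>

definition inB :: "state \<Rightarrow> nat set" where
  "inB S = {x. x < m \<and> arr S ''B'' 0 x = 1}"

text \<open>No order is involved, so that this also describes the tree edges of a search outside
  \<open>B\<close>; the step count makes links acyclic.\<close>

definition linked :: "state \<Rightarrow> nat \<Rightarrow> nat \<Rightarrow> bool" where
  "linked S d x \<longleftrightarrow> pe S d x \<in> A \<and> joins l (pe S d x) x (pt S d x) \<and> dp S d x = Suc (dp S d (pt S d x))"

definition rooted :: "state \<Rightarrow> nat \<Rightarrow> nat \<Rightarrow> bool" where
  "rooted S d x \<longleftrightarrow> linked S d x \<and> pt S d x \<in> inB S \<and> lt d S (pt S d x) x"

text \<open>The part of bipolarity that stays true in the middle of an insertion, when one vertex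
  may lack a proper link.\<close>

definition framed :: "state \<Rightarrow> bool" where
  "framed S \<longleftrightarrow> s \<in> inB S \<and> t \<in> inB S \<and> inj_on (rk S) (inB S) \<and>
     (\<forall>x \<in> inB S. rk S s \<le> rk S x \<and> rk S x \<le> rk S t) \<and> dp S 0 s = 0 \<and> dp S 1 t = 0 \<and>
     (\<forall>d \<le> 1. \<forall>x \<in> inB S. pa S d x = dp S d x mod 2)"

definition bipolar :: "state \<Rightarrow> bool" where
  "bipolar S \<longleftrightarrow> framed S \<and> (\<forall>d \<le> 1. \<forall>x \<in> inB S - {s, t}. rooted S d x)"

text \<open>For an edge with \<open>x\<close> below \<open>y \<noteq> t\<close>, consistency of the
  edge from \<open>y\<close> to its upper neighbour makes the descent parity of \<open>y\<close>
  opposite to its ascent parity, and the latter is the descent parity of \<open>x\<close>. So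
  descent parity is a proper colouring. A path cannot leave \<open>B\<close>, since edges out of
  \<open>B\<close> are dead, and its colours alternate from 0 at \<open>s\<close> to 1 at
  \<open>t\<close>.\<close>

lemma all_paths_odd:
  assumes bip: "bipolar S"
    and processed: "\<And>e x y. e \<in> A \<Longrightarrow> joins l e x y \<Longrightarrow> x \<in> inB S \<Longrightarrow> y \<in> inB S \<or> dead e"
    and cons: "\<And>e x y. e \<in> A \<Longrightarrow> joins l e x y \<Longrightarrow> x \<in> inB S \<Longrightarrow> y \<in> inB S \<Longrightarrow>
      rk S x < rk S y \<Longrightarrow> pa S 0 x = pa S 1 y"
    and path: "rpath l A xs es" "distinct xs" "hd xs = s" "last xs = t"
  shows "odd (length es)"
proof -
  have frm: "framed S" using bip by (simp add: bipolar_def)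
  \<comment> \<open>\<open>t\<close> has no chosen neighbour below it, so its colour is
    prescribed.\<close>
  define c where "c x = (if x = t then 1 else pa S 0 x)" for x
  have len: "length xs = Suc (length es)" and
    edge: "\<And>j. j < length es \<Longrightarrow> es ! j \<in> A \<and> joins l (es ! j) (xs ! j) (xs ! Suc j)"
    using path(1) by (auto simp: rpath_def)
  then have "xs \<noteq> []" by auto
  then have ends: "xs ! 0 = s" "xs ! length es = t"
    using path(3,4) len by (auto simp: hd_conv_nth last_conv_nth)
  have color: "c x \<noteq> c y \<and> c x \<le> 1 \<and> c y \<le> 1"
    if e: "e \<in> A" "joins l e x y" "x \<in> inB S" "y \<in> inB S" "rk S x < rk S y" for e x y
  proof -
    have xt: "x \<noteq> t" using frm e unfolding framed_def by (metis leD)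
    have ys: "y \<noteq> s" using frm e unfolding framed_def by (metis leD)
    have p: "pa S 0 x = dp S 0 x mod 2" "pa S 0 y = dp S 0 y mod 2" "pa S 1 y = dp S 1 y mod 2"
      using frm e by (auto simp: framed_def)
    have eq: "pa S 0 x = pa S 1 y" using cons e by blast
    show ?thesis
    proof (cases "y = t")
      case True
      then show ?thesis using frm xt eq p by (auto simp: c_def framed_def)
    next
      case False
      then have r: "rooted S 1 y" using bip ys e by (auto simp: bipolar_def)
      let ?z = "pt S 1 y"
      have "pa S 0 y = pa S 1 ?z"
        using r cons[of "pe S 1 y" y ?z] e by (auto simp: rooted_def linked_def lt_def)
      moreover have "pa S 1 ?z = dp S 1 ?z mod 2"
        using r frm by (auto simp: rooted_def framed_def)
      moreover have "dp S 1 y = Suc (dp S 1 ?z)"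
        using r by (simp add: rooted_def linked_def)
      ultimately show ?thesis using xt False eq p by (auto simp: c_def) presburger
    qed
  qed
  have "xs ! j \<in> inB S \<and> c (xs ! j) = j mod 2" if "j \<le> length es" for j
    using that
  proof (induction j)
    case 0
    then show ?case using frm ends st by (auto simp: framed_def c_def)
  next
    case (Suc j)
    then have x: "xs ! j \<in> inB S" "c (xs ! j) = j mod 2" and j: "j < length es" by auto
    note e = edge[OF j]
    have y: "xs ! Suc j \<in> inB S"
      using processed[of "es ! j" "xs ! j" "xs ! Suc j"] dead_not_on_path[OF path j] e x by blast
    have "xs ! j \<noteq> xs ! Suc j" using path(2) len j by (simp add: nth_eq_iff_index_eq)
    then have "rk S (xs ! j) \<noteq> rk S (xs ! Suc j)"
      using frm x y by (auto simp: framed_def inj_on_def)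
    then have "c (xs ! j) \<noteq> c (xs ! Suc j) \<and> c (xs ! j) \<le> 1 \<and> c (xs ! Suc j) \<le> 1"
      using color[of "es ! j" "xs ! j" "xs ! Suc j"] color[of "es ! j" "xs ! Suc j" "xs ! j"] e x y
      by (metis joins_commute nat_neq_iff)
    with x y show ?case by auto presburger
  qed
  from this[of "length es"] ends show ?thesis by (auto simp: c_def odd_iff_mod_2_eq_one)
qed

text \<open>During the insertion of an ear, \<open>V\<close> is the search tree below \<open>u\<close>, entered at \<open>w\<close>; the part of the ear from
  \<open>y\<close> onwards has been inserted just above \<open>u\<close> (with respect to the direction \<open>d\<close>), and \<open>x\<close> is the
  next vertex.\<close>

definition tree :: "state \<Rightarrow> nat set \<Rightarrow> nat \<Rightarrow> nat \<Rightarrow> nat \<Rightarrow> bool" where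
  "tree S V u w d \<longleftrightarrow> u \<notin> V \<and> s \<notin> V \<and> t \<notin> V \<and>
     (\<forall>z \<in> V. z < m \<and> linked S d z \<and> (z = w \<and> pt S d z = u \<or> pt S d z \<in> V) \<and>
       pa S d z = dp S d z mod 2)"

definition inserting :: "nat set \<Rightarrow> nat \<Rightarrow> nat \<Rightarrow> nat \<Rightarrow> nat \<Rightarrow> nat \<Rightarrow> nat \<Rightarrow> state \<Rightarrow> bool" where
  "inserting V u w d x y g S \<longleftrightarrow> framed S \<and> tree S V u w d \<and> d \<le> 1 \<and> u \<in> inB S \<and> y \<in> inB S \<and>
     lt d S u y \<and> g \<in> A \<and> joins l g x y \<and> (x = u \<and> w \<in> inB S \<or> x \<in> V \<and> x \<notin> inB S) \<and>
     (\<forall>z \<in> V \<inter> inB S. dp S d x < dp S d z) \<and>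
     (\<forall>z \<in> inB S - {s, t}. rooted S (1 - d) z \<and> (rooted S d z \<or> z = y \<and> z \<in> V \<and> pt S d z = x))"

text \<open>Once \<open>x\<close> has arrived at \<open>u\<close>, the only vertex whose link in
  direction \<open>d\<close> may still be pending is \<open>y\<close>. It is then linked to
  \<open>u\<close>, which lies below it in direction \<open>d\<close>, so all links are in
  order.\<close>

lemma inserting_finish:
  assumes ins: "inserting V u w d u y g S"
  shows "bipolar S" "w \<in> inB S"
proof -
  have "rooted S d z" if "z \<in> inB S - {s, t}" for z
  proof (cases "z = y \<and> z \<in> V \<and> pt S d z = u")
    case True
    then show ?thesis using ins by (auto simp: inserting_def rooted_def tree_def)
  next
    case False
    then show ?thesis using ins that unfolding inserting_def by blast
  qed
  moreover have "rooted S (1 - d) z" if "z \<in> inB S - {s, t}" for z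
    using ins that unfolding inserting_def by blast
  moreover have "e = d \<or> e = 1 - d" if "e \<le> 1" for e
    using that ins unfolding inserting_def by auto
  ultimately show "bipolar S" using ins unfolding bipolar_def inserting_def by metis
  show "w \<in> inB S" using ins by (auto simp: inserting_def tree_def)
qed

text \<open>\<open>x\<close> is placed immediately above \<open>u\<close> in direction
  \<open>d\<close>. Its link in direction \<open>1 - d\<close> goes to \<open>y\<close>, a pending
  tree link from \<open>y\<close> to \<open>x\<close> becomes proper, and the tree link of
  \<open>x\<close> is the only one now pending.\<close>

lemma inserting_step:
  assumes ins: "inserting V u w d x y g S" and x: "x \<noteq> u"
    \<comment> \<open>For \<open>d = 0\<close> the new rank is the one after \<open>u\<close>; for
      \<open>d = 1\<close> the new vertex takes the rank of \<open>u\<close>, and \<open>u\<close>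
      itself is shifted.\<close>
    and r: "r = (if d = 0 then Suc (rk S u) else rk S u)"
    and B: "inB S' = insert x (inB S)"
    and rank: "\<And>z. z \<in> inB S \<Longrightarrow> rk S' z = (if r \<le> rk S z then Suc (rk S z) else rk S z)"
      "rk S' x = r"
    and upd: "pt S' = (pt S)(1 - d := (pt S (1 - d))(x := y))"
      "pe S' = (pe S)(1 - d := (pe S (1 - d))(x := g))"
      "dp S' = (dp S)(1 - d := (dp S (1 - d))(x := Suc (dp S (1 - d) y)))"
      "pa S' = (pa S)(1 - d := (pa S (1 - d))(x := 1 - pa S (1 - d) y))"
  shows "inserting V u w d (pt S d x) x (pe S d x) S'"
proof -
  let ?d = "1 - d"
  have frm: "framed S" and tr: "tree S V u w d" and d1: "d \<le> 1"
    and uy: "u \<in> inB S" "y \<in> inB S" "lt d S u y" and g: "g \<in> A" "joins l g x y"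
    and xV: "x \<in> V" "x \<notin> inB S" and dpx: "\<And>z. z \<in> V \<Longrightarrow> z \<in> inB S \<Longrightarrow> dp S d x < dp S d z"
    and root: "\<And>z. z \<in> inB S \<Longrightarrow> z \<noteq> s \<Longrightarrow> z \<noteq> t \<Longrightarrow>
      rooted S ?d z \<and> (rooted S d z \<or> z = y \<and> z \<in> V \<and> pt S d z = x)"
    using ins x unfolding inserting_def by auto
  have d: "d \<le> 1" "?d \<noteq> d" using d1 by presburger+
  have xm: "x < m" "x \<noteq> s" "x \<noteq> t" and lx: "linked S d x" "x = w \<and> pt S d x = u \<or> pt S d x \<in> V"
      "pa S d x = dp S d x mod 2" and uV: "u \<notin> V"
    using tr xV by (auto simp: tree_def)
  have mono: "rk S' z < rk S' w \<longleftrightarrow> rk S z < rk S w" if "z \<in> inB S" "w \<in> inB S" for z w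
    using that by (auto simp: rank)
  have inj: "inj_on (rk S) (inB S)" using frm by (simp add: framed_def)
  have st': "s \<in> inB S" "t \<in> inB S" "\<And>z. z \<in> inB S \<Longrightarrow> rk S s \<le> rk S z \<and> rk S z \<le> rk S t"
    using frm by (auto simp: framed_def)
  have ltd: "lt e S' z w \<longleftrightarrow> lt e S z w" if "z \<in> inB S" "w \<in> inB S" for e z w
    using mono that by (simp add: lt_def)
  have ux: "lt d S' u x" using uy by (auto simp: lt_def rank r)
  \<comment> \<open>No vertex of \<open>B\<close> lies between \<open>u\<close> and
    \<open>x\<close>, so whatever is above \<open>u\<close> is above \<open>x\<close>.\<close>
  have xz: "lt d S' x z" if "z \<in> inB S" "lt d S u z" for z
    using that by (auto simp: lt_def rank r split: if_splits)
  have old: "pt S' e z = pt S e z" "pe S' e z = pe S e z" "dp S' e z = dp S e z" "pa S' e z = pa S e z"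
    if "z \<noteq> x \<or> e = d" for e z
    using that d by (auto simp: upd)
  have "framed S'"
    unfolding framed_def
  proof (intro conjI allI impI ballI)
    show "inj_on (rk S') (inB S')"
    proof (rule inj_onI)
      fix z w
      assume z: "z \<in> inB S'" "w \<in> inB S'" "rk S' z = rk S' w"
      have nr: "rk S' z \<noteq> r" if "z \<in> inB S" for z
        using that by (auto simp: rank)
      have "z = w" if "z \<in> inB S" "w \<in> inB S"
      proof -
        have "rk S z = rk S w" using mono[of z w] mono[of w z] that z(3) by simp
        then show ?thesis using inj that by (simp add: inj_on_def)
      qed
      then show "z = w" using z nr[of z] nr[of w] rank(2) unfolding B by fastforce
    qed
    fix z assume z: "z \<in> inB S'"
    have *: "rk S s < r" "r \<le> rk S t"
      using uy st'(3)[OF uy(1)] st'(3)[OF uy(2)] by (auto simp: r lt_def split: if_splits)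
    show "rk S' s \<le> rk S' z" "rk S' z \<le> rk S' t"
      using z * st' by (auto simp: B rank)
  next
    fix e :: nat and z
    assume e: "e \<le> 1" and z: "z \<in> inB S'"
    show "pa S' e z = dp S' e z mod 2"
    proof (cases "z = x")
      case True
      have "pa S ?d y = dp S ?d y mod 2" using frm uy by (auto simp: framed_def)
      moreover have "e = d \<or> e = ?d" using e d by auto
      ultimately show ?thesis using True lx(3) old d by (auto simp: upd) presburger
    next
      case False
      then show ?thesis using z e frm old by (auto simp: B framed_def)
    qed
  qed (use st' frm xm in \<open>auto simp: B old framed_def\<close>)
  moreover have link: "linked S' e z" if "linked S e z" "z \<noteq> x" "e \<noteq> d \<longrightarrow> pt S e z \<noteq> x" for e z
    using that old unfolding linked_def by metis
  have linkd: "linked S' d z" if "linked S d z" for z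
    using that old unfolding linked_def by metis
  have "tree S' V u w d"
    using tr linkd old unfolding tree_def by metis
  moreover have "rooted S' ?d x"
    using g uy xz d xV by (auto simp: rooted_def linked_def upd B lt_def split: if_splits)
  moreover have "rooted S' ?d z" if "z \<in> inB S" "z \<noteq> s" "z \<noteq> t" for z
  proof -
    have "z \<noteq> x" "rooted S ?d z" using that xV root by auto
    moreover from this have "pt S ?d z \<noteq> x" using xV by (auto simp: rooted_def)
    ultimately show ?thesis using link[of ?d z] ltd that by (auto simp: rooted_def old B)
  qed
  moreover have "rooted S' d z" if z: "z \<in> inB S" "z \<noteq> s" "z \<noteq> t" for z
  proof -
    consider "rooted S d z" | "z = y" "z \<in> V" "pt S d z = x" using root[OF z] by blast
    then show ?thesis
    proof cases
      case 1
      then show ?thesis using linkd[of z] ltd z by (auto simp: rooted_def old B)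
    next
      case 2
      then have "linked S d z" using tr by (simp add: tree_def)
      then show ?thesis using linkd[of z] 2 xz[OF uy(2,3)] by (auto simp: rooted_def old B)
    qed
  qed
  moreover have dpless: "dp S d (pt S d x) < dp S d x" using lx by (simp add: linked_def)
  \<comment> \<open>Tree vertices inserted so far have larger \<open>dp\<close> than
    \<open>x\<close>, whereas the parent of \<open>x\<close> has smaller \<open>dp\<close>. So a
    parent in the tree is not yet in \<open>B\<close>.\<close>
  moreover have "pt S d x = u \<and> w \<in> inB S' \<or> pt S d x \<in> V \<and> pt S d x \<notin> inB S'"
  proof -
    have "pt S d x \<notin> inB S'" if "pt S d x \<in> V"
      using that dpx[of "pt S d x"] dpless by (auto simp: B)
    then show ?thesis using lx(2) by (auto simp: B)
  qed
  moreover have "dp S' d (pt S d x) < dp S' d z" if "z \<in> V" "z \<in> inB S'" for z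
    using that dpx[of z] dpless by (auto simp: B old)
  moreover have "pe S d x \<in> A" "joins l (pe S d x) (pt S d x) x"
    using lx by (auto simp: linked_def joins_commute)
  ultimately show ?thesis
    using d ux uy xV old by (auto simp: inserting_def B)
qed

end

section \<open>Programs that grow a bipolar order\<close>

abbreviation is1 :: "string \<Rightarrow> aexp \<Rightarrow> bexp" where
  "is1 A e \<equiv> Eq (Read A (Const 0) e) (Const 1)"

abbreviation lab :: "nat \<Rightarrow> string \<Rightarrow> aexp" where
  "lab j e \<equiv> Read ''l'' (Const j) (Var e)"

definition set_link :: "string \<Rightarrow> string \<Rightarrow> string \<Rightarrow> nat \<Rightarrow> prog" where
  "set_link y x g d =
     Wrt ''P'' (Const d) (Var y) (Var x) ;;
     Wrt ''E'' (Const d) (Var y) (Var g) ;;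
     Wrt ''dp'' (Const d) (Var y) (Plus (Read ''dp'' (Const d) (Var x)) (Const 1)) ;;
     Wrt ''pa'' (Const d) (Var y) (Minus (Const 1) (Read ''pa'' (Const d) (Var x)))"

definition cross_test :: prog where
  "cross_test =
     Ite (is1 ''al'' (Var ''f''))
       (Ite (Conj (is1 ''vi'' (lab 0 ''f'')) (Conj (Neg (is1 ''vi'' (lab 1 ''f''))) (Neg (Eq (lab 1 ''f'') (Var ''u'')))))
         (Asg ''g'' (Var ''f'') ;; Asg ''x'' (lab 0 ''f'') ;; Asg ''y'' (lab 1 ''f''))
       (Ite (Conj (is1 ''vi'' (lab 1 ''f'')) (Conj (Neg (is1 ''vi'' (lab 0 ''f''))) (Neg (Eq (lab 0 ''f'') (Var ''u'')))))
         (Asg ''g'' (Var ''f'') ;; Asg ''x'' (lab 1 ''f'') ;; Asg ''y'' (lab 0 ''f''))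
       Nop))
     Nop"

text \<open>Edges have numbers below \<open>n\<close>, so \<open>g = n\<close> can mean that no edge
  leaves the tree.\<close>

definition cross_edge :: prog where
  "cross_edge = Asg ''g'' (Var ''n'') ;; For ''f'' ''n'' cross_test"

text \<open>A new tree vertex is linked in both directions, since the far end of the ear, and with
  it the direction of insertion, is not known yet. After a success, or when no edge is left, a round
  leaves the arrays alone.\<close>

definition search_step :: prog where
  "search_step =
     Ite (Eq (Var ''fd'') (Const 0))
       (cross_edge ;;
        Ite (Less (Var ''g'') (Var ''n''))
          (Ite (is1 ''B'' (Var ''y'')) (Asg ''fd'' (Const 1))
             (Wrt ''vi'' (Const 0) (Var ''y'') (Const 1) ;;
              set_link ''y'' ''x'' ''g'' 0 ;; set_link ''y'' ''x'' ''g'' 1))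
          Nop)
       Nop"

definition search :: prog where
  "search =
     For ''i'' ''m'' (Wrt ''vi'' (Const 0) (Var ''i'') (Const 0)) ;;
     Wrt ''vi'' (Const 0) (Var ''w'') (Const 1) ;;
     set_link ''w'' ''u'' ''e'' 0 ;; set_link ''w'' ''u'' ''e'' 1 ;;
     Asg ''fd'' (Const 0) ;;
     For ''i'' ''m'' search_step"

definition shift :: prog where
  "shift =
     For ''k'' ''m'' (Ite (Less (Read ''rk'' (Const 0) (Var ''k'')) (Var ''r'')) Nop
       (Wrt ''rk'' (Const 0) (Var ''k'') (Plus (Read ''rk'' (Const 0) (Var ''k'')) (Const 1))))"

text \<open>With \<open>x = u\<close> the ear is complete, and further rounds are idle.\<close>

definition insert_step :: prog where
  "insert_step =
     Ite (Eq (Var ''x'') (Var ''u'')) Nop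
       (Wrt ''P'' (Var ''c'') (Var ''x'') (Var ''y'') ;;
        Wrt ''E'' (Var ''c'') (Var ''x'') (Var ''g'') ;;
        Wrt ''dp'' (Var ''c'') (Var ''x'') (Plus (Read ''dp'' (Var ''c'') (Var ''y'')) (Const 1)) ;;
        Wrt ''pa'' (Var ''c'') (Var ''x'') (Minus (Const 1) (Read ''pa'' (Var ''c'') (Var ''y''))) ;;
        Wrt ''B'' (Const 0) (Var ''x'') (Const 1) ;;
        Asg ''r'' (Read ''rk'' (Const 0) (Var ''u'')) ;;
        Ite (Eq (Var ''d'') (Const 0)) (Asg ''r'' (Plus (Var ''r'') (Const 1))) Nop ;;
        shift ;;
        Wrt ''rk'' (Const 0) (Var ''x'') (Var ''r'') ;;
        Asg ''g'' (Read ''E'' (Var ''d'') (Var ''x'')) ;;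
        Asg ''y'' (Var ''x'') ;;
        Asg ''x'' (Read ''P'' (Var ''d'') (Var ''x'')))"

definition insert_ear :: prog where
  "insert_ear =
     Ite (Less (Read ''rk'' (Const 0) (Var ''u'')) (Read ''rk'' (Const 0) (Var ''y'')))
       (Asg ''d'' (Const 0)) (Asg ''d'' (Const 1)) ;;
     Asg ''c'' (Minus (Const 1) (Var ''d'')) ;;
     For ''i'' ''m'' insert_step"

definition pick_test :: prog where
  "pick_test =
     Ite (Conj (is1 ''al'' (Var ''f'')) (Neg (is1 ''dn'' (Var ''f''))))
       (Ite (is1 ''B'' (lab 0 ''f'')) (Asg ''e'' (Var ''f'') ;; Asg ''u'' (lab 0 ''f'') ;; Asg ''w'' (lab 1 ''f''))
       (Ite (is1 ''B'' (lab 1 ''f'')) (Asg ''e'' (Var ''f'') ;; Asg ''u'' (lab 1 ''f'') ;; Asg ''w'' (lab 0 ''f''))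
       Nop)) Nop"

definition pick :: prog where
  "pick = Asg ''e'' (Var ''n'') ;; For ''f'' ''n'' pick_test"

text \<open>Every picked edge is marked in \<open>dn\<close>, so it starts at most one search. This
  keeps the number of quadratic searches linear.\<close>

definition grow :: prog where
  "grow =
     pick ;;
     Ite (Less (Var ''e'') (Var ''n''))
       (Wrt ''dn'' (Const 0) (Var ''e'') (Const 1) ;;
        Ite (is1 ''B'' (Var ''w'')) Nop
          (search ;; Ite (Eq (Var ''fd'') (Const 1)) insert_ear Nop))
       Nop"

section \<open>Memory written by the growing programs\<close>

lemma writes_set_link [simp]:
  "wvars (set_link y x g d) = {}" "warrs (set_link y x g d) = {''P'', ''E'', ''dp'', ''pa''}"
  by (auto simp: set_link_def)

lemma writes_cross_test [simp]:
  "wvars cross_test = {''g'', ''x'', ''y''}" "warrs cross_test = {}"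
  by (auto simp: cross_test_def)

lemma writes_cross_edge [simp]:
  "wvars cross_edge = {''g'', ''f'', ''x'', ''y''}" "warrs cross_edge = {}"
  by (auto simp: cross_edge_def)

lemma writes_search_step [simp]:
  "wvars search_step = {''g'', ''f'', ''x'', ''y'', ''fd''}"
  "warrs search_step = {''vi'', ''P'', ''E'', ''dp'', ''pa''}"
  by (auto simp: search_step_def)

lemma writes_search [simp]:
  "wvars search = {''i'', ''g'', ''f'', ''x'', ''y'', ''fd''}"
  "warrs search = {''vi'', ''P'', ''E'', ''dp'', ''pa''}"
  by (auto simp: search_def)

lemma writes_shift [simp]: "wvars shift = {''k''}" "warrs shift = {''rk''}"
  by (auto simp: shift_def)

lemma writes_insert_step [simp]:
  "wvars insert_step = {''r'', ''k'', ''g'', ''x'', ''y''}"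
  "warrs insert_step = {''P'', ''E'', ''dp'', ''pa'', ''B'', ''rk''}"
  by (auto simp: insert_step_def)

lemma writes_insert_ear [simp]:
  "wvars insert_ear = {''d'', ''c'', ''i'', ''r'', ''k'', ''g'', ''x'', ''y''}"
  "warrs insert_ear = {''P'', ''E'', ''dp'', ''pa'', ''B'', ''rk''}"
  by (auto simp: insert_ear_def)

lemma writes_pick_test [simp]: "wvars pick_test = {''e'', ''u'', ''w''}" "warrs pick_test = {}"
  by (auto simp: pick_test_def)

lemma writes_pick [simp]: "wvars pick = {''e'', ''f'', ''u'', ''w''}" "warrs pick = {}"
  by (auto simp: pick_def)

lemma writes_grow [simp]:
  "wvars grow = {''e'', ''f'', ''u'', ''w'', ''i'', ''g'', ''x'', ''y'', ''fd'', ''d'', ''c'', ''r'', ''k''}"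
  "warrs grow = {''dn'', ''vi'', ''P'', ''E'', ''dp'', ''pa'', ''B'', ''rk''}"
  by (auto simp: grow_def)

lemma sem_shift:
  "rk (sem shift S) z =
     (if z < var S ''m'' \<and> var S ''r'' \<le> rk S z then Suc (rk S z) else rk S z)"
proof -
  have "\<forall>z. rk (sem shift S) z =
     (if z < var S ''m'' \<and> var S ''r'' \<le> rk S z then Suc (rk S z) else rk S z)"
    unfolding shift_def
  proof (rule For_inv[where I = "\<lambda>k R. \<forall>z. rk R z =
     (if z < k \<and> var S ''r'' \<le> rk S z then Suc (rk S z) else rk S z)"], goal_cases)
    case (5 k R)
    from agree_var[OF 5(3), of "''r''"] 5 show ?case by (auto simp: less_Suc_eq)
  qed auto
  then show ?thesis by blast
qed

lemma sem_set_link [simp]: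
  "pt (sem (set_link y x g d) S) = (pt S)(d := (pt S d)(var S y := var S x))"
  "pe (sem (set_link y x g d) S) = (pe S)(d := (pe S d)(var S y := var S g))"
  "dp (sem (set_link y x g d) S) = (dp S)(d := (dp S d)(var S y := Suc (dp S d (var S x))))"
  "pa (sem (set_link y x g d) S) = (pa S)(d := (pa S d)(var S y := 1 - pa S d (var S x)))"
  by (simp_all add: set_link_def)

section \<open>Correctness of search, insertion and growth\<close>

context terminals
begin

definition env :: "state \<Rightarrow> bool" where
  "env S \<longleftrightarrow> var S ''n'' = n \<and> var S ''m'' = m \<and> var S ''s'' = s \<and> var S ''t'' = t \<and>
     arr S ''l'' = l \<and> (\<forall>e < n. arr S ''al'' 0 e = 1 \<longleftrightarrow> e \<in> A)"

lemma env_sem: "env S \<Longrightarrow> {''n'', ''m'', ''s'', ''t''} \<inter> wvars c = {} \<Longrightarrow> {''l'', ''al''} \<inter> warrs c = {} \<Longrightarrow>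
  env (sem c S)"
  by (simp add: env_def)

lemma env_agree: "env S \<Longrightarrow> agree c S R \<Longrightarrow> {''n'', ''m'', ''s'', ''t''} \<inter> wvars c = {} \<Longrightarrow>
  {''l'', ''al''} \<inter> warrs c = {} \<Longrightarrow> env R"
  by (simp add: env_def agree_def)

definition visited :: "state \<Rightarrow> nat set" where
  "visited S = {x. x < m \<and> arr S ''vi'' 0 x = 1}"

lemma arr_eqD:
  assumes "arr S' = arr S"
  shows "inB S' = inB S" "visited S' = visited S" "bipolar S' = bipolar S"
    "tree S' V u w d = tree S V u w d"
proof -
  show "inB S' = inB S" "visited S' = visited S"
    by (simp_all add: inB_def visited_def assms)
  then show "bipolar S' = bipolar S" "tree S' V u w d = tree S V u w d"
    by (simp_all add: bipolar_def framed_def rooted_def linked_def lt_def tree_def assms)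
qed

lemma cross_edge:
  fixes S
  defines "S' \<equiv> sem cross_edge S"
  assumes env: "env S"
  shows "var S' ''g'' = n \<and>
      (\<forall>f\<in>A. \<forall>x y. joins l f x y \<longrightarrow> x \<in> visited S \<longrightarrow> y \<in> visited S \<or> y = var S ''u'')
    \<or> var S' ''g'' < n \<and> var S' ''g'' \<in> A \<and> joins l (var S' ''g'') (var S' ''x'') (var S' ''y'') \<and>
      var S' ''x'' \<in> visited S \<and> var S' ''y'' \<notin> visited S \<and> var S' ''y'' \<noteq> var S ''u''"
proof -
  define ok where "ok f \<longleftrightarrow> (\<forall>x y. joins l f x y \<longrightarrow> x \<in> visited S \<longrightarrow> y \<in> visited S \<or> y = var S ''u'')" for f
  define I where "I k R \<longleftrightarrow> var R ''g'' = n \<and>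
      (\<forall>f\<in>A. f < k \<longrightarrow> ok f)
    \<or> var R ''g'' < n \<and> var R ''g'' \<in> A \<and> joins l (var R ''g'') (var R ''x'') (var R ''y'') \<and>
      var R ''x'' \<in> visited S \<and> var R ''y'' \<notin> visited S \<and> var R ''y'' \<noteq> var S ''u''" for k and R :: state
  have n: "var S ''n'' = n" using env by (simp add: env_def)
  have "I (var (set_var ''g'' n S) ''n'') S'"
    unfolding S'_def cross_edge_def sem.simps(2,4) aval.simps n
  proof (rule For_inv[where I = I], goal_cases)
    case (5 k R)
    have "var R ''u'' = var S ''u''" by (subst agree_var[OF 5(3)]) simp_all
    moreover have "arr R ''vi'' = arr S ''vi''" by (subst agree_arr[OF 5(3)]) simp_all
    moreover have "env (set_var ''g'' n S)" using env by (simp add: env_def)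
    then have "env R" by (rule env_agree[OF _ 5(3)]) simp_all
    then have "arr R ''l'' = l" "arr R ''al'' 0 k = 1 \<longleftrightarrow> k \<in> A" "k < n"
      using 5(1) n by (simp_all add: env_def)
    ultimately have R: "var R ''u'' = var S ''u''" "arr R ''vi'' = arr S ''vi''"
      "arr R ''l'' = l" "arr R ''al'' 0 k = 1 \<longleftrightarrow> k \<in> A" "k < n" by simp_all
    let ?V = "visited S" and ?u = "var S ''u''"
    have V: "arr S ''vi'' 0 (l j k) = 1 \<longleftrightarrow> l j k \<in> ?V" if "k \<in> A" "j \<le> 1" for j
      using ends_less[OF that(1)] that(2) by (auto simp: visited_def le_Suc_eq)
    \<comment> \<open>\<open>take j\<close> and \<open>out j\<close> describe the branch in which
      the edge is crossed from its end \<open>j\<close>, so that both branches share one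
      argument.\<close>
    define take where "take j \<longleftrightarrow> k \<in> A \<and> l j k \<in> ?V \<and> l (1 - j) k \<notin> ?V \<and> l (1 - j) k \<noteq> ?u" for j
    define out where "out j = set_var ''y'' (l (1 - j) k) (set_var ''x'' (l j k) (set_var ''g'' k R))" for j
    have sem: "sem cross_test R = (if take 0 then out 0 else if take 1 then out 1 else R)"
      using R 5(2) V[of 0] V[of 1] by (simp add: cross_test_def take_def out_def)
    have "I (Suc k) (out j)" if "take j" "j \<le> 1" for j
      using that R by (auto simp: I_def take_def out_def joins_def le_Suc_eq)
    moreover have "I (Suc k) R" if "\<not> take 0" "\<not> take 1"
    proof -
      have "ok k" if "k \<in> A"
        using \<open>\<not> take 0\<close> \<open>\<not> take 1\<close> that by (auto simp: take_def joins_def ok_def)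
      then show ?thesis using 5(4) by (auto simp: I_def less_Suc_eq)
    qed
    moreover have "I (Suc k) (set_var ''f'' (Suc k) R') = I (Suc k) R'" for R'
      by (simp add: I_def)
    ultimately show ?case unfolding sem by auto
  qed (auto simp: I_def)
  then show ?thesis
    using n edges_less unfolding I_def ok_def by auto
qed

lemma rooted_cong:
  assumes "rooted S d x" "inB S \<subseteq> inB S'" "rk S' = rk S" "x \<in> inB S"
    "\<And>z. z \<in> inB S \<Longrightarrow> pt S' d z = pt S d z \<and> pe S' d z = pe S d z \<and> dp S' d z = dp S d z"
  shows "rooted S' d x"
  using assms by (auto simp: rooted_def linked_def lt_def)

text \<open>Only values at vertices of \<open>B\<close> matter, so a search may overwrite links
  outside \<open>B\<close>, including those left by earlier searches.\<close>

lemma bipolar_cong: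
  assumes "bipolar S" "inB S' = inB S" "rk S' = rk S"
    "\<And>d z. z \<in> inB S \<Longrightarrow> pt S' d z = pt S d z \<and> pe S' d z = pe S d z \<and> dp S' d z = dp S d z \<and> pa S' d z = pa S d z"
  shows "bipolar S'"
proof -
  have "framed S'" using assms by (auto simp: bipolar_def framed_def)
  then show ?thesis
    using assms rooted_cong[of S _ _ S'] unfolding bipolar_def by auto
qed

definition searching :: "nat \<Rightarrow> nat \<Rightarrow> state \<Rightarrow> bool" where
  "searching u w S \<longleftrightarrow> bipolar S \<and> tree S (visited S) u w 0 \<and> tree S (visited S) u w 1 \<and> w \<in> visited S \<and>
     u \<in> inB S \<and> visited S \<inter> inB S = {} \<and> var S ''fd'' \<le> 1 \<and>
     (var S ''fd'' = 1 \<longrightarrow> var S ''x'' \<in> visited S \<and> var S ''y'' \<in> inB S \<and> var S ''y'' \<noteq> u \<and>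
       var S ''g'' \<in> A \<and> joins l (var S ''g'') (var S ''x'') (var S ''y''))"

lemma tree_extend:
  assumes tree: "tree S V u w d" and x: "x \<in> V" and y: "y \<notin> V" "y \<noteq> u" "y \<noteq> s" "y \<noteq> t" "y < m"
    and g: "g \<in> A" "joins l g x y"
    and upd: "pt S' d = (pt S d)(y := x)" "pe S' d = (pe S d)(y := g)"
      "dp S' d = (dp S d)(y := Suc (dp S d x))" "pa S' d = (pa S d)(y := 1 - pa S d x)"
  shows "tree S' (insert y V) u w d"
proof -
  have "x \<noteq> y" using x y by auto
  have "pa S d x = dp S d x mod 2" using tree x by (auto simp: tree_def)
  then have "1 - pa S d x = Suc (dp S d x) mod 2" by presburger
  moreover have "linked S' d z" if "z \<in> V" for z
  proof -
    have "z \<noteq> y" "pt S d z \<noteq> y" "linked S d z" using tree y that by (auto simp: tree_def)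
    then show ?thesis by (simp add: linked_def upd)
  qed
  ultimately show ?thesis
    using tree x y g \<open>x \<noteq> y\<close>
    by (auto simp: tree_def linked_def upd joins_commute)
qed

definition searchable :: "state \<Rightarrow> bool" where
  "searchable S \<longleftrightarrow> var S ''fd'' = 0 \<and>
    \<not> (\<forall>f\<in>A. \<forall>x y. joins l f x y \<longrightarrow> x \<in> visited S \<longrightarrow> y \<in> visited S \<or> y = var S ''u'')"

text \<open>A round that makes progress either adds a vertex to the tree or reaches \<open>B\<close>
  and thereby ends the search.\<close>

lemma searching_step:
  assumes env: "env S" and inv: "searching (var S ''u'') w S"
  shows "searching (var S ''u'') w (sem search_step S) \<and>
    (if searchable S then searchable (sem search_step S) \<longrightarrow> card (visited S) < card (visited (sem search_step S))
     else \<not> searchable (sem search_step S))"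
proof (cases "var S ''fd'' = 0")
  case False
  then show ?thesis using inv by (simp add: search_step_def searchable_def)
next
  case fd: True
  define R where "R = sem cross_edge S"
  have arr: "arr R = arr S" unfolding R_def by (rule arr_sem_id) simp
  have var: "var R ''n'' = n" "var R ''u'' = var S ''u''" "var R ''fd'' = 0"
    using env fd by (auto simp: R_def env_def)
  note sets = arr_eqD(1,2)[OF arr]
  have invR: "searching (var S ''u'') w R"
    using inv by (simp add: searching_def arr_eqD[OF arr] var fd)
  show ?thesis
  proof (cases "var R ''g'' = n")
    case True
    then have "sem search_step S = R"
      using fd var by (simp add: search_step_def R_def[symmetric])
    then show ?thesis
      using cross_edge[OF env] invR True by (auto simp: searchable_def R_def[symmetric] sets var)
  next
    case False
    let ?x = "var R ''x''" and ?y = "var R ''y''" and ?g = "var R ''g''"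
    have g: "?g < n" "?g \<in> A" "joins l ?g ?x ?y" "?x \<in> visited S" "?y \<notin> visited S"
        "?y \<noteq> var S ''u''"
      using cross_edge[OF env] False by (auto simp: R_def[symmetric])
    then have C: "searchable S" using fd unfolding searchable_def by blast
    have ym: "?y < m" using g joins_less by blast
    show ?thesis
    proof (cases "?y \<in> inB R")
      case True
      then have eq: "sem search_step S = set_var ''fd'' 1 R"
        using fd var g by (simp add: search_step_def R_def[symmetric] inB_def)
      have "searching (var S ''u'') w (set_var ''fd'' 1 R)"
        using invR g True by (simp add: searching_def sets arr_eqD[OF arr_set_var])
      then show ?thesis using C eq by (simp add: searchable_def)
    next
      case False
      define T where "T = sem (set_link ''y'' ''x'' ''g'' 0 ;; set_link ''y'' ''x'' ''g'' 1) (set_arr ''vi'' 0 ?y 1 R)"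
      have eq: "sem search_step S = T"
        using fd var g False ym by (simp add: search_step_def R_def[symmetric] T_def inB_def One_nat_def[symmetric] del: One_nat_def)
      have vis: "visited T = insert ?y (visited R)"
        using ym by (auto simp: T_def visited_def)
      have inB: "inB T = inB R" by (auto simp: T_def inB_def)
      have vars: "var T = var R" by (intro ext) (simp add: T_def)
      have upd: "pt T d = (pt R d)(?y := ?x)" "pe T d = (pe R d)(?y := ?g)"
        "dp T d = (dp R d)(?y := Suc (dp R d ?x))" "pa T d = (pa R d)(?y := 1 - pa R d ?x)"
        if "d = 0 \<or> d = 1" for d
        using that by (auto simp: T_def)
      have upd': "pt T d = pt R d" "pe T d = pe R d" "dp T d = dp R d" "pa T d = pa R d"
        if "\<not> (d = 0 \<or> d = 1)" for d
        using that by (auto simp: T_def)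
      have bip: "bipolar T"
      proof (rule bipolar_cong)
        fix d z assume "z \<in> inB R"
        with False have "z \<noteq> ?y" by auto
        then show "pt T d z = pt R d z \<and> pe T d z = pe R d z \<and> dp T d z = dp R d z \<and> pa T d z = pa R d z"
          using upd[of d] upd'[of d] by (cases "d = 0 \<or> d = 1") auto
      next
        show "rk T = rk R" by (simp add: T_def)
      qed (use invR inB in \<open>auto simp: searching_def\<close>)
      have "s \<in> inB R" "t \<in> inB R"
        using invR by (auto simp: searching_def bipolar_def framed_def)
      with False have yst: "?y \<noteq> s" "?y \<noteq> t" by auto
      have tree: "tree T (insert ?y (visited R)) (var S ''u'') w d" if "d = 0 \<or> d = 1" for d
      proof (rule tree_extend)
        show "tree R (visited R) (var S ''u'') w d"
          using invR that by (auto simp: searching_def)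
      qed (use g ym yst sets upd[OF that] in auto)
      have "searching (var S ''u'') w T"
        using invR bip tree False var by (auto simp: searching_def vis inB vars)
      moreover have "card (visited R) < card (visited T)"
      proof -
        have "finite (visited R)" by (simp add: visited_def)
        then show ?thesis using g by (simp add: vis sets)
      qed
      ultimately show ?thesis using C by (simp add: eq sets)
    qed
  qed
qed

text \<open>If \<open>B\<close> is never reached and edges leave the tree only towards
  \<open>u\<close>, the tree itself is the set \<open>K\<close> that shows the edge to be dead: it
  contains \<open>w\<close> but none of \<open>u\<close>, \<open>s\<close>,
  \<open>t\<close>.\<close>

lemma search:
  fixes S
  defines "S' \<equiv> sem search S"
  defines "V \<equiv> visited S'"
  defines "u \<equiv> var S ''u''"
  defines "w \<equiv> var S ''w''"
  assumes env: "env S" and bip: "bipolar S" and u: "u \<in> inB S" and w: "w \<notin> inB S"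
    and e: "var S ''e'' \<in> A" "joins l (var S ''e'') u w"
  shows "searching u w S' \<and> (var S' ''fd'' = 0 \<longrightarrow> dead (var S ''e''))"
proof -
  define clr where "clr = For ''i'' ''m'' (Wrt ''vi'' (Const 0) (Var ''i'') (Const 0))"
  define R where "R = sem clr S"
  define T where "T = sem (Wrt ''vi'' (Const 0) (Var ''w'') (Const 1) ;;
     set_link ''w'' ''u'' ''e'' 0 ;; set_link ''w'' ''u'' ''e'' 1 ;; Asg ''fd'' (Const 0)) R"
  have S': "S' = sem (For ''i'' ''m'' search_step) T"
    by (simp add: S'_def search_def T_def R_def clr_def)
  have wm: "w < m" and um: "u < m" using joins_less[OF e] by auto
  have m: "var S ''m'' = m" using env by (simp add: env_def)
  have "\<forall>x < var S ''m''. arr R ''vi'' 0 x = 0"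
    unfolding R_def clr_def
    by (rule For_inv[where I = "\<lambda>k R. \<forall>x < k. arr R ''vi'' 0 x = 0"]) (auto simp: less_Suc_eq)
  then have "visited R = {}" by (auto simp: visited_def m)
  then have vis: "visited T = {w}"
    using wm by (auto simp: T_def visited_def R_def clr_def w_def)
  have vars: "var T ''w'' = w" "var T ''u'' = u" "var T ''fd'' = 0" "var T ''m'' = m"
    "var T ''e'' = var S ''e''"
    using env by (simp_all add: T_def R_def clr_def w_def u_def env_def)
  have inB: "inB T = inB S" by (auto simp: T_def R_def clr_def inB_def)
  have envT: "env T" using env by (simp add: T_def R_def clr_def env_def)
  have upd: "pt T d = (if d \<le> 1 then (pt S d)(w := u) else pt S d)"
    "pe T d = (if d \<le> 1 then (pe S d)(w := var S ''e'') else pe S d)"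
    "dp T d = (if d \<le> 1 then (dp S d)(w := Suc (dp S d u)) else dp S d)"
    "pa T d = (if d \<le> 1 then (pa S d)(w := 1 - pa S d u) else pa S d)" for d
    by (auto simp: T_def R_def clr_def w_def u_def le_Suc_eq)
  have uw: "u \<noteq> w" using u w by auto
  have bipT: "bipolar T"
  proof (rule bipolar_cong[OF bip inB])
    show "rk T = rk S" by (simp add: T_def R_def clr_def)
    fix d z
    assume "z \<in> inB S"
    with w have "z \<noteq> w" by auto
    then show "pt T d z = pt S d z \<and> pe T d z = pe S d z \<and> dp T d z = dp S d z \<and> pa T d z = pa S d z"
      by (simp add: upd)
  qed
  have frm: "framed S" using bip by (simp add: bipolar_def)
  have "tree T {w} u w d" if "d \<le> 1" for d
  proof -
    have "pa S d u = dp S d u mod 2" using frm u that by (simp add: framed_def)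
    then have "1 - pa S d u = Suc (dp S d u) mod 2" by presburger
    then show ?thesis
      using uw that e wm w frm by (auto simp: tree_def linked_def upd joins_commute framed_def)
  qed
  then have init: "searching u w T"
    using bipT u w vars by (simp add: searching_def vis inB)
  have set_i: "searching u w (set_var ''i'' k R) = searching u w R" "searchable (set_var ''i'' k R) = searchable R"
    "visited (set_var ''i'' k R) = visited R" for k R
    using arr_eqD[OF arr_set_var] by (simp_all add: searching_def searchable_def)
  have "searching u w S' \<and> \<not> searchable S'"
    unfolding S'
  proof (rule For_until[where \<mu> = "\<lambda>R. card (visited R)"], unfold set_i, goal_cases)
    case (5 k r)
    have "env r" "var r ''u'' = u"
      using env_agree[OF envT 5(1)] agree_var[OF 5(1), of "''u''"] vars by auto
    with searching_step[of r w] 5 show ?case by auto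
  next
    case (6 k r)
    have "env r" "var r ''u'' = u"
      using env_agree[OF envT 6(1)] agree_var[OF 6(1), of "''u''"] vars by auto
    with searching_step[of r w] 6 show ?case by auto
  next
    case (7 r)
    \<comment> \<open>\<open>u\<close> stays outside the tree, so fewer than \<open>m\<close>
      vertices are visited and \<open>m\<close> rounds suffice.\<close>
    then have "visited r \<subseteq> {..<m} - {u}" by (auto simp: visited_def searching_def tree_def)
    then have "card (visited r) \<le> card ({..<m} - {u})" by (intro card_mono) auto
    then show ?case using um vars by simp
  qed (use init in auto)
  moreover have "dead (var S ''e'')" if "searching u w S'" "\<not> searchable S'" "var S' ''fd'' = 0"
  proof -
    have "var S' ''u'' = u" by (simp add: S' vars)
    then show ?thesis
      using that e(2) unfolding dead_def searchable_def searching_def tree_def by blast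
  qed
  ultimately show ?thesis by blast
qed

lemma insert_step:
  assumes env: "env S" and ins: "inserting V u w d (var S ''x'') (var S ''y'') (var S ''g'') S"
    and vars: "var S ''u'' = u" "var S ''d'' = d" "var S ''c'' = 1 - d" and x: "var S ''x'' \<noteq> u"
  defines "S' \<equiv> sem insert_step S"
  shows "inserting V u w d (var S' ''x'') (var S' ''y'') (var S' ''g'') S'"
    "inB S' = insert (var S ''x'') (inB S)" "var S ''x'' \<notin> inB S" "var S ''x'' < m"
proof -
  let ?x = "var S ''x''" and ?y = "var S ''y''" and ?g = "var S ''g''"
  have xm: "?x < m" and xB: "?x \<notin> inB S"
    using ins x by (auto simp: inserting_def tree_def)
  then show "?x < m" "?x \<notin> inB S" by blast+
  have "d \<le> 1" using ins by (simp add: inserting_def)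
  then have d: "1 - d \<noteq> d" "d \<le> 1" by presburger+
  have m: "var S ''m'' = m" using env by (simp add: env_def)
  show B: "inB S' = insert ?x (inB S)"
    using x xm vars by (auto simp: S'_def insert_step_def inB_def)
  define r where "r = (if d = 0 then Suc (rk S u) else rk S u)"
  have "inserting V u w d (pt S d ?x) ?x (pe S d ?x) S'"
  proof (rule inserting_step[OF ins x r_def B])
    show "rk S' z = (if r \<le> rk S z then Suc (rk S z) else rk S z)" if "z \<in> inB S" for z
    proof -
      have "z \<noteq> ?x" "z < m" using that xB by (auto simp: inB_def)
      then show ?thesis
        using x vars m by (simp add: S'_def insert_step_def sem_shift r_def)
    qed
    show "rk S' ?x = r"
      using x vars by (simp add: S'_def insert_step_def r_def)
  qed (use x vars in \<open>simp_all add: S'_def insert_step_def\<close>)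
  moreover have "var S' ''x'' = pt S d ?x" "var S' ''y'' = ?x" "var S' ''g'' = pe S d ?x"
    using x vars d by (simp_all add: S'_def insert_step_def)
  ultimately show "inserting V u w d (var S' ''x'') (var S' ''y'') (var S' ''g'') S'" by simp
qed

text \<open>The tree is disjoint from \<open>B\<close> when the insertion starts, so no link is
  pending at that moment. Every round moves one vertex of the ear into \<open>B\<close>, until the
  ear arrives at \<open>u\<close>.\<close>

lemma insert_ear:
  fixes S
  defines "u \<equiv> var S ''u''"
  defines "S' \<equiv> sem insert_ear S"
  assumes env: "env S" and sch: "searching u w S" and fd: "var S ''fd'' = 1"
  shows "bipolar S' \<and> w \<in> inB S' \<and> inB S \<subseteq> inB S'"
proof -
  \<comment> \<open>In this direction the far end \<open>y\<close> of the ear lies above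
    \<open>u\<close>.\<close>
  define d :: nat where "d = (if rk S u < rk S (var S ''y'') then 0 else 1)"
  define T where "T = set_var ''c'' (1 - d) (set_var ''d'' d S)"
  let ?V = "visited S"
  have S': "S' = sem (For ''i'' ''m'' insert_step) T"
    by (simp add: S'_def insert_ear_def T_def d_def u_def)
  have arr: "arr T = arr S" and vars: "var T ''u'' = u" "var T ''d'' = d" "var T ''c'' = 1 - d"
      "var T ''m'' = m" "var T ''x'' = var S ''x''" "var T ''y'' = var S ''y''" "var T ''g'' = var S ''g''"
    using env by (auto simp: T_def u_def env_def)
  have envT: "env T" using env by (simp add: env_def T_def)
  have bip: "bipolar S" and uB: "u \<in> inB S" and f: "var S ''x'' \<in> ?V" "var S ''y'' \<in> inB S"
      "var S ''y'' \<noteq> u" "var S ''g'' \<in> A" "joins l (var S ''g'') (var S ''x'') (var S ''y'')"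
      and V: "?V \<inter> inB S = {}" and tree: "tree S ?V u w d"
    using sch fd by (auto simp: searching_def d_def)
  have frm: "framed S" using bip by (simp add: bipolar_def)
  have "rk S u \<noteq> rk S (var S ''y'')"
    using frm uB f by (auto simp: framed_def inj_on_def)
  then have lt: "lt d S u (var S ''y'')" by (auto simp: lt_def d_def)
  have "rooted S e z" if "z \<in> inB S - {s, t}" "e \<le> 1" for z e
    using bip that by (auto simp: bipolar_def)
  then have init: "inserting ?V u w d (var S ''x'') (var S ''y'') (var S ''g'') S"
    using frm tree uB f lt V by (auto simp: inserting_def d_def)
  define I where "I R \<longleftrightarrow> inserting ?V u w d (var R ''x'') (var R ''y'') (var R ''g'') R \<and> inB S \<subseteq> inB R"
    for R :: state
  have ins_eq: "inserting V u w d x y g R' = inserting V u w d x y g R" if "arr R' = arr R" for V x y g R R'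
    using arr_eqD[OF that]
    by (simp add: inserting_def framed_def lt_def rooted_def linked_def that)
  have set_i: "I (set_var ''i'' k R) = I R" "inB (set_var ''i'' k R) = inB R" for k R
    using arr_eqD[OF arr_set_var] ins_eq[OF arr_set_var] by (simp_all add: I_def)
  have "I S' \<and> \<not> var S' ''x'' \<noteq> u"
    unfolding S'
  proof (rule For_until[where \<mu> = "\<lambda>R. card (inB R)"], unfold set_i, goal_cases)
    case 4
    then show ?case using init ins_eq[OF arr] vars arr_eqD[OF arr] by (simp add: I_def)
  next
    case (5 k r)
    have e: "env r" "var r ''u'' = u" "var r ''d'' = d" "var r ''c'' = 1 - d"
      using env_agree[OF envT 5(1)] agree_var[OF 5(1)] vars by auto
    have "finite (inB r)" by (simp add: inB_def)
    with insert_step[OF e(1) _ e(2-4) 5(3), of ?V w] 5(2) show ?case by (auto simp: I_def)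
  next
    case (6 k r)
    have "var r ''u'' = u" using agree_var[OF 6(1), of "''u''"] vars by auto
    then have "sem insert_step r = r" using 6 by (simp add: insert_step_def)
    then show ?case using 6 by simp
  next
    case (7 r)
    have e: "env r" "var r ''u'' = u" "var r ''d'' = d" "var r ''c'' = 1 - d"
      using env_agree[OF envT 7(1)] agree_var[OF 7(1)] vars by auto
    \<comment> \<open>The vertex about to be inserted is outside \<open>B\<close>, which bounds the
      number of rounds.\<close>
    have "inB r \<subseteq> {..<m} - {var r ''x''}" "var r ''x'' < m"
      using insert_step[OF e(1) _ e(2-4) 7(3), of ?V w] 7(2) by (auto simp: I_def inB_def)
    then have "card (inB r) \<le> card ({..<m} - {var r ''x''})" by (intro card_mono) auto
    then show ?case using vars \<open>var r ''x'' < m\<close> by simp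
  qed auto
  then show ?thesis
    using inserting_finish unfolding I_def by metis
qed

lemma pick:
  fixes S
  defines "S' \<equiv> sem pick S"
  assumes env: "env S"
  shows "var S' ''e'' = n \<and>
      (\<forall>f\<in>A. arr S ''dn'' 0 f \<noteq> 1 \<longrightarrow> l 0 f \<notin> inB S \<and> l 1 f \<notin> inB S)
    \<or> var S' ''e'' < n \<and> var S' ''e'' \<in> A \<and> arr S ''dn'' 0 (var S' ''e'') \<noteq> 1 \<and>
      joins l (var S' ''e'') (var S' ''u'') (var S' ''w'') \<and> var S' ''u'' \<in> inB S"
proof -
  define I where "I k R \<longleftrightarrow> var R ''e'' = n \<and>
      (\<forall>f\<in>A. f < k \<longrightarrow> arr S ''dn'' 0 f \<noteq> 1 \<longrightarrow> l 0 f \<notin> inB S \<and> l 1 f \<notin> inB S)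
    \<or> var R ''e'' < n \<and> var R ''e'' \<in> A \<and> arr S ''dn'' 0 (var R ''e'') \<noteq> 1 \<and>
      joins l (var R ''e'') (var R ''u'') (var R ''w'') \<and> var R ''u'' \<in> inB S" for k and R :: state
  have n: "var S ''n'' = n" using env by (simp add: env_def)
  have "I (var (set_var ''e'' n S) ''n'') S'"
    unfolding S'_def pick_def sem.simps(2,4) aval.simps n
  proof (rule For_inv[where I = I], goal_cases)
    case (5 k R)
    have "arr R ''B'' = arr S ''B''" "arr R ''dn'' = arr S ''dn''"
      by (simp_all add: agree_arr[OF 5(3)])
    moreover have "env (set_var ''e'' n S)" using env by (simp add: env_def)
    then have "env R" by (rule env_agree[OF _ 5(3)]) simp_all
    then have "arr R ''l'' = l" "arr R ''al'' 0 k = 1 \<longleftrightarrow> k \<in> A" "k < n"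
      using 5(1) n by (simp_all add: env_def)
    ultimately have R: "arr R ''B'' = arr S ''B''" "arr R ''dn'' = arr S ''dn''"
      "arr R ''l'' = l" "arr R ''al'' 0 k = 1 \<longleftrightarrow> k \<in> A" "k < n" by simp_all
    have B: "arr S ''B'' 0 (l j k) = 1 \<longleftrightarrow> l j k \<in> inB S" if "k \<in> A" "j \<le> 1" for j
      using ends_less[OF that(1)] that(2) by (auto simp: inB_def le_Suc_eq)
    define take where "take j \<longleftrightarrow> k \<in> A \<and> arr S ''dn'' 0 k \<noteq> 1 \<and> l j k \<in> inB S" for j
    define out where "out j = set_var ''w'' (l (1 - j) k) (set_var ''u'' (l j k) (set_var ''e'' k R))" for j
    have sem: "sem pick_test R = (if take 0 then out 0 else if take 1 then out 1 else R)"
      using R 5(2) B[of 0] B[of 1] by (simp add: pick_test_def take_def out_def)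
    have "I (Suc k) (out j)" if "take j" "j \<le> 1" for j
      using that R by (auto simp: I_def take_def out_def joins_def le_Suc_eq)
    moreover have "I (Suc k) R" if "\<not> take 0" "\<not> take 1"
      using that 5(4) by (auto simp: I_def take_def less_Suc_eq)
    moreover have "I (Suc k) (set_var ''f'' (Suc k) R') = I (Suc k) R'" for R'
      by (simp add: I_def)
    ultimately show ?case unfolding sem by auto
  qed (auto simp: I_def)
  then show ?thesis
    using n edges_less by (auto simp: I_def)
qed

text \<open>Both alternatives persist while \<open>B\<close> grows: being dead does not depend on
  the state.\<close>

definition processed :: "state \<Rightarrow> nat \<Rightarrow> bool" where
  "processed S e \<longleftrightarrow> dead e \<or> l 0 e \<in> inB S \<and> l 1 e \<in> inB S"

definition growing :: "state \<Rightarrow> bool" where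
  "growing S \<longleftrightarrow> bipolar S \<and> (\<forall>e\<in>A. arr S ''dn'' 0 e = 1 \<longrightarrow> processed S e)"

definition growable :: "state \<Rightarrow> bool" where
  "growable S \<longleftrightarrow> (\<exists>e\<in>A. arr S ''dn'' 0 e \<noteq> 1 \<and> (l 0 e \<in> inB S \<or> l 1 e \<in> inB S))"

definition treated :: "state \<Rightarrow> nat set" where
  "treated S = {e \<in> A. arr S ''dn'' 0 e = 1}"

text \<open>A picked edge ends up processed in each case: its other end is in \<open>B\<close>
  already, or joins \<open>B\<close> with the ear, or the failed search shows that the edge is
  dead.\<close>

lemma grow:
  fixes S
  assumes env: "env S" and inv: "growing S"
  defines "S' \<equiv> sem grow S"
  shows "growing S' \<and> (if growable S then card (treated S) < card (treated S') else \<not> growable S')"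
proof -
  define R where "R = sem pick S"
  have arr: "arr R = arr S" unfolding R_def by (rule arr_sem_id) simp
  note eqs = arr_eqD[OF arr]
  have envR: "env R" using env by (simp add: R_def env_def)
  then have n: "var R ''n'' = n" by (simp add: env_def)
  have growR: "growing R" using inv by (simp add: growing_def eqs arr processed_def)
  show ?thesis
  proof (cases "var R ''e'' = n")
    case True
    then have "S' = R" using n by (simp add: S'_def grow_def R_def[symmetric])
    moreover have "\<not> growable S" using pick[OF env] True by (auto simp: growable_def R_def[symmetric])
    ultimately show ?thesis using growR by (auto simp: growable_def eqs arr)
  next
    case False
    let ?e = "var R ''e''" and ?u = "var R ''u''" and ?w = "var R ''w''"
    have e: "?e < n" "?e \<in> A" "arr S ''dn'' 0 ?e \<noteq> 1" "joins l ?e ?u ?w" "?u \<in> inB S"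
      using pick[OF env] False by (auto simp: R_def[symmetric])
    have C: "growable S" using e by (auto simp: growable_def joins_def)
    define T where "T = sem (Wrt ''dn'' (Const 0) (Var ''e'') (Const 1)) R"
    define U where "U = sem search T"
    have b: "bval (Less (Var ''e'') (Var ''n'')) R" using e n by simp
    have S': "S' = (if bval (is1 ''B'' (Var ''w'')) T then T
        else if bval (Eq (Var ''fd'') (Const 1)) U then sem insert_ear U else U)"
      by (simp only: S'_def grow_def sem.simps(1,4,5) R_def[symmetric] T_def[symmetric]
          U_def[symmetric] b if_True)
    have T: "T = set_arr ''dn'' 0 ?e 1 R" by (simp add: T_def)
    have envT: "env T" and varT: "var T = var R" using envR by (auto simp: env_def T)
    have BT: "inB T = inB S" by (simp add: T inB_def arr)
    have bipT: "bipolar T"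
      by (rule bipolar_cong[of S]) (use inv BT in \<open>auto simp: T arr growing_def\<close>)
    have wm: "?w < m" using joins_less e by blast
    then have wB: "bval (is1 ''B'' (Var ''w'')) T \<longleftrightarrow> ?w \<in> inB S"
      by (simp add: T arr inB_def)
    have dn': "arr S' ''dn'' = arr T ''dn''"
      by (simp add: S' U_def)
    have "A \<subseteq> {..<n}" using edges_less by auto
    then have "finite A" by (rule finite_subset) simp
    then have "finite (treated S)" by (simp add: treated_def)
    moreover have "treated S' = insert ?e (treated S)"
      using e by (auto simp: treated_def dn' T arr)
    ultimately have card: "card (treated S) < card (treated S')" using e by (simp add: treated_def)
    have "bipolar S' \<and> inB S \<subseteq> inB S' \<and> processed S' ?e"
    proof (cases "?w \<in> inB S")
      case True
      then have "S' = T"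
        unfolding S' wB by simp
      moreover have "processed T ?e"
        using e(4,5) True unfolding processed_def BT joins_def by metis
      ultimately show ?thesis using bipT BT by simp
    next
      case False
      then have S': "S' = (if var U ''fd'' = 1 then sem insert_ear U else U)"
        unfolding S' wB by simp
      have BU: "inB U = inB S" using BT by (simp add: U_def inB_def)
      have s: "searching ?u ?w U" "var U ''fd'' = 0 \<Longrightarrow> dead ?e"
        using search[OF envT bipT] e False BT by (auto simp: varT U_def)
      have envU: "env U" and u: "var U ''u'' = ?u"
        using envT varT by (auto simp: U_def env_def)
      show ?thesis
      proof (cases "var U ''fd'' = 1")
        case True
        then show ?thesis
          using insert_ear[OF envU, of ?w] s(1) e u BU S'
          by (auto simp: processed_def joins_def)
      next
        case False
        then have "var U ''fd'' = 0" using s(1) by (auto simp: searching_def)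
        then show ?thesis using s S' BU by (auto simp: processed_def searching_def)
      qed
    qed
    then have "growing S'"
      using inv unfolding growing_def dn' T by (auto simp: arr processed_def)
    then show ?thesis using C card by simp
  qed
qed

end

section \<open>Deciding the parity of paths between two terminals\<close>

text \<open>The edge below \<open>x\<close> belongs at position \<open>dp 0 x\<close>, which is
  known in advance, so the descent is written from back to front without a reversal. Position 0 is
  reserved for \<open>a\<close>.\<close>

definition down_step :: prog where
  "down_step = Ite (Eq (Var ''x'') (Var ''s'')) Nop
     (Wrt ''out'' (Const 0) (Read ''dp'' (Const 0) (Var ''x'')) (Read ''E'' (Const 0) (Var ''x'')) ;;
      Asg ''x'' (Read ''P'' (Const 0) (Var ''x'')))"

definition up_step :: prog where
  "up_step = Ite (Eq (Var ''y'') (Var ''t'')) Nop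
     (Asg ''k'' (Plus (Var ''k'') (Const 1)) ;;
      Wrt ''out'' (Const 0) (Var ''k'') (Read ''E'' (Const 1) (Var ''y'')) ;;
      Asg ''y'' (Read ''P'' (Const 1) (Var ''y'')))"

definition out_start :: prog where
  "out_start =
     Wrt ''out'' (Const 0) (Const 0) (Var ''a'') ;;
     Asg ''k'' (Plus (Read ''dp'' (Const 0) (Var ''x'')) (Const 1)) ;;
     Wrt ''out'' (Const 0) (Var ''k'') (Var ''e'')"

definition out_finish :: prog where
  "out_finish =
     Wrt ''out'' (Const 0) (Plus (Var ''k'') (Const 1)) (Var ''b'') ;;
     Asg ''len'' (Plus (Plus (Var ''k'') (Const 1)) (Const 1))"

definition out_path :: prog where
  "out_path = out_start ;; For ''i'' ''m'' down_step ;; For ''i'' ''m'' up_step ;; out_finish"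

definition order_ends :: prog where
  "order_ends =
     Ite (Less (Read ''rk'' (Const 0) (lab 0 ''e'')) (Read ''rk'' (Const 0) (lab 1 ''e'')))
       (Asg ''x'' (lab 0 ''e'') ;; Asg ''y'' (lab 1 ''e''))
       (Asg ''x'' (lab 1 ''e'') ;; Asg ''y'' (lab 0 ''e''))"

definition check_edge :: prog where
  "check_edge =
     Ite (Conj (Eq (Var ''len'') (Const 0)) (Conj (is1 ''al'' (Var ''e''))
         (Conj (is1 ''B'' (lab 0 ''e'')) (is1 ''B'' (lab 1 ''e'')))))
       (order_ends ;;
        Ite (Eq (Read ''pa'' (Const 0) (Var ''x'')) (Read ''pa'' (Const 1) (Var ''y''))) Nop out_path)
       Nop"

text \<open>With \<open>sx\<close> and \<open>tx\<close> the other ends of \<open>a\<close> and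
  \<open>b\<close>, all edges at them are removed, \<open>a\<close> and \<open>b\<close> among them.
  Label 0 marks vertices outside the labelled part of the graph.\<close>

definition alive :: bexp where
  "alive = Conj (Neg (Eq (lab 0 ''e'') (Const 0)))
     (Conj (Conj (Neg (Eq (lab 0 ''e'') (Var ''sx''))) (Neg (Eq (lab 0 ''e'') (Var ''tx''))))
       (Conj (Neg (Eq (lab 1 ''e'') (Var ''sx''))) (Neg (Eq (lab 1 ''e'') (Var ''tx'')))))"

definition alive_test :: prog where
  "alive_test =
     Ite alive (Wrt ''al'' (Const 0) (Var ''e'') (Const 1)) (Wrt ''al'' (Const 0) (Var ''e'') (Const 0)) ;;
     Wrt ''dn'' (Const 0) (Var ''e'') (Const 0)"

text \<open>The downward count of \<open>t\<close> and the upward count of \<open>s\<close> are set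
  to 0 together with their parities, so that \<open>pa\<close> is the parity of \<open>dp\<close>
  throughout \<open>B\<close>.\<close>

definition core_roots :: prog where
  "core_roots =
     Wrt ''B'' (Const 0) (Var ''s'') (Const 1) ;; Wrt ''B'' (Const 0) (Var ''t'') (Const 1) ;;
     Wrt ''rk'' (Const 0) (Var ''s'') (Const 0) ;; Wrt ''rk'' (Const 0) (Var ''t'') (Const 1) ;;
     Wrt ''dp'' (Const 0) (Var ''s'') (Const 0) ;; Wrt ''dp'' (Const 0) (Var ''t'') (Const 0) ;;
     Wrt ''dp'' (Const 1) (Var ''s'') (Const 0) ;; Wrt ''dp'' (Const 1) (Var ''t'') (Const 0) ;;
     Wrt ''pa'' (Const 0) (Var ''s'') (Const 0) ;; Wrt ''pa'' (Const 0) (Var ''t'') (Const 0) ;;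
     Wrt ''pa'' (Const 1) (Var ''s'') (Const 0) ;; Wrt ''pa'' (Const 1) (Var ''t'') (Const 0)"

definition core_init :: prog where
  "core_init =
     For ''e'' ''n'' alive_test ;;
     For ''x'' ''m'' (Wrt ''B'' (Const 0) (Var ''x'') (Const 0)) ;;
     core_roots"

definition core :: prog where
  "core = core_init ;; For ''q'' ''n'' grow ;; For ''e'' ''n'' check_edge"

lemma writes_down_step [simp]: "wvars down_step = {''x''}" "warrs down_step = {''out''}"
  by (auto simp: down_step_def)

lemma writes_up_step [simp]: "wvars up_step = {''k'', ''y''}" "warrs up_step = {''out''}"
  by (auto simp: up_step_def)

lemma writes_out_start [simp]: "wvars out_start = {''k''}" "warrs out_start = {''out''}"
  by (auto simp: out_start_def)

lemma writes_out_finish [simp]: "wvars out_finish = {''len''}" "warrs out_finish = {''out''}"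
  by (auto simp: out_finish_def)

lemma writes_out_path [simp]:
  "wvars out_path = {''k'', ''i'', ''x'', ''y'', ''len''}" "warrs out_path = {''out''}"
  by (auto simp: out_path_def)

lemma writes_order_ends [simp]: "wvars order_ends = {''x'', ''y''}" "warrs order_ends = {}"
  by (auto simp: order_ends_def)

lemma writes_check_edge [simp]:
  "wvars check_edge = {''k'', ''i'', ''x'', ''y'', ''len''}" "warrs check_edge = {''out''}"
  by (auto simp: check_edge_def)

lemma writes_alive_test [simp]: "wvars alive_test = {}" "warrs alive_test = {''al'', ''dn''}"
  by (auto simp: alive_test_def)

lemma writes_core_roots [simp]:
  "wvars core_roots = {}" "warrs core_roots = {''B'', ''rk'', ''dp'', ''pa''}"
  by (auto simp: core_roots_def)

lemma writes_core_init [simp]: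
  "wvars core_init = {''e'', ''x''}" "warrs core_init = {''al'', ''dn'', ''B'', ''rk'', ''dp'', ''pa''}"
  by (auto simp: core_init_def)

lemma writes_core [simp]:
  "wvars core = {''q'', ''e'', ''f'', ''u'', ''w'', ''i'', ''g'', ''x'', ''y'', ''fd'', ''d'', ''c'', ''r'', ''k'', ''len''}"
  "warrs core = {''al'', ''dn'', ''vi'', ''P'', ''E'', ''dp'', ''pa'', ''B'', ''rk'', ''out''}"
  by (auto simp: core_def)

lemma sorted_wrt_le_last:
  fixes f :: "'a \<Rightarrow> nat"
  shows "sorted_wrt (\<lambda>v w. f v < f w) xs \<Longrightarrow> v \<in> set xs \<Longrightarrow> f v \<le> f (last xs)"
  by (induction xs) (auto intro: less_imp_le)

lemma sorted_wrt_less_distinct: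
  fixes f :: "'a \<Rightarrow> nat"
  shows "sorted_wrt (\<lambda>v w. f v < f w) xs \<Longrightarrow> distinct xs"
  by (induction xs) auto

section \<open>Writing out the path through an inconsistent edge\<close>

context terminals
begin

text \<open>Ranks increase along the walk, so its vertices are distinct, also across the edge where
  descent and ascent meet. Its edges fill the output up to position \<open>k\<close> and leave room
  before them for the rest of the descent.\<close>

definition walk :: "state \<Rightarrow> nat \<Rightarrow> nat \<Rightarrow> nat \<Rightarrow> nat list \<Rightarrow> nat list \<Rightarrow> bool" where
  "walk R p q k xs es \<longleftrightarrow> rpath l A xs es \<and> hd xs = p \<and> last xs = q \<and> set xs \<subseteq> inB R \<and>
     sorted_wrt (\<lambda>v w. rk R v < rk R w) xs \<and> k = dp R 0 p + length es \<and>
     (\<forall>i < length es. arr R ''out'' 0 (dp R 0 p + Suc i) = es ! i) \<and>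
     arr R ''out'' 0 0 = var R ''a''"

lemma walk_rk: "walk R p q k xs es \<Longrightarrow> p \<in> inB R \<and> q \<in> inB R \<and> rk R p \<le> rk R q"
proof -
  assume w: "walk R p q k xs es"
  then have "xs \<noteq> []" by (auto simp: walk_def rpath_def)
  then show ?thesis
    using w sorted_wrt_le_last[of "rk R" xs p] hd_in_set[of xs] last_in_set[of xs]
    by (auto simp: walk_def)
qed

lemma down_step:
  assumes bip: "bipolar R" and s: "var R ''s'' = s" and x: "var R ''x'' \<noteq> s" "var R ''x'' \<noteq> t"
    and walk: "walk R (var R ''x'') q k xs es"
  defines "R' \<equiv> sem down_step R"
  shows "walk R' (var R' ''x'') q k (pt R 0 (var R ''x'') # xs) (pe R 0 (var R ''x'') # es)"
    "rk R (var R' ''x'') < rk R (var R ''x'')"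
proof -
  let ?x = "var R ''x''" and ?z = "pt R 0 (var R ''x'')"
  have xB: "?x \<in> inB R" using walk_rk[OF walk] by simp
  have "rooted R 0 ?x" using bip xB x by (simp add: bipolar_def)
  then have z: "?z \<in> inB R" "rk R ?z < rk R ?x" "pe R 0 ?x \<in> A" "joins l (pe R 0 ?x) ?z ?x"
      "dp R 0 ?x = Suc (dp R 0 ?z)"
    by (auto simp: rooted_def linked_def lt_def joins_commute)
  have R': "R' = set_var ''x'' ?z (set_arr ''out'' 0 (dp R 0 ?x) (pe R 0 ?x) R)"
    using x s by (simp add: R'_def down_step_def)
  have inB: "inB R' = inB R" by (simp add: R' inB_def)
  have "xs \<noteq> []" using walk by (auto simp: walk_def rpath_def)
  have "rpath l A (?z # xs) (pe R 0 ?x # es)"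
    using walk z by (intro rpath_Cons) (auto simp: walk_def)
  moreover have "sorted_wrt (\<lambda>v w. rk R v < rk R w) (?z # xs)"
    using walk z \<open>xs \<noteq> []\<close> by (cases xs) (auto simp: walk_def)
  ultimately show "walk R' (var R' ''x'') q k (?z # xs) (pe R 0 ?x # es)"
    using walk z \<open>xs \<noteq> []\<close>
    unfolding walk_def inB by (auto simp: R' nth_Cons split: nat.split)
  show "rk R (var R' ''x'') < rk R ?x" using z by (simp add: R')
qed

text \<open>The sum of \<open>k\<close> and the remaining number of steps is invariant; it
  determines the final length.\<close>

lemma up_step:
  assumes bip: "bipolar R" and t: "var R ''t'' = t" and y: "var R ''y'' \<noteq> s" "var R ''y'' \<noteq> t"
    and walk: "walk R s (var R ''y'') (var R ''k'') xs es"
  defines "R' \<equiv> sem up_step R"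
  shows "walk R' s (var R' ''y'') (var R' ''k'') (xs @ [pt R 1 (var R ''y'')]) (es @ [pe R 1 (var R ''y'')])"
    "rk R (var R ''y'') < rk R (var R' ''y'')"
    "var R' ''k'' + dp R' 1 (var R' ''y'') = var R ''k'' + dp R 1 (var R ''y'')"
proof -
  let ?y = "var R ''y''" and ?z = "pt R 1 (var R ''y'')" and ?k = "Suc (var R ''k'')"
  have yB: "?y \<in> inB R" using walk_rk[OF walk] by simp
  have "rooted R 1 ?y" using bip yB y by (simp add: bipolar_def)
  then have z: "?z \<in> inB R" "rk R ?y < rk R ?z" "pe R 1 ?y \<in> A" "joins l (pe R 1 ?y) ?y ?z"
      "dp R 1 ?y = Suc (dp R 1 ?z)"
    by (auto simp: rooted_def linked_def lt_def)
  have R': "R' = set_var ''y'' ?z (set_arr ''out'' 0 ?k (pe R 1 ?y) (set_var ''k'' ?k R))"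
    using y t by (simp add: R'_def up_step_def)
  have inB: "inB R' = inB R" by (simp add: R' inB_def)
  have "dp R 0 s = 0" using bip by (simp add: bipolar_def framed_def)
  then have k: "var R ''k'' = length es" using walk by (simp add: walk_def)
  have ne: "xs \<noteq> []" using walk by (auto simp: walk_def rpath_def)
  have "rpath l A (xs @ [?z]) (es @ [pe R 1 ?y])"
    using walk z by (intro rpath_snoc) (auto simp: walk_def)
  moreover have "rk R v < rk R ?z" if "v \<in> set xs" for v
  proof -
    have "rk R v \<le> rk R (last xs)"
      using walk that sorted_wrt_le_last[of "rk R" xs v] by (simp add: walk_def)
    then show ?thesis using walk z by (simp add: walk_def)
  qed
  then have "sorted_wrt (\<lambda>v w. rk R v < rk R w) (xs @ [?z])"
    using walk by (simp add: walk_def sorted_wrt_append)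
  ultimately show "walk R' s (var R' ''y'') (var R' ''k'') (xs @ [?z]) (es @ [pe R 1 ?y])"
    using walk z ne k
    unfolding walk_def inB by (auto simp: R' nth_append less_Suc_eq \<open>dp R 0 s = 0\<close>)
  show "rk R ?y < rk R (var R' ''y'')" using z by (simp add: R')
  show "var R' ''k'' + dp R' 1 (var R' ''y'') = var R ''k'' + dp R 1 ?y" using z by (simp add: R')
qed

definition found :: "state \<Rightarrow> bool" where
  "found S \<longleftrightarrow> (\<exists>xs es. rpath l A xs es \<and> distinct xs \<and> hd xs = s \<and> last xs = t \<and> even (length es) \<and>
     var S ''len'' = length es + 2 \<and>
     map (arr S ''out'' 0) [0..<var S ''len''] = var S ''a'' # es @ [var S ''b''])"

lemma bipolar_agree:
  assumes "bipolar S" "agree c S R" "{''B'', ''rk'', ''P'', ''E'', ''dp'', ''pa''} \<inter> warrs c = {}"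
  shows "bipolar R" "inB R = inB S" "rk R = rk S" "dp R = dp S"
proof -
  have eq: "arr R ''B'' = arr S ''B''" "arr R ''rk'' = arr S ''rk''" "arr R ''P'' = arr S ''P''"
    "arr R ''E'' = arr S ''E''" "arr R ''dp'' = arr S ''dp''" "arr R ''pa'' = arr S ''pa''"
    using assms(2,3) by (auto simp: agree_def)
  show inB: "inB R = inB S" by (simp add: inB_def eq)
  show "bipolar R" by (rule bipolar_cong[OF assms(1) inB]) (auto simp: eq)
qed (use assms in \<open>auto simp: agree_def\<close>)

text \<open>The resulting edge list has length \<open>dp 0 x + 1 + dp 1 y\<close>, which is even
  exactly when the two parities differ.\<close>

lemma out_path:
  assumes env: "env S" and bip: "bipolar S"
    and e: "var S ''e'' \<in> A" "joins l (var S ''e'') (var S ''x'') (var S ''y'')"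
    and xy: "var S ''x'' \<in> inB S" "var S ''y'' \<in> inB S" "rk S (var S ''x'') < rk S (var S ''y'')"
    and pa: "pa S 0 (var S ''x'') \<noteq> pa S 1 (var S ''y'')"
  defines "S' \<equiv> sem out_path S"
  shows "found S' \<and> var S' ''len'' \<noteq> 0"
proof -
  define x0 where "x0 = var S ''x''"
  define y0 where "y0 = var S ''y''"
  define K where "K = Suc (dp S 0 x0)"
  define S1 where "S1 = sem out_start S"
  define S2 where "S2 = sem (For ''i'' ''m'' down_step) S1"
  define S3 where "S3 = sem (For ''i'' ''m'' up_step) S2"
  have S': "S' = sem out_finish S3"
    by (simp add: S'_def out_path_def S3_def S2_def S1_def)
  have frm: "framed S" using bip by (simp add: bipolar_def)
  then have st': "s \<in> inB S" "t \<in> inB S" "\<And>z. z \<in> inB S \<Longrightarrow> rk S s \<le> rk S z \<and> rk S z \<le> rk S t"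
    by (auto simp: framed_def)
  have ag1: "agree out_start S S1" unfolding S1_def by (rule agree_sem)
  have bip1: "bipolar S1" "inB S1 = inB S" "rk S1 = rk S" "dp S1 = dp S"
    by (rule bipolar_agree[OF bip ag1], simp)+
  have env1: "env S1" by (rule env_agree[OF env ag1]) simp_all
  have v1: "var S1 ''x'' = x0" "var S1 ''y'' = y0" "var S1 ''k'' = K" "arr S1 ''out'' 0 K = var S ''e''"
    "arr S1 ''out'' 0 0 = var S1 ''a''"
    by (simp_all add: S1_def out_start_def K_def x0_def y0_def)
  have walk1: "walk S1 x0 y0 K [x0, y0] [var S ''e'']"
    using e xy v1 unfolding x0_def[symmetric] y0_def[symmetric]
    by (simp add: walk_def rpath_def bip1 K_def)
  \<comment> \<open>A rank below that of \<open>t\<close> excludes \<open>x = t\<close>, where no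
    link downwards is available.\<close>
  define I where "I R \<longleftrightarrow> (\<exists>xs es. walk R (var R ''x'') y0 K xs es) \<and> rk S (var R ''x'') < rk S t" for R :: state
  have walk_eq: "walk (set_var ''i'' k R) = walk R" "inB (set_var ''i'' k R) = inB R" for k R
    by (intro ext) (simp add: walk_def inB_def)+
  have set_i: "I (set_var ''i'' k R) = I R" for k R by (simp add: I_def walk_eq)
  have card_less: "card {v \<in> inB S. P v} < m" if "z \<in> inB S" "\<not> P z" for P z
  proof -
    have "{v \<in> inB S. P v} \<subseteq> {..<m} - {z}" using that by (auto simp: inB_def)
    then have "card {v \<in> inB S. P v} \<le> card ({..<m} - {z})" by (intro card_mono) auto
    also have "\<dots> < m" using that by (auto simp: inB_def)
    finally show ?thesis .
  qed
  have "I S2 \<and> \<not> var S2 ''x'' \<noteq> s"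
    unfolding S2_def
  \<comment> \<open>As \<open>x\<close> descends, more vertices of \<open>B\<close> lie above it;
    \<open>s\<close> is never counted, so the count stays below \<open>m\<close>.\<close>
  proof (rule For_until[where \<mu> = "\<lambda>R. card {v \<in> inB S. rk S (var R ''x'') < rk S v}"], unfold set_i, goal_cases)
    case 4
    have "rk S x0 < rk S t" using xy st'(3)[OF xy(2)] by (simp add: x0_def)
    then show ?case using walk1 v1 by (auto simp: I_def)
  next
    case (5 k r)
    have r: "bipolar r" "inB r = inB S1" "rk r = rk S1" "dp r = dp S1"
      by (rule bipolar_agree[OF bip1(1) 5(1)], simp)+
    have "env r" by (rule env_agree[OF env1 5(1)]) simp_all
    then have s: "var r ''s'' = s" by (simp add: env_def)
    obtain xs es where w: "walk r (var r ''x'') y0 K xs es" and rt: "rk S (var r ''x'') < rk S t"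
      using 5(2) by (auto simp: I_def)
    have xt: "var r ''x'' \<noteq> t" using rt by auto
    note step = down_step[OF r(1) s 5(3) xt w]
    have less: "rk S (var (sem down_step r) ''x'') < rk S (var r ''x'')"
      using step(2) by (simp add: r bip1)
    have "var r ''x'' \<in> inB S" using walk_rk[OF w] by (simp add: r bip1)
    then have "{v \<in> inB S. rk S (var r ''x'') < rk S v}
        \<subset> {v \<in> inB S. rk S (var (sem down_step r) ''x'') < rk S v}"
      using less by auto
    then have "card {v \<in> inB S. rk S (var r ''x'') < rk S v}
        < card {v \<in> inB S. rk S (var (sem down_step r) ''x'') < rk S v}"
      by (rule psubset_card_mono[rotated]) (simp add: inB_def)
    moreover have "I (sem down_step r)" using step(1) less rt unfolding I_def by force
    ultimately show ?case by simp
  next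
    case (6 k r)
    have "env r" by (rule env_agree[OF env1 6(1)]) simp_all
    then have "sem down_step r = r" using 6(3) by (simp add: down_step_def env_def)
    then show ?case using 6 by simp
  next
    case (7 r)
    have "var S1 ''m'' = m" using env1 by (simp add: env_def)
    moreover have "\<not> rk S (var r ''x'') < rk S s"
    proof -
      obtain xs es where w: "walk r (var r ''x'') y0 K xs es" using 7(2) by (auto simp: I_def)
      have "inB r = inB S1" by (rule bipolar_agree[OF bip1(1) 7(1)]) simp
      then show ?thesis using walk_rk[OF w] st'(3) by (simp add: bip1 leD)
    qed
    ultimately show ?case using card_less[OF st'(1)] by simp
  qed simp_all
  then obtain xs2 es2 where walk2: "walk S2 s y0 K xs2 es2" by (auto simp: I_def)
  have ag2: "agree (For ''i'' ''m'' down_step) S1 S2" unfolding S2_def by (rule agree_sem)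
  have bip2: "bipolar S2" "inB S2 = inB S" "rk S2 = rk S" "dp S2 = dp S"
    using bipolar_agree[OF bip1(1) ag2] bip1 by simp_all
  have env2: "env S2" by (rule env_agree[OF env1 ag2]) simp_all
  have v2: "var S2 ''y'' = y0" "var S2 ''k'' = K" using v1 by (simp_all add: S2_def)
  define J where "J R \<longleftrightarrow> (\<exists>xs es. walk R s (var R ''y'') (var R ''k'') xs es) \<and>
      rk S s < rk S (var R ''y'') \<and> var R ''k'' + dp S 1 (var R ''y'') = K + dp S 1 y0" for R :: state
  have set_i': "J (set_var ''i'' k R) = J R" for k R by (simp add: J_def walk_eq)
  have "J S3 \<and> \<not> var S3 ''y'' \<noteq> t"
    unfolding S3_def
  proof (rule For_until[where \<mu> = "\<lambda>R. card {v \<in> inB S. rk S v < rk S (var R ''y'')}"], unfold set_i', goal_cases)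
    case 4
    have "rk S s < rk S y0" using xy st'(3)[OF xy(1)] by (simp add: y0_def)
    then show ?case using walk2 v2 by (auto simp: J_def)
  next
    case (5 k r)
    have r: "bipolar r" "inB r = inB S2" "rk r = rk S2" "dp r = dp S2"
      by (rule bipolar_agree[OF bip2(1) 5(1)], simp)+
    have "env r" by (rule env_agree[OF env2 5(1)]) simp_all
    then have t: "var r ''t'' = t" by (simp add: env_def)
    obtain xs es where w: "walk r s (var r ''y'') (var r ''k'') xs es" and rs: "rk S s < rk S (var r ''y'')"
        and k: "var r ''k'' + dp S 1 (var r ''y'') = K + dp S 1 y0"
      using 5(2) by (auto simp: J_def)
    have ys: "var r ''y'' \<noteq> s" using rs by auto
    note step = up_step[OF r(1) t ys 5(3) w]
    have dp: "dp (sem up_step r) = dp r" by simp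
    have less: "rk S (var r ''y'') < rk S (var (sem up_step r) ''y'')"
      using step(2) by (simp add: r bip2)
    have "var r ''y'' \<in> inB S" using walk_rk[OF w] by (simp add: r bip2)
    then have "{v \<in> inB S. rk S v < rk S (var r ''y'')}
        \<subset> {v \<in> inB S. rk S v < rk S (var (sem up_step r) ''y'')}"
      using less by auto
    then have "card {v \<in> inB S. rk S v < rk S (var r ''y'')}
        < card {v \<in> inB S. rk S v < rk S (var (sem up_step r) ''y'')}"
      by (rule psubset_card_mono[rotated]) (simp add: inB_def)
    moreover have "var (sem up_step r) ''k'' + dp S 1 (var (sem up_step r) ''y'') = K + dp S 1 y0"
      using step(3) k by (simp add: dp r bip2)
    then have "J (sem up_step r)" using step(1) less rs unfolding J_def by force
    ultimately show ?case by simp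
  next
    case (6 k r)
    have "env r" by (rule env_agree[OF env2 6(1)]) simp_all
    then have "sem up_step r = r" using 6(3) by (simp add: up_step_def env_def)
    then show ?case using 6 by simp
  next
    case (7 r)
    have "var S2 ''m'' = m" using env2 by (simp add: env_def)
    moreover have "\<not> rk S t < rk S (var r ''y'')"
    proof -
      obtain xs es where w: "walk r s (var r ''y'') (var r ''k'') xs es" using 7(2) by (auto simp: J_def)
      have "inB r = inB S2" by (rule bipolar_agree[OF bip2(1) 7(1)]) simp
      then show ?thesis using walk_rk[OF w] st'(3) by (simp add: bip2 leD)
    qed
    ultimately show ?case using card_less[OF st'(2)] by simp
  qed simp_all
  then obtain xs es where walk3: "walk S3 s t (var S3 ''k'') xs es"
      and k3: "var S3 ''k'' + dp S 1 t = K + dp S 1 y0"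
    by (auto simp: J_def)
  have ag3: "agree (For ''i'' ''m'' up_step) S2 S3" unfolding S3_def by (rule agree_sem)
  have bip3: "rk S3 = rk S" "dp S3 = dp S"
    using bipolar_agree[OF bip2(1) ag3] bip2 by simp_all
  have dp0: "dp S 0 s = 0" "dp S 1 t = 0" using frm by (auto simp: framed_def)
  then have k: "var S3 ''k'' = length es" using walk3 by (simp add: walk_def bip3)
  have "pa S 0 x0 = dp S 0 x0 mod 2" "pa S 1 y0 = dp S 1 y0 mod 2"
    using frm xy by (auto simp: framed_def x0_def y0_def)
  moreover have "pa S 0 x0 \<noteq> pa S 1 y0" using pa by (simp add: x0_def y0_def)
  ultimately have ev: "even (length es)" using k k3 dp0 unfolding K_def by presburger
  have "distinct xs"
    using walk3 sorted_wrt_less_distinct[of "rk S" xs] by (simp add: walk_def bip3)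
  moreover have out: "\<forall>i < length es. arr S3 ''out'' 0 (Suc i) = es ! i" "arr S3 ''out'' 0 0 = var S3 ''a''"
    using walk3 by (auto simp: walk_def bip3 dp0)
  have "map (arr S' ''out'' 0) [0..<length es + 2] = var S' ''a'' # es @ [var S' ''b'']"
  proof (rule nth_equalityI)
    fix i assume "i < length (map (arr S' ''out'' 0) [0..<length es + 2])"
    then have "i = 0 \<or> (\<exists>j < length es. i = Suc j) \<or> i = Suc (length es)"
      by (cases i) auto
    then show "map (arr S' ''out'' 0) [0..<length es + 2] ! i = (var S' ''a'' # es @ [var S' ''b'']) ! i"
      using out by (auto simp: S' out_finish_def k nth_append simp del: upt_Suc)
  qed simp
  moreover have "var S' ''len'' = length es + 2" by (simp add: S' out_finish_def k)
  ultimately show ?thesis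
    using walk3 ev unfolding found_def walk_def by auto
qed

definition consistent :: "state \<Rightarrow> nat \<Rightarrow> bool" where
  "consistent S e \<longleftrightarrow> (\<forall>x y. joins l e x y \<longrightarrow> x \<in> inB S \<longrightarrow> y \<in> inB S \<longrightarrow> rk S x < rk S y \<longrightarrow>
     pa S 0 x = pa S 1 y)"

lemma check_edge:
  assumes env: "env S" and bip: "bipolar S" and e: "var S ''e'' < n" and len: "var S ''len'' = 0"
  defines "S' \<equiv> sem check_edge S"
  shows "found S' \<and> var S' ''len'' \<noteq> 0 \<or>
    var S' ''len'' = 0 \<and> (var S ''e'' \<in> A \<longrightarrow> consistent S (var S ''e''))"
proof (cases "var S ''e'' \<in> A \<and> l 0 (var S ''e'') \<in> inB S \<and> l 1 (var S ''e'') \<in> inB S")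
  case False
  let ?e = "var S ''e''"
  have "consistent S ?e" if "?e \<in> A"
    using that False unfolding consistent_def joins_def by metis
  moreover have "S' = S"
    using False env e ends_less[of ?e] by (auto simp: S'_def check_edge_def env_def inB_def)
  ultimately show ?thesis using len by simp
next
  case True
  let ?e = "var S ''e''"
  define R where "R = sem order_ends S"
  have ag: "agree order_ends S R" unfolding R_def by (rule agree_sem)
  have envR: "env R" by (rule env_agree[OF env ag]) simp_all
  have bipR: "bipolar R" by (rule bipolar_agree[OF bip ag]) simp
  have arr: "arr R = arr S" unfolding R_def by (rule arr_sem_id) simp
  have inB: "inB R = inB S" by (simp add: inB_def arr)
  have v: "var R ''e'' = ?e" "var R ''len'' = 0" using len by (simp_all add: R_def)
  have l: "arr S ''l'' = l" using env by (simp add: env_def)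
  have "inj_on (rk S) (inB S)" using bip by (simp add: bipolar_def framed_def)
  then have ne: "rk S (l 0 ?e) \<noteq> rk S (l 1 ?e)"
    using True no_loop by (auto simp: inj_on_def)
  let ?x = "var R ''x''" and ?y = "var R ''y''"
  have xy: "?x = (if rk S (l 0 ?e) < rk S (l 1 ?e) then l 0 ?e else l 1 ?e)"
    "?y = (if rk S (l 0 ?e) < rk S (l 1 ?e) then l 1 ?e else l 0 ?e)"
    using l by (simp_all add: R_def order_ends_def)
  then have j: "joins l ?e ?x ?y" by (simp add: joins_def)
  have less: "rk S ?x < rk S ?y" using ne xy by simp
  have B: "?x \<in> inB S" "?y \<in> inB S" using True xy by simp_all
  have "bval (Conj (Eq (Var ''len'') (Const 0)) (Conj (is1 ''al'' (Var ''e''))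
         (Conj (is1 ''B'' (lab 0 ''e'')) (is1 ''B'' (lab 1 ''e''))))) S"
    using True env e len by (auto simp: env_def inB_def)
  then have S': "S' = (if bval (Eq (Read ''pa'' (Const 0) (Var ''x'')) (Read ''pa'' (Const 1) (Var ''y''))) R
      then R else sem out_path R)"
    by (simp only: S'_def check_edge_def sem.simps(1,4,5) R_def[symmetric] if_True)
  show ?thesis
  proof (cases "pa S 0 ?x = pa S 1 ?y")
    case pa: True
    have "consistent S ?e"
      unfolding consistent_def
    proof (intro allI impI)
      fix p q
      assume pq: "joins l ?e p q" "rk S p < rk S q"
      have "p = ?x \<and> q = ?y \<or> p = ?y \<and> q = ?x"
        using pq(1) j unfolding joins_def by metis
      with pq(2) less pa show "pa S 0 p = pa S 1 q" by (metis less_asym)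
    qed
    moreover have "S' = R" unfolding S' using pa by (simp add: arr)
    ultimately show ?thesis using v by simp
  next
    case pa: False
    then have "S' = sem out_path R" unfolding S' by (simp add: arr)
    moreover have "found (sem out_path R) \<and> var (sem out_path R) ''len'' \<noteq> 0"
      by (rule out_path[OF envR bipR]) (use True j B less pa v in \<open>simp_all add: arr inB\<close>)
    ultimately show ?thesis by simp
  qed
qed

section \<open>The complete parity test for two terminals\<close>

lemma core_init:
  assumes vars: "var S ''n'' = n" "var S ''m'' = m" "var S ''s'' = s" "var S ''t'' = t"
    and l: "arr S ''l'' = l"
    and A: "A = {e. e < n \<and> l 0 e \<noteq> 0 \<and> l 0 e \<noteq> var S ''sx'' \<and> l 0 e \<noteq> var S ''tx'' \<and>
      l 1 e \<noteq> var S ''sx'' \<and> l 1 e \<noteq> var S ''tx''}"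
  defines "S' \<equiv> sem core_init S"
  shows "env S' \<and> growing S'"
proof -
  define S1 where "S1 = sem (For ''e'' ''n'' alive_test) S"
  define S2 where "S2 = sem (For ''x'' ''m'' (Wrt ''B'' (Const 0) (Var ''x'') (Const 0))) S1"
  have S': "S' = sem core_roots S2"
    by (simp add: S'_def core_init_def S2_def S1_def)
  define I where "I k R \<longleftrightarrow> (\<forall>e < k. (arr R ''al'' 0 e = 1 \<longleftrightarrow> e \<in> A) \<and> arr R ''dn'' 0 e = 0)"
    for k and R :: state
  have "I (var S ''n'') S1"
    unfolding S1_def
  proof (rule For_inv[where I = I], goal_cases)
    case (5 k r)
    have r: "arr r ''l'' = l" "var r ''sx'' = var S ''sx''" "var r ''tx'' = var S ''tx''"
      using l by (simp_all add: agree_arr[OF 5(3)] agree_var[OF 5(3)])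
    have b: "bval alive r \<longleftrightarrow> k \<in> A" using 5(1,2) r vars(1) by (simp add: alive_def A)
    have "sem alive_test r = set_arr ''dn'' 0 k 0 (set_arr ''al'' 0 k (if bval alive r then 1 else 0) r)"
      using 5(2) by (simp add: alive_test_def)
    then have eq: "arr (sem alive_test r) ''al'' 0 = (arr r ''al'' 0)(k := if k \<in> A then 1 else 0)"
      "arr (sem alive_test r) ''dn'' 0 = (arr r ''dn'' 0)(k := 0)"
      by (simp_all add: b)
    show ?case using 5(4) unfolding I_def arr_set_var eq by (simp add: less_Suc_eq)
  qed (simp_all add: I_def)
  then have al: "\<forall>e < n. (arr S1 ''al'' 0 e = 1 \<longleftrightarrow> e \<in> A) \<and> arr S1 ''dn'' 0 e = 0"
    by (simp add: I_def vars)
  have "\<forall>x < var S1 ''m''. arr S2 ''B'' 0 x = 0"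
    unfolding S2_def
    by (rule For_inv[where I = "\<lambda>k R. \<forall>x < k. arr R ''B'' 0 x = 0"]) (auto simp: less_Suc_eq)
  then have B: "\<forall>x < m. arr S2 ''B'' 0 x = 0" using vars by (simp add: S1_def)
  have vars2: "var S2 ''n'' = n" "var S2 ''m'' = m" "var S2 ''s'' = s" "var S2 ''t'' = t"
    "arr S2 ''l'' = l" "arr S2 ''al'' = arr S1 ''al''" "arr S2 ''dn'' = arr S1 ''dn''"
    using vars l by (simp_all add: S2_def S1_def)
  then have "env S'" using al by (simp add: env_def S')
  moreover have inB: "inB S' = {s, t}"
    using B vars2 st by (auto simp: inB_def S' core_roots_def)
  have "arr S' ''dn'' 0 e \<noteq> 1" if "e \<in> A" for e
    using al edges_less[OF that] vars2 by (simp add: S')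
  moreover have "framed S'"
    using st vars2 unfolding framed_def inB
    by (auto simp: S' core_roots_def le_Suc_eq)
  ultimately show ?thesis by (simp add: growing_def bipolar_def inB)
qed

text \<open>When growth has stopped, every edge that touches \<open>B\<close> is processed. An
  inconsistent edge then yields an even path; if there is none, \<open>all_paths_odd\<close>
  applies.\<close>

lemma core:
  assumes vars: "var S ''n'' = n" "var S ''m'' = m" "var S ''s'' = s" "var S ''t'' = t"
    and l: "arr S ''l'' = l"
    and A: "A = {e. e < n \<and> l 0 e \<noteq> 0 \<and> l 0 e \<noteq> var S ''sx'' \<and> l 0 e \<noteq> var S ''tx'' \<and>
      l 1 e \<noteq> var S ''sx'' \<and> l 1 e \<noteq> var S ''tx''}"
    and len: "var S ''len'' = 0"
  defines "S' \<equiv> sem core S"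
  shows "found S' \<and> var S' ''len'' \<noteq> 0 \<or>
    var S' ''len'' = 0 \<and>
    (\<forall>xs es. rpath l A xs es \<longrightarrow> distinct xs \<longrightarrow> hd xs = s \<longrightarrow> last xs = t \<longrightarrow> odd (length es))"
proof -
  define S1 where "S1 = sem core_init S"
  define S2 where "S2 = sem (For ''q'' ''n'' grow) S1"
  have S': "S' = sem (For ''e'' ''n'' check_edge) S2"
    by (simp add: S'_def core_def S2_def S1_def)
  have env1: "env S1" and grow1: "growing S1"
    using core_init[OF vars l A] by (simp_all add: S1_def)
  have "finite A" using edges_less by (intro finite_subset[of A "{..<n}"]) auto
  have set_q: "growing (set_var ''q'' k R) = growing R" "growable (set_var ''q'' k R) = growable R"
    "treated (set_var ''q'' k R) = treated R" for k R
    by (simp_all add: growing_def processed_def arr_eqD[OF arr_set_var] growable_def treated_def)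
  have "growing S2 \<and> \<not> growable S2"
    unfolding S2_def
  proof (rule For_until[where \<mu> = "\<lambda>R. card (treated R)"], unfold set_q, goal_cases)
    case (5 k r)
    have "env r" by (rule env_agree[OF env1 5(1)]) simp_all
    from grow[OF this 5(2)] 5(3) show ?case by simp
  next
    case (6 k r)
    have "env r" by (rule env_agree[OF env1 6(1)]) simp_all
    from grow[OF this 6(2)] 6(3) show ?case by simp
  next
    case (7 r)
    \<comment> \<open>Growth is possible only while some edge is untreated, so \<open>n\<close>
      rounds are enough.\<close>
    then obtain e where e: "e \<in> A" "e \<notin> treated r" by (auto simp: growable_def treated_def)
    then have "treated r \<subseteq> {..<n} - {e}" using edges_less by (auto simp: treated_def)
    then have "card (treated r) \<le> card ({..<n} - {e})" by (intro card_mono) auto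
    moreover have "var S1 ''n'' = n" using env1 by (simp add: env_def)
    ultimately show ?case using edges_less[OF e(1)] by simp
  qed (use grow1 in simp_all)
  then have bip: "bipolar S2" and processed: "\<And>e. e \<in> A \<Longrightarrow> l 0 e \<in> inB S2 \<or> l 1 e \<in> inB S2 \<Longrightarrow> processed S2 e"
    by (auto simp: growing_def growable_def)
  have env2: "env S2" unfolding S2_def by (rule env_sem[OF env1]) simp_all
  then have n2: "var S2 ''n'' = n" by (simp add: env_def)
  define I where "I k R \<longleftrightarrow> found R \<and> var R ''len'' \<noteq> 0 \<or>
      var R ''len'' = 0 \<and> (\<forall>e < k. e \<in> A \<longrightarrow> consistent S2 e)" for k and R :: state
  have set_e: "I k (set_var ''e'' j R) = I k R" for k j R
    by (simp add: I_def found_def)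
  have "I (var S2 ''n'') S'"
    unfolding S'
  proof (rule For_inv[where I = I], unfold set_e, goal_cases)
    case 4
    show ?case using len by (simp add: I_def S2_def S1_def)
  next
    case (5 k r)
    show ?case
    proof (cases "var r ''len'' = 0")
      case True
      have env: "env r" by (rule env_agree[OF env2 5(3)]) simp_all
      have r: "bipolar r" "inB r = inB S2" "rk r = rk S2"
        by (rule bipolar_agree[OF bip 5(3)], simp)+
      have "pa r = pa S2" by (subst agree_arr[OF 5(3)]) simp_all
      then have cons: "consistent r e = consistent S2 e" for e
        by (simp add: consistent_def r)
      have "var r ''e'' < n" using 5(1,2) n2 by simp
      from check_edge[OF env r(1) this True] show ?thesis
        using 5(2,4) True by (auto simp: I_def cons less_Suc_eq)
    next
      case False
      then have "sem check_edge r = r" by (simp add: check_edge_def)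
      then show ?thesis using False 5(4) by (simp add: I_def)
    qed
  qed simp_all
  then consider "found S'" "var S' ''len'' \<noteq> 0"
    | "var S' ''len'' = 0" "\<And>e. e \<in> A \<Longrightarrow> consistent S2 e"
    using edges_less n2 by (auto simp: I_def)
  then show ?thesis
  proof cases
    case 2
    have "odd (length es)" if "rpath l A xs es" "distinct xs" "hd xs = s" "last xs = t" for xs es
    proof (rule all_paths_odd[OF bip _ _ that])
      show "y \<in> inB S2 \<or> dead e" if "e \<in> A" "joins l e x y" "x \<in> inB S2" for e x y
      proof -
        have "l 0 e \<in> inB S2 \<or> l 1 e \<in> inB S2" using that(2,3) unfolding joins_def by metis
        then have "processed S2 e" using processed that(1) by blast
        then show ?thesis using that(2) unfolding processed_def joins_def by metis
      qed
      show "pa S2 0 x = pa S2 1 y"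
        if "e \<in> A" "joins l e x y" "x \<in> inB S2" "y \<in> inB S2" "rk S2 x < rk S2 y" for e x y
        using 2(2)[OF that(1)] that unfolding consistent_def by blast
    qed
    then show ?thesis using 2 by blast
  qed simp
qed

end

section \<open>Induced paths in a line graph\<close>

text \<open>Each edge of \<open>G\<close> has two different ends and the entries of \<open>p\<close>
  are distinct, so the equality of edge sets becomes a condition on pairs of positions.\<close>

lemma is_path_iff:
  assumes "simple_graph G"
  shows "is_path G p \<longleftrightarrow> p \<noteq> [] \<and> distinct p \<and> set p \<subseteq> verts G \<and>
    (\<forall>i j. i < j \<longrightarrow> j < length p \<longrightarrow> ({p ! i, p ! j} \<in> edges G \<longleftrightarrow> j = Suc i))"
proof (cases "distinct p")
  case True
  have edge_eq: "{p ! k, p ! Suc k} = {p ! i, p ! j} \<longleftrightarrow> k = i \<and> j = Suc i"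
    if "i < j" "j < length p" "Suc k < length p" for i j k
    using that True by (auto simp: doubleton_eq_iff nth_eq_iff_index_eq)
  have "{e \<in> edges G. e \<subseteq> set p} = {{p ! i, p ! Suc i} |i. Suc i < length p} \<longleftrightarrow>
    (\<forall>i j. i < j \<longrightarrow> j < length p \<longrightarrow> ({p ! i, p ! j} \<in> edges G \<longleftrightarrow> j = Suc i))" (is "?E = ?P \<longleftrightarrow> ?R")
  proof
    assume eq: "?E = ?P"
    show ?R
    proof (intro allI impI)
      fix i j assume ij: "i < j" "j < length p"
      have "{p ! i, p ! j} \<in> edges G \<longleftrightarrow> {p ! i, p ! j} \<in> ?E" using ij by auto
      also have "\<dots> \<longleftrightarrow> (\<exists>k. Suc k < length p \<and> {p ! k, p ! Suc k} = {p ! i, p ! j})"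
        unfolding eq by auto
      also have "\<dots> \<longleftrightarrow> j = Suc i" using edge_eq[OF ij] ij by auto
      finally show "{p ! i, p ! j} \<in> edges G \<longleftrightarrow> j = Suc i" .
    qed
  next
    assume R: ?R
    show "?E = ?P"
    proof (intro equalityI subsetI)
      fix e assume e: "e \<in> ?E"
      then obtain u v where uv: "u \<noteq> v" "e = {u, v}" using assms by (auto simp: simple_graph_def)
      with e obtain i j where "i < length p" "j < length p" "u = p ! i" "v = p ! j"
        by (auto simp: in_set_conv_nth)
      with uv obtain i j where ij: "i < j" "j < length p" "e = {p ! i, p ! j}"
        by (metis insert_commute linorder_neqE_nat)
      with R e have "j = Suc i" by auto
      with ij show "e \<in> ?P" by auto
    next
      fix e assume "e \<in> ?P"
      then obtain i where "Suc i < length p" "e = {p ! i, p ! Suc i}" by auto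
      with R show "e \<in> ?E" by auto
    qed
  qed
  then show ?thesis by (auto simp: is_path_def induced_subgraph_def path_graph_def)
qed (simp add: is_path_def)

definition share :: "(nat \<Rightarrow> nat \<Rightarrow> nat) \<Rightarrow> nat \<Rightarrow> nat \<Rightarrow> bool" where
  "share l u v \<longleftrightarrow> l 0 u = l 0 v \<or> l 0 u = l 1 v \<or> l 1 u = l 0 v \<or> l 1 u = l 1 v"

lemma share_joins:
  "joins l e x y \<Longrightarrow> joins l f z w \<Longrightarrow> share l e f \<longleftrightarrow> x = z \<or> x = w \<or> y = z \<or> y = w"
  unfolding joins_def share_def by metis

lemma shareD: "share l u v \<Longrightarrow> \<exists>c y z. joins l u c y \<and> joins l v c z"
  unfolding share_def joins_def by metis

text \<open>Labels are the vertices of a root multigraph of the part of \<open>G\<close> where \<open>l 0\<close> is nonzero: the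
  vertex \<open>v\<close> of \<open>G\<close> is the edge with the ends \<open>l 0 v\<close> and \<open>l 1 v\<close>.\<close>

definition root_labelling :: "nat \<Rightarrow> nat \<Rightarrow> (nat \<Rightarrow> nat \<Rightarrow> bool) \<Rightarrow> (nat \<Rightarrow> nat \<Rightarrow> nat) \<Rightarrow> bool" where
  "root_labelling n m adj l \<longleftrightarrow>
     (\<forall>u < n. l 0 u \<noteq> 0 \<longrightarrow> (l 1 u \<noteq> 0 \<and> l 0 u \<noteq> l 1 u \<and> l 0 u < m \<and> l 1 u < m) \<and>
       (\<forall>v < n. u = v \<or> (adj u v \<longleftrightarrow> l 0 v \<noteq> 0 \<and> share l u v)))"

locale labelled_graph =
  fixes G :: "nat graph" and n m :: nat and l :: "nat \<Rightarrow> nat \<Rightarrow> nat"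
  assumes simple: "simple_graph G" and verts: "verts G = {..<n}"
    and labelling: "root_labelling n m (\<lambda>u v. {u, v} \<in> edges G) l"
begin

definition D :: "nat set" where
  "D = {v. v < n \<and> l 0 v \<noteq> 0}"

lemma adj: "u \<in> D \<Longrightarrow> v < n \<Longrightarrow> u \<noteq> v \<Longrightarrow> {u, v} \<in> edges G \<longleftrightarrow> v \<in> D \<and> share l u v"
  using labelling by (auto simp: root_labelling_def D_def)

lemma labelsD: "v \<in> D \<Longrightarrow> l 0 v \<noteq> 0 \<and> l 1 v \<noteq> 0 \<and> l 0 v \<noteq> l 1 v \<and> l 0 v < m \<and> l 1 v < m"
  using labelling by (auto simp: root_labelling_def D_def)

text \<open>No edge of \<open>G\<close> leaves the labelled part.\<close>

lemma path_subset_D: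
  assumes "is_path G p" "hd p \<in> D"
  shows "set p \<subseteq> D"
proof -
  have p: "p \<noteq> []" "distinct p" "set p \<subseteq> {..<n}"
    "\<And>i j. i < j \<Longrightarrow> j < length p \<Longrightarrow> {p ! i, p ! j} \<in> edges G \<longleftrightarrow> j = Suc i"
    using assms(1) verts unfolding is_path_iff[OF simple] by auto
  have "p ! i \<in> D" if "i < length p" for i
    using that
  proof (induction i)
    case 0
    then show ?case using assms(2) p(1) by (simp add: hd_conv_nth)
  next
    case (Suc i)
    have "p ! Suc i \<in> set p" using Suc.prems by simp
    then have "p ! Suc i < n" using p(3) by auto
    moreover have "{p ! i, p ! Suc i} \<in> edges G" "p ! i \<noteq> p ! Suc i" "p ! i \<in> D"
      using p Suc by (auto simp: nth_eq_iff_index_eq)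
    ultimately show ?case using adj by blast
  qed
  then show ?thesis by (auto simp: in_set_conv_nth)
qed

text \<open>Two edges of a path in the root share an end only if they are consecutive, so the
  corresponding vertices of \<open>G\<close> induce a path.\<close>

lemma rpath_imp_path:
  assumes "rpath l D xs p" "distinct xs" "p \<noteq> []"
  shows "is_path G p"
proof -
  have len: "length xs = Suc (length p)"
    and e: "\<And>i. i < length p \<Longrightarrow> p ! i \<in> D \<and> joins l (p ! i) (xs ! i) (xs ! Suc i)"
    using assms(1) by (auto simp: rpath_def)
  have nth_eq: "xs ! i = xs ! j \<longleftrightarrow> i = j" if "i \<le> length p" "j \<le> length p" for i j
    using that assms(2) len by (simp add: nth_eq_iff_index_eq)
  have ne: "p ! i \<noteq> p ! j" if "i < j" "j < length p" for i j
  proof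
    assume "p ! i = p ! j"
    then have "joins l (p ! i) (xs ! j) (xs ! Suc j)" "joins l (p ! i) (xs ! i) (xs ! Suc i)"
      using e[of i] e[of j] that by simp_all
    then have "xs ! i = xs ! j \<or> xs ! i = xs ! Suc j" unfolding joins_def by metis
    then show False using nth_eq that by auto
  qed
  have "distinct p"
    using ne by (auto simp: distinct_conv_nth) (metis linorder_neqE_nat)
  moreover have "set p \<subseteq> {..<n}" using e by (auto simp: in_set_conv_nth D_def)
  moreover have "{p ! i, p ! j} \<in> edges G \<longleftrightarrow> j = Suc i" if ij: "i < j" "j < length p" for i j
  proof -
    have i: "i < length p" using ij by simp
    have "p ! j < n" using e[OF ij(2)] by (simp add: D_def)
    then have "{p ! i, p ! j} \<in> edges G \<longleftrightarrow> share l (p ! i) (p ! j)"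
      using adj[of "p ! i" "p ! j"] e[OF ij(2)] e[OF i] ne[OF ij] by auto
    also have "\<dots> \<longleftrightarrow> j = Suc i"
      using share_joins[of l "p ! i" "xs ! i" "xs ! Suc i" "p ! j" "xs ! j" "xs ! Suc j"]
        e[OF ij(2)] e[OF i] nth_eq ij by auto
    finally show ?thesis .
  qed
  ultimately show ?thesis using assms(3) verts unfolding is_path_iff[OF simple] by auto
qed

text \<open>Consecutive vertices share a label and others share none. So the shared labels are
  distinct and form the path, completed by the outer ends of the first and the last edge. With two
  vertices only, the edges might be parallel, and no distinct list would exist.\<close>

lemma path_imp_rpath:
  assumes path: "is_path G p" and hd: "hd p \<in> D" and len: "3 \<le> length p"
  shows "\<exists>xs. rpath l D xs p \<and> distinct xs"
proof -
  let ?k = "length p"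
  have p: "distinct p" "set p \<subseteq> {..<n}"
    "\<And>i j. i < j \<Longrightarrow> j < ?k \<Longrightarrow> {p ! i, p ! j} \<in> edges G \<longleftrightarrow> j = Suc i"
    using path verts unfolding is_path_iff[OF simple] by auto
  have inD: "p ! i \<in> D" if "i < ?k" for i
    using path_subset_D[OF path hd] that by (auto dest: nth_mem)
  have sh: "share l (p ! i) (p ! j) \<longleftrightarrow> j = Suc i" if "i < j" "j < ?k" for i j
    using that p(3)[OF that] adj[of "p ! i" "p ! j"] inD[of i] inD[of j] p(1)
    by (auto simp: D_def nth_eq_iff_index_eq)
  have "\<exists>c. (\<exists>y. joins l (p ! i) c y) \<and> (\<exists>z. joins l (p ! Suc i) c z)" if "Suc i < ?k" for i
    using shareD[of l "p ! i" "p ! Suc i"] sh[of i "Suc i"] that by auto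
  then obtain c where c: "\<And>i. Suc i < ?k \<Longrightarrow> (\<exists>y. joins l (p ! i) (c i) y) \<and> (\<exists>z. joins l (p ! Suc i) (c i) z)"
    by metis
  have far: "x \<noteq> z" if "joins l (p ! i) x y" "joins l (p ! j) z w" "i < j" "j < ?k" "j \<noteq> Suc i" for i j x y z w
    using that sh share_joins by blast
  have c_ne: "c i \<noteq> c j" if ij: "i < j" "Suc j < ?k" for i j
  proof -
    have "Suc i < ?k" using ij by simp
    then obtain y z where "joins l (p ! i) (c i) y" "joins l (p ! Suc j) (c j) z"
      using c[of i] c[of j] ij(2) by blast
    then show ?thesis using far[of i "c i" y "Suc j" "c j" z] ij by simp
  qed
  have "0 < ?k" "Suc (?k - 2) < ?k" "Suc (?k - 2) = ?k - 1" using len by auto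
  then obtain y0 yk where y0: "joins l (p ! 0) y0 (c 0)" and yk: "joins l (p ! (?k - 1)) (c (?k - 2)) yk"
    using c[of 0] c[of "?k - 2"] len by (auto simp: joins_commute)
  define x where "x i = (if i = 0 then y0 else if i = ?k then yk else c (i - 1))" for i
  have join: "joins l (p ! i) (x i) (x (Suc i))" if i: "i < ?k" for i
  proof -
    consider "i = 0" | "i = ?k - 1" "i \<noteq> 0" | j where "i = Suc j" "Suc (Suc j) < ?k"
      using i by (cases i) (auto, linarith)
    then show ?thesis
    proof cases
      case 1
      then show ?thesis using y0 len by (simp add: x_def)
    next
      case 2
      then show ?thesis using yk len by (auto simp: x_def numeral_2_eq_2)
    next
      case 3
      then have "\<exists>z. joins l (p ! i) (c j) z" "\<exists>z. joins l (p ! i) (c (Suc j)) z" "c j \<noteq> c (Suc j)"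
        using c[of j] c[of "Suc j"] c_ne[of j "Suc j"] by auto
      then have "joins l (p ! i) (c j) (c (Suc j))" unfolding joins_def by auto
      then show ?thesis using 3 by (simp add: x_def)
    qed
  qed
  have loop: "x i \<noteq> x (Suc i)" if "i < ?k" for i
    using join[OF that] labelsD[OF inD[OF that]] unfolding joins_def by auto
  have ne: "x i \<noteq> x j" if ij: "i < j" "j \<le> ?k" for i j
  proof (cases "j = Suc i")
    case True
    then show ?thesis using loop ij by simp
  next
    case False
    show ?thesis
    \<comment> \<open>In these cases an outer end is involved, and the two labels belong to edges
      that are not consecutive; otherwise both are shared labels.\<close>
    proof (cases "i = 0 \<and> j < ?k \<or> 0 < i \<and> j = ?k \<or> i = 0 \<and> j = ?k")
      case True
      then consider "i = 0" "j < ?k" | "j = ?k" by blast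
      then show ?thesis
      proof cases
        case 1
        then show ?thesis using far[OF join join, of 0 j] False ij \<open>0 < ?k\<close> by simp
      next
        case 2
        define h where "h = ?k - 1"
        have h: "j = Suc h" "h < ?k" using 2 len by (auto simp: h_def)
        show ?thesis
        proof (cases "i = 0")
          case True
          have "joins l (p ! 0) (x 0) (x (Suc 0))" "joins l (p ! h) (x (Suc h)) (x h)"
            using join[OF \<open>0 < ?k\<close>] join[OF h(2)] by (simp_all add: joins_commute)
          then have "x 0 \<noteq> x (Suc h)"
            using far[of 0 "x 0" _ h "x (Suc h)"] h 2 len by fastforce
          then show ?thesis using True h by simp
        next
          case False
          then obtain g where g: "i = Suc g" by (cases i) auto
          have "joins l (p ! g) (x (Suc g)) (x g)" "joins l (p ! h) (x (Suc h)) (x h)"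
            using join[of g] join[of h] g h ij by (auto simp: joins_commute)
          then have "x (Suc g) \<noteq> x (Suc h)"
            using far[of g "x (Suc g)" _ h "x (Suc h)"] g h ij \<open>j \<noteq> Suc i\<close> by auto
          then show ?thesis using g h by simp
        qed
      qed
    next
      case False
      then obtain g h where "i = Suc g" "j = Suc h" "j < ?k"
        using ij by (cases i; cases j) auto
      then show ?thesis using c_ne[of g h] ij by (simp add: x_def)
    qed
  qed
  let ?xs = "map x [0..<Suc ?k]"
  have "distinct ?xs"
    using ne by (auto simp: distinct_map inj_on_def simp del: upt_Suc) (metis less_Suc_eq_le linorder_neqE_nat)
  moreover have "rpath l D ?xs p"
    using join inD by (auto simp: rpath_def nth_append simp del: upt_Suc)
  ultimately show ?thesis by blast
qed

end

section \<open>Finding a root graph\<close>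

text \<open>The edge \<open>f v\<close> of the root graph corresponds to the vertex \<open>v\<close>.\<close>

locale root =
  fixes n :: nat and adj :: "nat \<Rightarrow> nat \<Rightarrow> bool" and f :: "nat \<Rightarrow> nat set"
  assumes doubleton: "v < n \<Longrightarrow> \<exists>x y. x \<noteq> y \<and> f v = {x, y}"
    and inj: "u < n \<Longrightarrow> v < n \<Longrightarrow> f u = f v \<Longrightarrow> u = v"
    and adj_iff: "u < n \<Longrightarrow> v < n \<Longrightarrow> u \<noteq> v \<Longrightarrow> adj u v \<longleftrightarrow> f u \<inter> f v \<noteq> {}"
    and irrefl: "\<not> adj v v"
begin

text \<open>Let \<open>p\<close> be a common end of \<open>a\<close> and \<open>u\<close>, and let
  \<open>y\<close> and \<open>z\<close> be their other ends. A common neighbour that misses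
  \<open>p\<close> is the edge \<open>yz\<close>, of which a simple root graph has at most one;
  excluding it as \<open>g\<close> leaves the edges at \<open>p\<close>.\<close>

lemma first_clique:
  assumes a: "a < n" and u: "u = a \<and> (\<forall>v < n. \<not> adj a v) \<or> u < n \<and> adj a u"
  shows "\<exists>g < n. \<exists>p. \<forall>v < n. (v = a \<or> adj a v \<and> (v = u \<or> adj u v) \<and> v \<noteq> g) \<longleftrightarrow> p \<in> f v"
proof (cases "u < n \<and> adj a u")
  case False
  with u have none: "\<forall>v < n. \<not> adj a v" by blast
  obtain p q where "f a = {p, q}" using doubleton[OF a] by blast
  \<comment> \<open>Without neighbours, the clique at either end is \<open>a\<close> alone.\<close>
  then have "(v = a \<or> adj a v \<and> (v = u \<or> adj u v) \<and> v \<noteq> a) \<longleftrightarrow> p \<in> f v" if "v < n" for v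
    using none that adj_iff[OF a that] by auto
  then show ?thesis using a by blast
next
  case True
  then have u: "u < n" "adj a u" "u \<noteq> a" using irrefl by auto
  then obtain p where p: "p \<in> f a" "p \<in> f u" using adj_iff[OF a u(1)] by auto
  obtain y where y: "f a = {p, y}" "p \<noteq> y" using doubleton[OF a] p(1) by (metis insert_commute insertE singletonD)
  obtain z where z: "f u = {p, z}" "p \<noteq> z" using doubleton[OF u(1)] p(2) by (metis insert_commute insertE singletonD)
  have "y \<noteq> z" using y z inj[OF a u(1)] u(3) by auto
  define g where "g = (if \<exists>w < n. f w = {y, z} then SOME w. w < n \<and> f w = {y, z} else a)"
  have g: "g < n \<and> f g = {y, z}" if "\<exists>w < n. f w = {y, z}"
    using someI_ex[of "\<lambda>w. w < n \<and> f w = {y, z}"] that by (auto simp: g_def)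
  have gn: "g < n" using g a by (cases "\<exists>w < n. f w = {y, z}") (auto simp: g_def)
  have "(v = a \<or> adj a v \<and> (v = u \<or> adj u v) \<and> v \<noteq> g) \<longleftrightarrow> p \<in> f v" if v: "v < n" for v
  proof
    assume "v = a \<or> adj a v \<and> (v = u \<or> adj u v) \<and> v \<noteq> g"
    then consider "v = a" | "v = u" | "v \<noteq> a" "v \<noteq> u" "adj a v" "adj u v" "v \<noteq> g" by blast
    then show "p \<in> f v"
    proof cases
      case 3
      show ?thesis
      proof (rule ccontr)
        assume "p \<notin> f v"
        moreover have "f a \<inter> f v \<noteq> {}" "f u \<inter> f v \<noteq> {}"
          using adj_iff[OF a v] adj_iff[OF u(1) v] 3 by auto
        ultimately have "y \<in> f v" "z \<in> f v" using y z by auto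
        then have fv: "f v = {y, z}" using doubleton[OF v] \<open>y \<noteq> z\<close> by auto
        then have "f g = f v" "g < n" using g v by auto
        then show False using inj[OF _ v] 3(5) by blast
      qed
    qed (use p in auto)
  next
    assume pv: "p \<in> f v"
    have "v \<noteq> g \<or> v = a"
    proof (cases "\<exists>w < n. f w = {y, z}")
      case True
      then show ?thesis using g pv y z by auto
    next
      case False
      then have "g = a" unfolding g_def by (simp only: if_False)
      then show ?thesis by blast
    qed
    moreover have "adj a v" if "v \<noteq> a" using adj_iff[OF a v] that pv p by auto
    moreover have "adj u v" if "v \<noteq> u" using adj_iff[OF u(1) v] that pv p by auto
    ultimately show "v = a \<or> adj a v \<and> (v = u \<or> adj u v) \<and> v \<noteq> g" by blast
  qed
  then show ?thesis using gn by blast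
qed

text \<open>The label \<open>k\<close> stands for the vertex \<open>\<phi> k\<close> of the root and
  marks all edges at it; 0 stands for an end not labelled so far, and the slot \<open>l 0\<close> is
  filled first.\<close>

definition partial_labelling :: "(nat \<Rightarrow> nat) \<Rightarrow> nat \<Rightarrow> (nat \<Rightarrow> nat \<Rightarrow> nat) \<Rightarrow> bool" where
  "partial_labelling \<phi> c l \<longleftrightarrow> inj_on \<phi> {1..c} \<and>
     (\<forall>v < n. \<forall>k \<in> {1..c}. (l 0 v = k \<or> l 1 v = k) \<longleftrightarrow> \<phi> k \<in> f v) \<and>
     (\<forall>v < n. l 0 v \<le> c \<and> l 1 v \<le> c \<and> (l 0 v = 0 \<longrightarrow> l 1 v = 0) \<and> (l 0 v \<noteq> 0 \<longrightarrow> l 0 v \<noteq> l 1 v))"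

lemma both_labels:
  assumes "partial_labelling \<phi> c l" "v < n" "l 1 v \<noteq> 0"
  shows "f v = {\<phi> (l 0 v), \<phi> (l 1 v)}"
proof -
  note part = assms(1)[unfolded partial_labelling_def]
  have inj\<phi>: "inj_on \<phi> {1..c}"
    and lab: "\<forall>v < n. \<forall>k \<in> {1..c}. (l 0 v = k \<or> l 1 v = k) \<longleftrightarrow> \<phi> k \<in> f v"
    and rng: "\<forall>v < n. l 0 v \<le> c \<and> l 1 v \<le> c \<and> (l 0 v = 0 \<longrightarrow> l 1 v = 0) \<and> (l 0 v \<noteq> 0 \<longrightarrow> l 0 v \<noteq> l 1 v)"
    using part[THEN conjunct1] part[THEN conjunct2, THEN conjunct1] part[THEN conjunct2, THEN conjunct2] .
  have k: "l 0 v \<in> {1..c}" "l 1 v \<in> {1..c}" "l 0 v \<noteq> l 1 v"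
    using rng[rule_format, OF assms(2)] assms(3) by (auto simp: Suc_le_eq)
  have "\<phi> (l 0 v) \<in> f v" "\<phi> (l 1 v) \<in> f v" using lab assms(2) k by blast+
  moreover have "\<phi> (l 0 v) \<noteq> \<phi> (l 1 v)" using inj_onD[OF inj\<phi> _ k(1,2)] k(3) by blast
  ultimately show ?thesis using doubleton[OF assms(2)] by auto
qed

text \<open>Let \<open>y\<close> be the unlabelled end of \<open>v\<close>. The other edges at
  \<open>y\<close> are the neighbours of \<open>v\<close> that avoid its labelled end, since an edge
  with both ends would coincide with \<open>v\<close>. So exactly the clique at \<open>y\<close>
  gets the next label.\<close>

lemma partial_labelling_step:
  assumes part: "partial_labelling \<phi> c l" and v: "v < n" "l 0 v \<noteq> 0" "l 1 v = 0"
  defines "hit \<equiv> \<lambda>x. adj v x \<and> l 0 x \<noteq> l 0 v \<and> l 1 x \<noteq> l 0 v"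
  assumes l'0: "\<And>x. x < n \<Longrightarrow> l' 0 x = (if hit x \<and> l 0 x = 0 then Suc c else l 0 x)"
    and l'1: "\<And>x. x < n \<Longrightarrow> l' 1 x = (if x = v \<or> hit x \<and> l 0 x \<noteq> 0 then Suc c else l 1 x)"
  shows "\<exists>\<phi>. partial_labelling \<phi> (Suc c) l'"
proof -
  have inj\<phi>: "inj_on \<phi> {1..c}"
    and lab: "\<And>x k. x < n \<Longrightarrow> 1 \<le> k \<Longrightarrow> k \<le> c \<Longrightarrow> (l 0 x = k \<or> l 1 x = k) \<longleftrightarrow> \<phi> k \<in> f x"
    and rng: "\<And>x. x < n \<Longrightarrow> l 0 x \<le> c \<and> l 1 x \<le> c \<and> (l 0 x = 0 \<longrightarrow> l 1 x = 0) \<and> (l 0 x \<noteq> 0 \<longrightarrow> l 0 x \<noteq> l 1 x)"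
    using part by (auto simp: partial_labelling_def)
  have k0: "1 \<le> l 0 v" "l 0 v \<le> c" using v rng[OF v(1)] by auto
  have "\<phi> (l 0 v) \<in> f v" using lab[OF v(1) k0] by simp
  then obtain y where y: "f v = {\<phi> (l 0 v), y}" "\<phi> (l 0 v) \<noteq> y"
    using doubleton[OF v(1)] by (metis insert_commute insertE singletonD)
  have fresh: "\<phi> k \<noteq> y" if "1 \<le> k" "k \<le> c" for k
  proof
    assume "\<phi> k = y"
    then have "l 0 v = k \<or> l 1 v = k" using lab[OF v(1) that] y by simp
    then show False using v that y \<open>\<phi> k = y\<close> by auto
  qed
  have hit: "hit x \<longleftrightarrow> x \<noteq> v \<and> y \<in> f x" if x: "x < n" for x
  proof
    assume h: "hit x"
    then have "x \<noteq> v" by (auto simp: hit_def irrefl)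
    moreover have "\<phi> (l 0 v) \<notin> f x" using lab[OF x k0] h by (simp add: hit_def)
    moreover have "f v \<inter> f x \<noteq> {}" using adj_iff[OF v(1) x] h \<open>x \<noteq> v\<close> by (auto simp: hit_def)
    ultimately show "x \<noteq> v \<and> y \<in> f x" using y by auto
  next
    assume h: "x \<noteq> v \<and> y \<in> f x"
    have "\<phi> (l 0 v) \<notin> f x"
    proof
      assume "\<phi> (l 0 v) \<in> f x"
      then have "f x = f v" using h y doubleton[OF x] by auto
      then show False using inj[OF x v(1)] h by blast
    qed
    then have "l 0 x \<noteq> l 0 v" "l 1 x \<noteq> l 0 v" using lab[OF x k0] by auto
    moreover have "adj v x" using adj_iff[OF v(1) x] h y by auto
    ultimately show "hit x" by (simp add: hit_def)
  qed
  \<comment> \<open>An edge at \<open>y\<close> with two labels would make \<open>y\<close> a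
    labelled vertex, so a slot is free.\<close>
  have free: "l 1 x = 0" if "x < n" "hit x" for x
  proof (rule ccontr)
    assume "l 1 x \<noteq> 0"
    then have "f x = {\<phi> (l 0 x), \<phi> (l 1 x)}" "1 \<le> l 0 x" "l 0 x \<le> c" "1 \<le> l 1 x" "l 1 x \<le> c"
      using both_labels[OF part that(1)] rng[OF that(1)] by auto
    moreover have "y \<in> f x" using hit that by blast
    ultimately show False using fresh[of "l 0 x"] fresh[of "l 1 x"] by auto
  qed
  define \<phi>' where "\<phi>' = \<phi>(Suc c := y)"
  have "partial_labelling \<phi>' (Suc c) l'"
    unfolding partial_labelling_def
  proof (intro conjI allI impI ballI)
    show "inj_on \<phi>' {1..Suc c}"
    proof (rule inj_onI)
      fix i j assume ij: "i \<in> {1..Suc c}" "j \<in> {1..Suc c}" "\<phi>' i = \<phi>' j"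
      show "i = j"
      proof (cases "i = Suc c \<or> j = Suc c")
        case True
        then show ?thesis using ij fresh[of i] fresh[of j] by (auto simp: \<phi>'_def split: if_splits)
      next
        case False
        then show ?thesis using ij inj_onD[OF inj\<phi>, of i j] by (auto simp: \<phi>'_def)
      qed
    qed
  next
    fix x k assume x: "x < n" and k: "k \<in> {1..Suc c}"
    show "(l' 0 x = k \<or> l' 1 x = k) \<longleftrightarrow> \<phi>' k \<in> f x"
    proof (cases "k = Suc c")
      case True
      have "(l' 0 x = Suc c \<or> l' 1 x = Suc c) \<longleftrightarrow> hit x \<or> x = v"
        using rng[OF x] by (auto simp: l'0[OF x] l'1[OF x, unfolded One_nat_def])
      also have "\<dots> \<longleftrightarrow> y \<in> f x" using hit[OF x] y by auto
      finally show ?thesis using True by (simp add: \<phi>'_def)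
    next
      case False
      then have "(l' 0 x = k \<or> l' 1 x = k) \<longleftrightarrow> (l 0 x = k \<or> l 1 x = k)"
        using k free[OF x] v by (auto simp: l'0[OF x] l'1[OF x, unfolded One_nat_def])
      then show ?thesis using lab[OF x] k False by (simp add: \<phi>'_def)
    qed
  next
    fix x assume x: "x < n"
    show "l' 0 x \<le> Suc c" "l' 1 x \<le> Suc c" using rng[OF x] by (auto simp: l'0[OF x] l'1[OF x, unfolded One_nat_def])
    show "l' 1 x = 0" if "l' 0 x = 0"
      using that rng[OF x] v by (auto simp: l'0[OF x] l'1[OF x, unfolded One_nat_def] split: if_splits)
    show "l' 0 x \<noteq> l' 1 x" if "l' 0 x \<noteq> 0"
      using that rng[OF x] hit[OF x] by (auto simp: l'0[OF x] l'1[OF x, unfolded One_nat_def] split: if_splits)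
  qed
  then show ?thesis by blast
qed

text \<open>With no edge half labelled, labelled edges meet exactly if they share a label. An edge
  without labels meets none of them, since a label in use marks all edges at its vertex.\<close>

lemma partial_labelling_complete:
  assumes part: "partial_labelling \<phi> c l" and full: "\<And>v. v < n \<Longrightarrow> l 0 v \<noteq> 0 \<Longrightarrow> l 1 v \<noteq> 0"
    and c: "c < m"
  shows "root_labelling n m adj l"
  unfolding root_labelling_def
proof (intro allI impI conjI)
  fix u assume u: "u < n" "l 0 u \<noteq> 0"
  note rng = part[unfolded partial_labelling_def]
  show "l 1 u \<noteq> 0" "l 0 u \<noteq> l 1 u" "l 0 u < m" "l 1 u < m"
    using full[OF u] u rng c by (auto intro: le_less_trans)
  fix v assume v: "v < n"
  have fu: "f u = {\<phi> (l 0 u), \<phi> (l 1 u)}" using both_labels[OF part u(1) full[OF u]] .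
  have ku: "l 0 u \<in> {1..c}" "l 1 u \<in> {1..c}" using full[OF u] u rng by (auto simp: Suc_le_eq)
  have lab: "\<phi> k \<in> f v \<longleftrightarrow> l 0 v = k \<or> l 1 v = k" if "k \<in> {1..c}" for k
    using that rng v by blast
  show "u = v \<or> (adj u v \<longleftrightarrow> l 0 v \<noteq> 0 \<and> share l u v)"
  proof (cases "u = v")
    case False
    have "adj u v \<longleftrightarrow> \<phi> (l 0 u) \<in> f v \<or> \<phi> (l 1 u) \<in> f v"
      using adj_iff[OF u(1) v False] fu by auto
    also have "\<dots> \<longleftrightarrow> share l u v"
      using lab ku unfolding share_def by metis
    also have "\<dots> \<longleftrightarrow> l 0 v \<noteq> 0 \<and> share l u v"
    proof -
      have "l 0 v \<noteq> 0" if "share l u v"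
        using that ku rng v unfolding share_def by force
      then show ?thesis by blast
    qed
    finally show ?thesis by blast
  qed simp
qed

end

section \<open>Programs that find a root labelling\<close>

abbreviation adjb :: "string \<Rightarrow> string \<Rightarrow> bexp" where
  "adjb i j \<equiv> Eq (Read ''adj'' (Var i) (Var j)) (Const 1)"

definition find_neighbour :: prog where
  "find_neighbour =
     Asg ''u'' (Var ''a'') ;; For ''x'' ''n'' (Ite (adjb ''a'' ''x'') (Asg ''u'' (Var ''x'')) Nop)"

text \<open>This is the condition of \<open>first_clique\<close>, with disjunctions spelled by
  \<open>Neg\<close> and \<open>Conj\<close>, as the language has none.\<close>

definition in_first :: bexp where
  "in_first =
     Neg (Conj (Neg (Eq (Var ''x'') (Var ''a'')))
       (Neg (Conj (adjb ''a'' ''x'')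
         (Conj (Neg (Conj (Neg (Eq (Var ''x'') (Var ''u''))) (Neg (adjb ''u'' ''x''))))
           (Neg (Eq (Var ''x'') (Var ''g'')))))))"

definition init_vertex :: prog where
  "init_vertex =
     Wrt ''l'' (Const 1) (Var ''x'') (Const 0) ;;
     Ite in_first (Wrt ''l'' (Const 0) (Var ''x'') (Const 1)) (Wrt ''l'' (Const 0) (Var ''x'') (Const 0))"

definition half_test :: prog where
  "half_test =
     Ite (Conj (Neg (Eq (lab 0 ''x'') (Const 0))) (Eq (lab 1 ''x'') (Const 0)))
       (Asg ''v'' (Var ''x'')) Nop"

text \<open>\<open>v = n\<close> means that no vertex is half labelled.\<close>

definition half_labelled :: prog where
  "half_labelled = Asg ''v'' (Var ''n'') ;; For ''x'' ''n'' half_test"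

definition hits :: bexp where
  "hits = Conj (adjb ''v'' ''x'') (Conj (Neg (Eq (lab 0 ''x'') (Var ''k''))) (Neg (Eq (lab 1 ''x'') (Var ''k''))))"

definition spread :: prog where
  "spread =
     Ite hits
       (Ite (Eq (lab 0 ''x'') (Const 0)) (Wrt ''l'' (Const 0) (Var ''x'') (Var ''c''))
         (Wrt ''l'' (Const 1) (Var ''x'') (Var ''c'')))
       Nop"

definition label_clique :: prog where
  "label_clique =
     Asg ''c'' (Plus (Var ''c'') (Const 1)) ;; Asg ''k'' (lab 0 ''v'') ;;
     For ''x'' ''n'' spread ;; Wrt ''l'' (Const 1) (Var ''v'') (Var ''c'')"

definition label_step :: prog where
  "label_step = half_labelled ;; Ite (Less (Var ''v'') (Var ''n'')) label_clique Nop"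

definition shares :: bexp where
  "shares =
     Neg (Conj (Conj (Neg (Eq (lab 0 ''x'') (lab 0 ''y''))) (Neg (Eq (lab 0 ''x'') (lab 1 ''y''))))
       (Conj (Neg (Eq (lab 1 ''x'') (lab 0 ''y''))) (Neg (Eq (lab 1 ''x'') (lab 1 ''y'')))))"

definition pair_test :: prog where
  "pair_test =
     Ite (Eq (Var ''x'') (Var ''y'')) Nop
       (Ite (Conj (Neg (Eq (lab 0 ''y'') (Const 0))) shares)
         (Ite (adjb ''x'' ''y'') Nop (Asg ''ok'' (Const 0)))
         (Ite (adjb ''x'' ''y'') (Asg ''ok'' (Const 0)) Nop))"

definition vertex_test :: prog where
  "vertex_test =
     Ite (Eq (lab 0 ''x'') (Const 0)) Nop
       (Ite (Conj (Conj (Neg (Eq (lab 1 ''x'') (Const 0))) (Neg (Eq (lab 0 ''x'') (lab 1 ''x''))))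
           (Conj (Less (lab 0 ''x'') (Var ''m'')) (Less (lab 1 ''x'') (Var ''m''))))
         Nop (Asg ''ok'' (Const 0)) ;;
        For ''y'' ''n'' pair_test)"

definition check_labels :: prog where
  "check_labels =
     Ite (Eq (lab 0 ''a'') (Const 0)) (Asg ''ok'' (Const 0)) (Asg ''ok'' (Const 1)) ;;
     For ''x'' ''n'' vertex_test"

definition guess :: prog where
  "guess =
     For ''x'' ''n'' init_vertex ;; Asg ''c'' (Const 1) ;;
     For ''i'' ''n'' label_step ;;
     check_labels"

definition guess_unless :: prog where
  "guess_unless = Ite (Eq (Var ''ok'') (Const 0)) guess Nop"

definition find_root :: prog where
  "find_root = find_neighbour ;; Asg ''ok'' (Const 0) ;; For ''g'' ''n'' guess_unless"

lemma writes_init_vertex [simp]: "wvars init_vertex = {}" "warrs init_vertex = {''l''}"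
  by (auto simp: init_vertex_def)

lemma writes_find_neighbour [simp]: "wvars find_neighbour = {''u'', ''x''}" "warrs find_neighbour = {}"
  by (auto simp: find_neighbour_def)

lemma writes_half_test [simp]: "wvars half_test = {''v''}" "warrs half_test = {}"
  by (auto simp: half_test_def)

lemma writes_half_labelled [simp]: "wvars half_labelled = {''v'', ''x''}" "warrs half_labelled = {}"
  by (auto simp: half_labelled_def)

lemma writes_spread [simp]: "wvars spread = {}" "warrs spread = {''l''}"
  by (auto simp: spread_def)

lemma writes_label_clique [simp]:
  "wvars label_clique = {''c'', ''k'', ''x''}" "warrs label_clique = {''l''}"
  by (auto simp: label_clique_def)

lemma writes_label_step [simp]:
  "wvars label_step = {''v'', ''x'', ''c'', ''k''}" "warrs label_step = {''l''}"
  by (auto simp: label_step_def)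

lemma writes_pair_test [simp]: "wvars pair_test = {''ok''}" "warrs pair_test = {}"
  by (auto simp: pair_test_def)

lemma writes_vertex_test [simp]: "wvars vertex_test = {''ok'', ''y''}" "warrs vertex_test = {}"
  by (auto simp: vertex_test_def)

lemma writes_check_labels [simp]: "wvars check_labels = {''ok'', ''y'', ''x''}" "warrs check_labels = {}"
  by (auto simp: check_labels_def)

lemma writes_guess [simp]:
  "wvars guess = {''x'', ''c'', ''i'', ''v'', ''k'', ''ok'', ''y''}" "warrs guess = {''l''}"
  by (auto simp: guess_def)

lemma writes_guess_unless [simp]:
  "wvars guess_unless = {''x'', ''c'', ''i'', ''v'', ''k'', ''ok'', ''y''}" "warrs guess_unless = {''l''}"
  by (auto simp: guess_unless_def)

lemma writes_find_root [simp]: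
  "wvars find_root = {''u'', ''g'', ''x'', ''c'', ''i'', ''v'', ''k'', ''ok'', ''y''}" "warrs find_root = {''l''}"
  by (auto simp: find_root_def)

text \<open>Nothing is assumed about the labelling, so the labels from a wrong guess are judged
  correctly as well.\<close>

lemma sem_check_labels:
  assumes n: "var S ''n'' = n" and m: "var S ''m'' = m"
    and adj: "\<And>i j. arr S ''adj'' i j = 1 \<longleftrightarrow> adj i j"
  defines "S' \<equiv> sem check_labels S"
  shows "var S' ''ok'' =
    (if arr S ''l'' 0 (var S ''a'') \<noteq> 0 \<and> root_labelling n m adj (arr S ''l'') then 1 else 0)"
proof -
  define l where "l = arr S ''l''"
  define a where "a = var S ''a''"
  define pok where "pok u v \<longleftrightarrow> u = v \<or> (adj u v \<longleftrightarrow> l 0 v \<noteq> 0 \<and> share l u v)" for u v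
  define vok where "vok u \<longleftrightarrow> l 1 u \<noteq> 0 \<and> l 0 u \<noteq> l 1 u \<and> l 0 u < m \<and> l 1 u < m" for u
  define Q where "Q u \<longleftrightarrow> (l 0 u \<noteq> 0 \<longrightarrow> vok u \<and> (\<forall>v < n. pok u v))" for u
  have root: "root_labelling n m adj l \<longleftrightarrow> (\<forall>u < n. Q u)"
    by (simp add: root_labelling_def Q_def pok_def vok_def)
  define S1 where "S1 = sem (Ite (Eq (lab 0 ''a'') (Const 0)) (Asg ''ok'' (Const 0)) (Asg ''ok'' (Const 1))) S"
  have arr1: "arr S1 = arr S" unfolding S1_def by (rule arr_sem_id) simp
  have v1: "var S1 ''n'' = n" "var S1 ''m'' = m" "var S1 ''ok'' = (if l 0 a \<noteq> 0 then 1 else 0)"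
    using n m by (simp_all add: S1_def l_def a_def)
  have pair: "var (sem (For ''y'' ''n'' pair_test) r) ''ok'' = (if \<forall>v < n. pok (var r ''x'') v then var r ''ok'' else 0)"
    if r: "arr r = arr S" "var r ''n'' = n" for r
  proof -
    define J where "J k q \<longleftrightarrow> var q ''ok'' = (if \<forall>v < k. pok (var r ''x'') v then var r ''ok'' else 0)"
      for k and q :: state
    have "J (var r ''n'') (sem (For ''y'' ''n'' pair_test) r)"
    proof (rule For_inv[where I = J], goal_cases)
      case (5 k q)
      have q: "var q ''x'' = var r ''x''" by (subst agree_var[OF 5(3)]) simp_all
      have "arr q = arr S"
        unfolding r(1)[symmetric] by (rule ext, subst agree_arr[OF 5(3)]) simp_all
      then have "sem pair_test q = (if pok (var r ''x'') k then q else set_var ''ok'' 0 q)"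
        using q 5(2) adj by (simp add: pair_test_def pok_def l_def shares_def share_def)
      then show ?case using 5(4) by (auto simp: J_def less_Suc_eq)
    qed (simp_all add: J_def)
    then show ?thesis by (simp add: J_def r)
  qed
  define I where "I k q \<longleftrightarrow> var q ''ok'' =
      (if l 0 a \<noteq> 0 \<and> (\<forall>u < k. Q u) then 1 else 0)"
    for k and q :: state
  have "I (var S1 ''n'') (sem (For ''x'' ''n'' vertex_test) S1)"
  proof (rule For_inv[where I = I], goal_cases)
    case (5 k q)
    have qa: "arr q = arr S"
      unfolding arr1[symmetric] by (rule ext, subst agree_arr[OF 5(3)]) simp_all
    have qv: "var q ''n'' = n" "var q ''m'' = m"
      using v1 by (simp_all add: agree_var[OF 5(3)])
    define b where "b = Conj (Conj (Neg (Eq (lab 1 ''x'') (Const 0))) (Neg (Eq (lab 0 ''x'') (lab 1 ''x''))))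
           (Conj (Less (lab 0 ''x'') (Var ''m'')) (Less (lab 1 ''x'') (Var ''m'')))"
    have b: "bval b q \<longleftrightarrow> vok k" using 5(2) qa qv by (simp add: b_def vok_def l_def)
    let ?q = "if vok k then q else set_var ''ok'' 0 q"
    have sem: "sem vertex_test q = (if l 0 k = 0 then q else sem (For ''y'' ''n'' pair_test) ?q)"
    proof -
      have "bval (Eq (lab 0 ''x'') (Const 0)) q \<longleftrightarrow> l 0 k = 0" using 5(2) qa by (simp add: l_def)
      then show ?thesis
        by (simp only: vertex_test_def sem.simps(1,2,4,5) b_def[symmetric] b aval.simps)
    qed
    have q': "arr ?q = arr S" "var ?q ''n'' = n" "var ?q ''x'' = k" using qa qv 5(2) by simp_all
    have "var (sem (For ''y'' ''n'' pair_test) ?q) ''ok'' = (if \<forall>v < n. pok k v then var ?q ''ok'' else 0)"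
      using pair[OF q'(1,2)] unfolding q'(3) .
    then have "var (sem vertex_test q) ''ok'' = (if Q k then var q ''ok'' else 0)"
      unfolding sem Q_def by (cases "l 0 k = 0"; cases "vok k"; cases "\<forall>v < n. pok k v") auto
    then show ?case using 5(4) by (auto simp: I_def less_Suc_eq)
  qed (use v1 in \<open>simp_all add: I_def\<close>)
  moreover have "S' = sem (For ''x'' ''n'' vertex_test) S1"
    by (simp only: S'_def check_labels_def S1_def sem.simps(4))
  ultimately show ?thesis
    by (simp add: I_def v1 root l_def[symmetric] a_def[symmetric])
qed

section \<open>Correctness of the root search\<close>

locale root_search = root n adj f for n :: nat and adj :: "nat \<Rightarrow> nat \<Rightarrow> bool" and f :: "nat \<Rightarrow> nat set" +
  fixes a :: nat
  assumes a: "a < n"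
begin

definition input :: "state \<Rightarrow> bool" where
  "input S \<longleftrightarrow> var S ''n'' = n \<and> var S ''m'' = Suc (Suc n) \<and> var S ''a'' = a \<and>
     (\<forall>i j. arr S ''adj'' i j = 1 \<longleftrightarrow> adj i j)"

lemma input_agree: "input S \<Longrightarrow> agree c S R \<Longrightarrow> {''n'', ''m'', ''a''} \<inter> wvars c = {} \<Longrightarrow>
  ''adj'' \<notin> warrs c \<Longrightarrow> input R"
  by (simp add: input_def agree_def)

lemma input_sem: "input S \<Longrightarrow> {''n'', ''m'', ''a''} \<inter> wvars c = {} \<Longrightarrow> ''adj'' \<notin> warrs c \<Longrightarrow> input (sem c S)"
  by (rule input_agree[OF _ agree_sem])

abbreviation labels :: "state \<Rightarrow> nat \<Rightarrow> nat \<Rightarrow> nat" where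
  "labels S \<equiv> arr S ''l''"

lemma find_neighbour:
  assumes inp: "input S"
  defines "u \<equiv> var (sem find_neighbour S) ''u''"
  shows "u = a \<and> (\<forall>v < n. \<not> adj a v) \<or> u < n \<and> adj a u"
proof -
  define I where "I k R \<longleftrightarrow> var R ''u'' = a \<and> (\<forall>v < k. \<not> adj a v) \<or> var R ''u'' < n \<and> adj a (var R ''u'')"
    for k and R :: state
  let ?S = "set_var ''u'' a S"
  have inp': "input ?S" using inp by (simp add: input_def)
  have "I (var ?S ''n'') (sem (For ''x'' ''n'' (Ite (adjb ''a'' ''x'') (Asg ''u'' (Var ''x'')) Nop)) ?S)"
  proof (rule For_inv[where I = I], goal_cases)
    case (5 k r)
    have "input r" by (rule input_agree[OF inp' 5(3)]) simp_all
    then have "sem (Ite (adjb ''a'' ''x'') (Asg ''u'' (Var ''x'')) Nop) r = (if adj a k then set_var ''u'' k r else r)"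
      using 5(2) by (simp add: input_def)
    moreover have "k < n" using 5(1) inp' by (simp add: input_def)
    ultimately show ?case using 5(4) by (auto simp: I_def less_Suc_eq)
  qed (simp_all add: I_def)
  moreover have "sem find_neighbour S =
      sem (For ''x'' ''n'' (Ite (adjb ''a'' ''x'') (Asg ''u'' (Var ''x'')) Nop)) ?S"
    using inp by (simp only: find_neighbour_def sem.simps(2,4) aval.simps input_def)
  ultimately show ?thesis using inp' by (simp add: I_def u_def input_def)
qed

lemma label_init:
  assumes inp: "input S"
  defines "l' \<equiv> labels (sem (For ''x'' ''n'' init_vertex) S)"
  assumes x: "x < n"
  shows "l' 1 x = 0 \<and>
    l' 0 x = (if x = a \<or> adj a x \<and> (x = var S ''u'' \<or> adj (var S ''u'') x) \<and> x \<noteq> var S ''g'' then 1 else 0)"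
proof -
  define P where "P x \<longleftrightarrow> x = a \<or> adj a x \<and> (x = var S ''u'' \<or> adj (var S ''u'') x) \<and> x \<noteq> var S ''g''" for x
  define I where "I k R \<longleftrightarrow> (\<forall>x < k. labels R 1 x = 0 \<and> labels R 0 x = (if P x then 1 else 0))"
    for k and R :: state
  have "I (var S ''n'') (sem (For ''x'' ''n'' init_vertex) S)"
  proof (rule For_inv[where I = I], goal_cases)
    case (5 k r)
    have inp': "input r" by (rule input_agree[OF inp 5(3)]) simp_all
    have "var r ''u'' = var S ''u''" "var r ''g'' = var S ''g''"
      by (simp_all add: agree_var[OF 5(3)])
    then have "bval in_first (sem (Wrt ''l'' (Const 1) (Var ''x'') (Const 0)) r) \<longleftrightarrow> P k"
      using inp' 5(2) by (auto simp: in_first_def input_def P_def)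
    then have "labels (sem init_vertex r) 1 = (labels r 1)(k := 0)"
      "labels (sem init_vertex r) 0 = (labels r 0)(k := if P k then 1 else 0)"
      using 5(2) by (simp_all add: init_vertex_def)
    then show ?case using 5(4) unfolding I_def arr_set_var by (simp add: less_Suc_eq)
  qed (simp_all add: I_def)
  then show ?thesis using inp x by (simp add: I_def l'_def input_def P_def)
qed

lemma half_labelled:
  assumes inp: "input S"
  defines "v \<equiv> var (sem half_labelled S) ''v''"
  shows "v = n \<and> (\<forall>x < n. labels S 0 x \<noteq> 0 \<longrightarrow> labels S 1 x \<noteq> 0) \<or>
    v < n \<and> labels S 0 v \<noteq> 0 \<and> labels S 1 v = 0"
proof -
  define I where "I k R \<longleftrightarrow>
      var R ''v'' = n \<and> (\<forall>x < k. labels S 0 x \<noteq> 0 \<longrightarrow> labels S 1 x \<noteq> 0) \<or>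
      var R ''v'' < n \<and> labels S 0 (var R ''v'') \<noteq> 0 \<and> labels S 1 (var R ''v'') = 0"
    for k and R :: state
  let ?S = "set_var ''v'' n S"
  have n: "var S ''n'' = n" using inp by (simp add: input_def)
  have "I (var ?S ''n'') (sem (For ''x'' ''n'' half_test) ?S)"
  proof (rule For_inv[where I = I], goal_cases)
    case (5 k r)
    have "labels r = labels S" by (simp add: agree_arr[OF 5(3)])
    then have "sem half_test r = (if labels S 0 k \<noteq> 0 \<and> labels S 1 k = 0 then set_var ''v'' k r else r)"
      using 5(2) by (simp add: half_test_def)
    then show ?case using 5(1,4) n by (auto simp: I_def less_Suc_eq)
  qed (simp_all add: I_def)
  moreover have "sem half_labelled S = sem (For ''x'' ''n'' half_test) ?S"
    by (simp only: half_labelled_def sem.simps(2,4) aval.simps n)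
  ultimately show ?thesis using n by (simp add: I_def v_def)
qed

lemma spread:
  assumes inp: "input S"
  defines "l \<equiv> labels S" and "v \<equiv> var S ''v''" and "c \<equiv> var S ''c''" and "k \<equiv> var S ''k''"
  defines "l' \<equiv> labels (sem (For ''x'' ''n'' spread) S)"
  defines "hit \<equiv> \<lambda>x. adj v x \<and> l 0 x \<noteq> k \<and> l 1 x \<noteq> k"
  assumes x: "x < n"
  shows "l' 0 x = (if hit x \<and> l 0 x = 0 then c else l 0 x) \<and> l' 1 x = (if hit x \<and> l 0 x \<noteq> 0 then c else l 1 x)"
proof -
  define I where "I j R \<longleftrightarrow> (\<forall>x. labels R 0 x = (if x < j \<and> hit x \<and> l 0 x = 0 then c else l 0 x) \<and>
      labels R 1 x = (if x < j \<and> hit x \<and> l 0 x \<noteq> 0 then c else l 1 x))" for j and R :: state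
  have "I (var S ''n'') (sem (For ''x'' ''n'' spread) S)"
  proof (rule For_inv[where I = I], goal_cases)
    case (5 j r)
    have inp': "input r" by (rule input_agree[OF inp 5(3)]) simp_all
    have r: "var r ''v'' = v" "var r ''c'' = c" "var r ''k'' = k"
      by (simp_all add: agree_var[OF 5(3)] v_def c_def k_def)
    have lj: "labels r 0 j = l 0 j" "labels r 1 j = l 1 j" using 5(4) by (auto simp: I_def)
    then have hit: "bval hits r \<longleftrightarrow> hit j"
      using inp' r 5(2) by (simp add: hits_def hit_def input_def)
    have "sem spread r = (if hit j then if l 0 j = 0 then set_arr ''l'' 0 j c r else set_arr ''l'' 1 j c r else r)"
      using 5(2) r lj hit by (simp add: spread_def)
    then have "labels (sem spread r) 0 = (labels r 0)(j := if hit j \<and> l 0 j = 0 then c else l 0 j)"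
      "labels (sem spread r) 1 = (labels r 1)(j := if hit j \<and> l 0 j \<noteq> 0 then c else l 1 j)"
      using lj by auto
    then show ?case using 5(4) unfolding I_def arr_set_var by (auto simp: less_Suc_eq)
  qed (simp_all add: I_def l_def)
  moreover have "var S ''n'' = n" using inp by (simp add: input_def)
  ultimately show ?thesis using x by (simp add: I_def l'_def)
qed

definition finished :: "state \<Rightarrow> nat set" where
  "finished S = {v. v < n \<and> labels S 1 v \<noteq> 0}"

text \<open>Each label after the first finishes at least one vertex, so at most \<open>n + 1\<close>
  labels arise, all below \<open>m = n + 2\<close>.\<close>

definition labelling :: "state \<Rightarrow> bool" where
  "labelling S \<longleftrightarrow> (\<exists>\<phi>. partial_labelling \<phi> (var S ''c'') (labels S)) \<and> var S ''c'' \<le> Suc (card (finished S))"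

definition unfinished :: "state \<Rightarrow> bool" where
  "unfinished S \<longleftrightarrow> (\<exists>v < n. labels S 0 v \<noteq> 0 \<and> labels S 1 v = 0)"

lemma label_step:
  assumes inp: "input S" and lab: "labelling S"
  defines "S' \<equiv> sem label_step S"
  shows "labelling S' \<and> (if unfinished S then card (finished S) < card (finished S') else \<not> unfinished S')"
proof -
  define R where "R = sem half_labelled S"
  have arr: "arr R = arr S" unfolding R_def by (rule arr_sem_id) simp
  have inpR: "input R" unfolding R_def by (rule input_sem[OF inp]) simp_all
  then have n: "var R ''n'' = n" by (simp add: input_def)
  have c: "var R ''c'' = var S ''c''" by (simp add: R_def)
  let ?v = "var R ''v''" and ?l = "labels S" and ?l' = "labels S'" and ?c = "var S ''c''"
  note half = half_labelled[OF inp, folded R_def]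
  have sem: "S' = (if ?v < n then sem label_clique R else R)"
    by (simp add: S'_def label_step_def R_def[symmetric] n)
  show ?thesis
  proof (cases "?v < n")
    case False
    then have "S' = R" using sem by simp
    moreover have "\<not> unfinished S" using half False by (auto simp: unfinished_def)
    ultimately show ?thesis using lab c by (simp add: labelling_def unfinished_def finished_def arr)
  next
    case True
    then have v: "?v < n" "?l 0 ?v \<noteq> 0" "?l 1 ?v = 0" using half by auto
    define T where "T = set_var ''k'' (?l 0 ?v) (set_var ''c'' (Suc ?c) R)"
    have "S' = sem label_clique R" using sem True by simp
    then have S': "S' = set_arr ''l'' 1 ?v (Suc ?c) (sem (For ''x'' ''n'' spread) T)"
      by (simp add: label_clique_def T_def arr c)
    have inpT: "input T" using inpR by (simp add: input_def T_def)
    define hit where "hit x \<longleftrightarrow> adj ?v x \<and> ?l 0 x \<noteq> ?l 0 ?v \<and> ?l 1 x \<noteq> ?l 0 ?v" for x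
    have l': "?l' 0 x = (if hit x \<and> ?l 0 x = 0 then Suc ?c else ?l 0 x)"
      "?l' 1 x = (if x = ?v \<or> hit x \<and> ?l 0 x \<noteq> 0 then Suc ?c else ?l 1 x)" if "x < n" for x
      using spread[OF inpT that] unfolding S' hit_def by (simp_all add: T_def arr)
    obtain \<phi> where part: "partial_labelling \<phi> ?c ?l" and card: "?c \<le> Suc (card (finished S))"
      using lab by (auto simp: labelling_def)
    have "\<exists>\<phi>. partial_labelling \<phi> (Suc ?c) ?l'"
      by (rule partial_labelling_step[OF part v]) (use l' in \<open>simp_all only: hit_def\<close>)
    moreover have "var S' ''c'' = Suc ?c" by (simp add: S' T_def)
    moreover have "finished S \<subseteq> finished S'"
      using l'(2) by (auto simp: finished_def)
    moreover have "?v \<in> finished S'" "?v \<notin> finished S"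
      using l'(2)[OF v(1)] v by (auto simp: finished_def)
    moreover have "finite (finished S')" by (simp add: finished_def)
    ultimately have "card (finished S) < card (finished S')"
      by (intro psubset_card_mono) auto
    moreover have "unfinished S" using v by (auto simp: unfinished_def)
    ultimately show ?thesis
      using \<open>\<exists>\<phi>. partial_labelling \<phi> (Suc ?c) ?l'\<close> \<open>var S' ''c'' = Suc ?c\<close> card
      by (simp add: labelling_def)
  qed
qed

definition correct :: "state \<Rightarrow> bool" where
  "correct S \<longleftrightarrow> labels S 0 a \<noteq> 0 \<and> root_labelling n (Suc (Suc n)) adj (labels S)"

text \<open>The first claim holds for every guess, so only a correct labelling is accepted. The
  second ensures success if the guessed first clique consists of the edges at some
  \<open>p\<close>.\<close>

lemma guess:
  assumes inp: "input S"
  defines "S' \<equiv> sem guess S"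
  shows "var S' ''ok'' = (if correct S' then 1 else 0)"
    and "\<lbrakk>\<And>v. v < n \<Longrightarrow> (v = a \<or> adj a v \<and> (v = var S ''u'' \<or> adj (var S ''u'') v) \<and> v \<noteq> var S ''g'') \<longleftrightarrow> p \<in> f v\<rbrakk>
      \<Longrightarrow> correct S'"
proof -
  define S1 where "S1 = sem (For ''x'' ''n'' init_vertex ;; Asg ''c'' (Const 1)) S"
  define S2 where "S2 = sem (For ''i'' ''n'' label_step) S1"
  have S': "S' = sem check_labels S2"
    by (simp only: S'_def guess_def S2_def S1_def sem.simps(4))
  have inp1: "input S1" unfolding S1_def by (rule input_sem[OF inp]) simp_all
  have inp2: "input S2" unfolding S2_def by (rule input_sem[OF inp1]) simp_all
  have l': "labels S' = labels S2" by (simp add: S')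
  show "var S' ''ok'' = (if correct S' then 1 else 0)"
    using sem_check_labels[of S2 n "Suc (Suc n)" adj] inp2
    unfolding correct_def l' by (simp add: S' input_def)
  assume p: "\<And>v. v < n \<Longrightarrow> (v = a \<or> adj a v \<and> (v = var S ''u'' \<or> adj (var S ''u'') v) \<and> v \<noteq> var S ''g'') \<longleftrightarrow> p \<in> f v"
  have l1: "labels S1 1 v = 0" "labels S1 0 v = (if p \<in> f v then 1 else 0)" if "v < n" for v
    using label_init[OF inp that] p[OF that] by (simp_all add: S1_def)
  have c1: "var S1 ''c'' = 1" by (simp add: S1_def)
  \<comment> \<open>Label 1 is the only one in use, so a constant map is injective on the
    labels.\<close>
  have "partial_labelling (\<lambda>_. p) 1 (labels S1)"
    unfolding partial_labelling_def by (simp add: l1[unfolded One_nat_def])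
  then have lab1: "labelling S1" unfolding labelling_def c1 by auto
  have set_i: "labelling (set_var ''i'' k r) = labelling r" "unfinished (set_var ''i'' k r) = unfinished r"
    "finished (set_var ''i'' k r) = finished r" for k r
    by (simp_all add: labelling_def unfinished_def finished_def)
  have "labelling S2 \<and> \<not> unfinished S2"
    unfolding S2_def
  proof (rule For_until[where \<mu> = "\<lambda>r. card (finished r)"], unfold set_i, goal_cases)
    case (5 k r)
    have "input r" by (rule input_agree[OF inp1 5(1)]) simp_all
    from label_step[OF this 5(2)] 5(3) show ?case by simp
  next
    case (6 k r)
    have "input r" by (rule input_agree[OF inp1 6(1)]) simp_all
    from label_step[OF this 6(2)] 6(3) show ?case by simp
  next
    case (7 r)
    then obtain v where v: "v < n" "labels r 1 v = 0" unfolding unfinished_def by blast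
    then have "finished r \<subseteq> {..<n} - {v}" by (auto simp: finished_def)
    then have "card (finished r) \<le> card ({..<n} - {v})" by (intro card_mono) auto
    moreover have "var S1 ''n'' = n" using inp1 by (simp add: input_def)
    ultimately show ?case using v by simp
  qed (use lab1 in simp_all)
  then obtain \<phi> where part: "partial_labelling \<phi> (var S2 ''c'') (labels S2)"
    and c: "var S2 ''c'' \<le> Suc (card (finished S2))" and full: "\<not> unfinished S2"
    by (auto simp: labelling_def)
  have "finished S2 \<subseteq> {..<n}" by (auto simp: finished_def)
  then have "card (finished S2) \<le> card {..<n}" by (intro card_mono) auto
  then have "var S2 ''c'' < Suc (Suc n)" using c by simp
  then have "root_labelling n (Suc (Suc n)) adj (labels S2)"
    using full by (intro partial_labelling_complete[OF part]) (auto simp: unfinished_def)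
  moreover have "labels S2 0 a \<noteq> 0"
  proof -
    \<comment> \<open>Spreading never overwrites a nonzero \<open>l 0\<close>, so the first label of
      \<open>a\<close> survives.\<close>
    define I where "I k r \<longleftrightarrow> labels r 0 a \<noteq> 0" for k :: nat and r :: state
    have "I (var S1 ''n'') S2"
      unfolding S2_def
    proof (rule For_inv[where I = I], goal_cases)
      case 4
      then show ?case using l1[OF a] p[OF a] by (simp add: I_def)
    next
      case (5 k r)
      have inp': "input (sem half_labelled r)"
        by (intro input_sem input_agree[OF inp1 5(3)]) simp_all
      define R where "R = sem half_labelled r"
      have arr: "arr R = arr r" unfolding R_def by (rule arr_sem_id) simp
      define T where "T = set_var ''k'' (labels r 0 (var R ''v'')) (set_var ''c'' (Suc (var R ''c'')) R)"
      have "input T" using inp' by (simp add: input_def T_def R_def)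
      from spread[OF this a] have "labels (sem (For ''x'' ''n'' spread) T) 0 a = labels r 0 a"
        using 5(4) by (simp add: I_def T_def arr)
      then show ?case
        using 5(4) by (simp add: I_def label_step_def label_clique_def R_def[symmetric] arr T_def)
    qed simp_all
    then show ?thesis by (simp add: I_def)
  qed
  ultimately show "correct S'" by (simp add: correct_def l')
qed

text \<open>Some \<open>g < n\<close> yields the true clique at an end of \<open>a\<close>, so a
  guess is accepted at this \<open>g\<close> at the latest.\<close>

lemma find_root:
  assumes inp: "input S"
  shows "correct (sem find_root S)"
proof -
  define R where "R = sem find_neighbour S"
  define T where "T = set_var ''ok'' 0 R"
  define u where "u = var R ''u''"
  have sem: "sem find_root S = sem (For ''g'' ''n'' guess_unless) T"
    by (simp only: find_root_def T_def R_def sem.simps(2,4) aval.simps)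
  have "input R" unfolding R_def by (rule input_sem[OF inp]) simp_all
  then have inpT: "input T" by (simp add: input_def T_def)
  obtain g p where g: "g < n"
    and p: "\<And>v. v < n \<Longrightarrow> (v = a \<or> adj a v \<and> (v = u \<or> adj u v) \<and> v \<noteq> g) \<longleftrightarrow> p \<in> f v"
    using first_clique[OF a find_neighbour[OF inp]] unfolding u_def R_def by blast
  define I where "I k r \<longleftrightarrow> var r ''ok'' = 0 \<and> k \<le> g \<or> var r ''ok'' = 1 \<and> correct r"
    for k and r :: state
  have "I (var T ''n'') (sem (For ''g'' ''n'' guess_unless) T)"
  proof (rule For_inv[where I = I], goal_cases)
    case (5 k r)
    have inp': "input r" by (rule input_agree[OF inpT 5(3)]) simp_all
    have ru: "var r ''u'' = u"
      by (subst agree_var[OF 5(3)]) (simp_all add: T_def u_def)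
    have set_g: "I j (set_var ''g'' i r') = I j r'" for i j r' by (simp add: I_def correct_def)
    show ?case
    proof (cases "var r ''ok'' = 0")
      case True
      then have "sem guess_unless r = sem guess r" by (simp add: guess_unless_def)
      moreover have "correct (sem guess r)" if "k = g"
        by (rule guess(2)[OF inp', where p = p]) (use p ru 5(2) that in simp)
      ultimately show ?thesis
        using guess(1)[OF inp'] 5(4) True unfolding set_g by (cases "k = g") (auto simp: I_def)
    next
      case False
      then have "sem guess_unless r = r" by (simp add: guess_unless_def)
      then show ?thesis using 5(4) False unfolding set_g by (auto simp: I_def)
    qed
  qed (simp_all add: I_def T_def)
  then show ?thesis unfolding sem using g inpT by (auto simp: I_def input_def)
qed

end

section \<open>The algorithm\<close>

definition try_ends :: "nat \<Rightarrow> nat \<Rightarrow> prog" where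
  "try_ends i j =
     Ite (Eq (Var ''len'') (Const 0))
       (Asg ''s'' (lab i ''a'') ;; Asg ''sx'' (lab (1 - i) ''a'') ;;
        Asg ''t'' (lab j ''b'') ;; Asg ''tx'' (lab (1 - j) ''b'') ;; core)
       Nop"

definition try_all :: prog where
  "try_all = try_ends 0 0 ;; try_ends 0 1 ;; try_ends 1 0 ;; try_ends 1 1"

text \<open>If \<open>b\<close> is unlabelled, no path from \<open>a\<close> reaches it, and
  \<open>len\<close> stays 0.\<close>

definition search_path :: prog where
  "search_path = find_root ;; Ite (Eq (lab 0 ''b'') (Const 0)) Nop try_all"

text \<open>Adjacent \<open>a\<close> and \<open>b\<close> form an odd path of length 1. They are
  treated separately since they share an end in the root, so that the terminals \<open>s\<close> and
  \<open>t\<close> could coincide.\<close>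

definition main_prog :: prog where
  "main_prog =
     Ite (adjb ''a'' ''b'')
       (Wrt ''out'' (Const 0) (Const 0) (Var ''a'') ;; Wrt ''out'' (Const 0) (Const 1) (Var ''b'') ;;
        Asg ''len'' (Plus (Const 1) (Const 1)))
       search_path"

lemma writes_try_ends [simp]:
  "wvars (try_ends i j) = {''s'', ''sx'', ''t'', ''tx'', ''q'', ''e'', ''f'', ''u'', ''w'', ''i'', ''g'',
     ''x'', ''y'', ''fd'', ''d'', ''c'', ''r'', ''k'', ''len''}"
  "warrs (try_ends i j) = {''al'', ''dn'', ''vi'', ''P'', ''E'', ''dp'', ''pa'', ''B'', ''rk'', ''out''}"
  by (auto simp: try_ends_def)

lemmas prog_defs = main_prog_def search_path_def try_all_def try_ends_def find_root_def guess_unless_def guess_def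
  check_labels_def vertex_test_def pair_test_def shares_def label_step_def label_clique_def spread_def
  hits_def half_labelled_def half_test_def init_vertex_def in_first_def find_neighbour_def
  core_def core_init_def core_roots_def alive_test_def alive_def check_edge_def order_ends_def out_path_def
  out_finish_def out_start_def up_step_def down_step_def grow_def pick_def pick_test_def insert_ear_def
  insert_step_def shift_def search_def search_step_def cross_edge_def cross_test_def set_link_def

lemma wf_main: "wf main_prog"
  by (simp add: prog_defs)

lemma limits_main: "limits main_prog = {''n'', ''m''}"
  by (auto simp: prog_defs)

lemma wvars_main: "''n'' \<notin> wvars main_prog" "''m'' \<notin> wvars main_prog"
  by (simp_all add: main_prog_def search_path_def try_all_def)

lemma depth_main: "depth main_prog = 3"
  by (simp add: prog_defs)

lemma joins_index:
  assumes "joins l e x y"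
  shows "\<exists>i \<le> 1. l i e = y \<and> l (1 - i) e = x"
proof (cases "l 0 e = y \<and> l 1 e = x")
  case True
  then show ?thesis by (intro exI[of _ 0]) simp
next
  case False
  then show ?thesis using assms by (intro exI[of _ 1]) (auto simp: joins_def)
qed

section \<open>Odd paths of the graph and even paths of its root\<close>

context labelled_graph
begin

definition alive_edges :: "nat \<Rightarrow> nat \<Rightarrow> nat \<Rightarrow> nat \<Rightarrow> nat set" where
  "alive_edges a b i j = {e. e < n \<and> l 0 e \<noteq> 0 \<and> l 0 e \<noteq> l (1 - i) a \<and> l 0 e \<noteq> l (1 - j) b \<and>
     l 1 e \<noteq> l (1 - i) a \<and> l 1 e \<noteq> l (1 - j) b}"

definition even_rpath :: "nat \<Rightarrow> nat \<Rightarrow> nat \<Rightarrow> nat \<Rightarrow> nat list \<Rightarrow> nat list \<Rightarrow> bool" where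
  "even_rpath a b i j xs es \<longleftrightarrow> rpath l (alive_edges a b i j) xs es \<and> distinct xs \<and> hd xs = l i a \<and>
     last xs = l j b \<and> even (length es)"

text \<open>Dropping \<open>a\<close> and \<open>b\<close> from the path, and the two outermost
  labels from its root path, leaves an even number of edges. As the labels are distinct, these edges
  avoid the other ends of \<open>a\<close> and \<open>b\<close>; \<open>i\<close> and
  \<open>j\<close> record the ends that remain.\<close>

lemma odd_path_imp_even_rpath:
  assumes path: "path_joining G a b p" and odd: "odd (path_length p)"
    and a: "a \<in> D" and ab: "{a, b} \<notin> edges G" "a \<noteq> b"
  shows "\<exists>i \<le> 1. \<exists>j \<le> 1. \<exists>xs es. even_rpath a b i j xs es"
proof -
  have isp: "is_path G p" and ends: "hd p = a" "last p = b" using path by (auto simp: path_joining_def)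
  have p: "p \<noteq> []" "distinct p"
    "\<And>i j. i < j \<Longrightarrow> j < length p \<Longrightarrow> {p ! i, p ! j} \<in> edges G \<longleftrightarrow> j = Suc i"
    using isp unfolding is_path_iff[OF simple] by auto
  have even: "even (length p)" using odd p(1) by (cases p) (auto simp: path_length_def)
  have "length p \<noteq> 2"
  proof
    assume 2: "length p = 2"
    then have "p ! 0 = a" "p ! 1 = b" using ends p(1) by (auto simp: hd_conv_nth last_conv_nth)
    then show False using p(3)[of 0 1] 2 ab by simp
  qed
  moreover have "length p \<noteq> 0" "length p \<noteq> 1" using p(1) even by auto
  ultimately have len: "3 \<le> length p" by linarith
  obtain zs where zs: "rpath l D zs p" "distinct zs"
    using path_imp_rpath[OF isp _ len] a ends by blast
  define es where "es = butlast (tl p)"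
  define xs where "xs = butlast (tl zs)"
  have lz: "length zs = Suc (length p)" and
    e: "\<And>q. q < length p \<Longrightarrow> p ! q \<in> D \<and> joins l (p ! q) (zs ! q) (zs ! Suc q)"
    using zs(1) by (auto simp: rpath_def)
  have le: "length es = length p - 2" "length xs = length p - 1" using lz by (auto simp: es_def xs_def)
  have nth: "es ! q = p ! Suc q" if "q < length es" for q
    using that le by (simp add: es_def nth_butlast nth_tl)
  have xnth: "xs ! q = zs ! Suc q" if "q < length xs" for q
    using that le lz by (simp add: xs_def nth_butlast nth_tl)
  have z_eq: "zs ! q = zs ! r \<longleftrightarrow> q = r" if "q \<le> length p" "r \<le> length p" for q r
    using that zs(2) lz by (simp add: nth_eq_iff_index_eq)
  have p0: "p ! 0 = a" "p ! (length p - 1) = b" using ends p(1) by (auto simp: hd_conv_nth last_conv_nth)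
  have "0 < length p" using p(1) by simp
  then have "joins l a (zs ! 0) (zs ! 1)" using e[of 0] p0 by simp
  then obtain i where i: "i \<le> 1" "l i a = zs ! 1" "l (1 - i) a = zs ! 0"
    using joins_index by blast
  have "Suc (length p - 1) = length p" using len by simp
  then have "joins l b (zs ! length p) (zs ! (length p - 1))"
    using e[of "length p - 1"] p0 \<open>0 < length p\<close> by (simp add: joins_commute)
  then obtain j where j: "j \<le> 1" "l j b = zs ! (length p - 1)" "l (1 - j) b = zs ! length p"
    using joins_index by blast
  have "es ! q \<in> alive_edges a b i j \<and> joins l (es ! q) (xs ! q) (xs ! Suc q)" if q: "q < length es" for q
  proof -
    have q': "Suc q < length p" "Suc (Suc q) < length p" using q le by auto
    then have join: "joins l (es ! q) (zs ! Suc q) (zs ! Suc (Suc q))" "es ! q \<in> D"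
      using e[OF q'(1)] nth[OF q] by auto
    have "zs ! Suc q \<noteq> zs ! 0" "zs ! Suc (Suc q) \<noteq> zs ! 0"
      "zs ! Suc q \<noteq> zs ! length p" "zs ! Suc (Suc q) \<noteq> zs ! length p"
      using z_eq q' by auto
    then have "es ! q \<in> alive_edges a b i j"
      using join i j unfolding alive_edges_def joins_def D_def by auto
    then show ?thesis using join(1) xnth[of q] xnth[of "Suc q"] q le by simp
  qed
  then have "rpath l (alive_edges a b i j) xs es"
    using le len by (simp add: rpath_def)
  moreover have "distinct xs" using zs(2) by (simp add: xs_def distinct_butlast distinct_tl)
  moreover have "xs \<noteq> []" using le len by auto
  then have "hd xs = l i a" "last xs = l j b"
    using xnth[of 0] xnth[of "length xs - 1"] le len i j
    by (auto simp: hd_conv_nth last_conv_nth Suc_diff_Suc numeral_2_eq_2)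
  moreover have "even (length es)" using even le by simp
  ultimately show ?thesis using i(1) j(1) unfolding even_rpath_def by blast
qed

text \<open>The root path is extended by \<open>a\<close>, \<open>b\<close> and their other ends.
  The labels stay distinct because alive edges avoid those ends and nonadjacent \<open>a\<close> and
  \<open>b\<close> share no label.\<close>

lemma even_rpath_imp_odd_path:
  assumes xs: "even_rpath a b i j xs es" and ij: "i \<le> 1" "j \<le> 1"
    and D: "a \<in> D" "b \<in> D" and ab: "{a, b} \<notin> edges G" "a \<noteq> b"
  shows "path_joining G a b (a # es @ [b]) \<and> odd (path_length (a # es @ [b]))"
proof -
  let ?x = "l (1 - i) a" and ?y = "l (1 - j) b"
  have path: "rpath l (alive_edges a b i j) xs es" "distinct xs" "hd xs = l i a" "last xs = l j b" "even (length es)"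
    using xs by (auto simp: even_rpath_def)
  have "b < n" using D by (simp add: D_def)
  then have nsh: "\<not> share l a b" using adj[OF D(1)] ab D by blast
  have lx: "length xs = Suc (length es)" and
    e: "\<And>q. q < length es \<Longrightarrow> es ! q \<in> alive_edges a b i j \<and> joins l (es ! q) (xs ! q) (xs ! Suc q)"
    using path(1) by (auto simp: rpath_def)
  have ja: "joins l a ?x (hd xs)" and jb: "joins l b (last xs) ?y"
    using ij path(3,4) by (auto simp: joins_def le_Suc_eq)
  have ne: "?x \<noteq> ?y" "hd xs \<noteq> last xs" using share_joins[OF ja jb] nsh by auto
  have alive: "x \<noteq> ?x \<and> x \<noteq> ?y" if "x \<in> set xs" for x
  proof -
    obtain q where q: "q < length xs" "x = xs ! q" using \<open>x \<in> set xs\<close> by (auto simp: in_set_conv_nth)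
    \<comment> \<open>The terminals differ, so there is an edge, and hence every vertex of
      \<open>xs\<close> lies on an alive edge.\<close>
    have "es \<noteq> []"
    proof
      assume "es = []"
      then have "length xs = Suc 0" using lx by simp
      then show False using ne(2) by (auto simp: length_Suc_conv)
    qed
    have "\<exists>f y. f \<in> alive_edges a b i j \<and> joins l f x y"
    proof (cases "q < length es")
      case True
      then show ?thesis using e[of q] q(2) by blast
    next
      case False
      then have "q = length es" using q(1) lx by simp
      then have "q - 1 < length es" "Suc (q - 1) = q" using \<open>es \<noteq> []\<close> by (cases es; simp)+
      then show ?thesis using e[of "q - 1"] q(2) joins_commute by metis
    qed
    then obtain f y where "f \<in> alive_edges a b i j" "joins l f x y" by blast
    then show ?thesis by (auto simp: joins_def alive_edges_def)
  qed
  let ?zs = "?x # xs @ [?y]"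
  have "rpath l D xs es" using path(1) by (auto simp: rpath_def alive_edges_def D_def)
  then have "rpath l D (xs @ [?y]) (es @ [b])" by (rule rpath_snoc[OF _ D(2) jb])
  moreover have "xs \<noteq> []" using lx by auto
  ultimately have "rpath l D ?zs (a # es @ [b])" using ja by (intro rpath_Cons D(1)) simp_all
  moreover have "distinct ?zs" using path(2) alive ne by auto
  ultimately have "is_path G (a # es @ [b])" by (rule rpath_imp_path) simp
  then show ?thesis using path(5) by (simp add: path_joining_def path_length_def)
qed

definition answered :: "nat \<Rightarrow> nat \<Rightarrow> state \<Rightarrow> bool" where
  "answered a b S \<longleftrightarrow> var S ''len'' \<noteq> 0 \<and>
     (\<exists>p. map (arr S ''out'' 0) [0..<var S ''len''] = p \<and> path_joining G a b p \<and> odd (path_length p))"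

definition ready :: "nat \<Rightarrow> nat \<Rightarrow> state \<Rightarrow> bool" where
  "ready a b S \<longleftrightarrow> var S ''n'' = n \<and> var S ''m'' = m \<and> var S ''a'' = a \<and> var S ''b'' = b \<and> arr S ''l'' = l"

lemma try_ends:
  assumes rdy: "ready a b S" and len: "var S ''len'' = 0" and ij: "i \<le> 1" "j \<le> 1"
    and D: "a \<in> D" "b \<in> D" and ab: "{a, b} \<notin> edges G" "a \<noteq> b"
  defines "S' \<equiv> sem (try_ends i j) S"
  shows "answered a b S' \<or> var S' ''len'' = 0 \<and> (\<nexists>xs es. even_rpath a b i j xs es)"
proof -
  let ?A = "alive_edges a b i j"
  define R where "R = set_var ''tx'' (l (1 - j) b) (set_var ''t'' (l j b)
      (set_var ''sx'' (l (1 - i) a) (set_var ''s'' (l i a) S)))"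
  have S': "S' = sem core R"
    using rdy len by (simp add: S'_def try_ends_def R_def ready_def)
  have "b < n" using D by (simp add: D_def)
  then have nsh: "\<not> share l a b" using adj[OF D(1)] ab D by blast
  interpret terminals n m l ?A "l i a" "l j b"
  proof
    fix e assume "e \<in> ?A"
    then have "e \<in> D" by (simp add: alive_edges_def D_def)
    then show "e < n" "l 0 e < m \<and> l 1 e < m" "l 0 e \<noteq> l 1 e"
      using labelsD by (auto simp: D_def)
  next
    show "l i a < m" "l j b < m" using labelsD[OF D(1)] labelsD[OF D(2)] ij by (auto simp: le_Suc_eq)
    show "l i a \<noteq> l j b" using nsh ij by (auto simp: share_def le_Suc_eq)
  qed
  have "found S' \<and> var S' ''len'' \<noteq> 0 \<or> var S' ''len'' = 0 \<and>
    (\<forall>xs es. rpath l ?A xs es \<longrightarrow> distinct xs \<longrightarrow> hd xs = l i a \<longrightarrow> last xs = l j b \<longrightarrow> odd (length es))"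
    unfolding S'
    by (rule core) (use rdy len in \<open>simp_all add: R_def ready_def alive_edges_def\<close>)
  moreover have "answered a b S'" if fnd: "found S'" "var S' ''len'' \<noteq> 0"
  proof -
    obtain xs es where xs: "even_rpath a b i j xs es"
      and out: "map (arr S' ''out'' 0) [0..<var S' ''len''] = var S' ''a'' # es @ [var S' ''b'']"
      using fnd(1) unfolding found_def by (elim exE conjE) (rule that, auto simp: even_rpath_def)
    have "var S' ''a'' = a" "var S' ''b'' = b" using rdy by (simp_all add: S' R_def ready_def)
    then show ?thesis
      using out even_rpath_imp_odd_path[OF xs ij D ab] fnd(2) unfolding answered_def by simp
  qed
  ultimately show ?thesis unfolding even_rpath_def by blast
qed

text \<open>Once a path is found, \<open>len\<close> is nonzero and the remaining attempts are
  skipped.\<close>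

lemma try_all:
  assumes rdy: "ready a b S" and len: "var S ''len'' = 0"
    and D: "a \<in> D" "b \<in> D" and ab: "{a, b} \<notin> edges G" "a \<noteq> b"
  defines "S' \<equiv> sem try_all S"
  shows "answered a b S' \<or>
    var S' ''len'' = 0 \<and> (\<nexists>p. path_joining G a b p \<and> odd (path_length p))"
proof -
  have stay: "sem (try_ends i j) R = R" if "answered a b R" for i j R
    using that by (simp add: answered_def try_ends_def)
  have rdy': "ready a b (sem (try_ends i j) R)" if "ready a b R" for i j R
    using that by (simp add: ready_def)
  have step: "answered a b (sem (try_ends i j) R) \<or>
      var (sem (try_ends i j) R) ''len'' = 0 \<and> (\<nexists>xs es. even_rpath a b i j xs es)"
    if "ready a b R" "var R ''len'' = 0" "i \<le> 1" "j \<le> 1" for i j R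
    by (rule try_ends[OF that D ab])
  define S1 where "S1 = sem (try_ends 0 0) S"
  define S2 where "S2 = sem (try_ends 0 1) S1"
  define S3 where "S3 = sem (try_ends 1 0) S2"
  define none where "none i j \<longleftrightarrow> (\<nexists>xs es. even_rpath a b i j xs es)" for i j
  have S': "S' = sem (try_ends 1 1) S3"
    by (simp only: S'_def try_all_def sem.simps(4) S1_def S2_def S3_def)
  have r: "ready a b S1" "ready a b S2" "ready a b S3"
    unfolding S1_def S2_def S3_def by (intro rdy' rdy)+
  have 1: "answered a b S1 \<or> var S1 ''len'' = 0 \<and> none 0 0"
    using step[OF rdy len, of 0 0] unfolding S1_def none_def by simp
  have 2: "answered a b S2 \<or> var S2 ''len'' = 0 \<and> none 0 0 \<and> none 0 1"
    using 1 stay step[OF r(1), of 0 1] unfolding S2_def none_def by fastforce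
  have 3: "answered a b S3 \<or> var S3 ''len'' = 0 \<and> none 0 0 \<and> none 0 1 \<and> none 1 0"
    using 2 stay step[OF r(2), of 1 0] unfolding S3_def none_def by fastforce
  have 4: "answered a b S' \<or> var S' ''len'' = 0 \<and> none 0 0 \<and> none 0 1 \<and> none 1 0 \<and> none 1 1"
    using 3 stay step[OF r(3), of 1 1] unfolding S' none_def by fastforce
  have "\<nexists>p. path_joining G a b p \<and> odd (path_length p)" if n: "none 0 0" "none 0 1" "none 1 0" "none 1 1"
  proof
    assume "\<exists>p. path_joining G a b p \<and> odd (path_length p)"
    then obtain p where "path_joining G a b p" "odd (path_length p)" by blast
    from odd_path_imp_even_rpath[OF this D(1) ab]
    obtain i j where "i \<le> 1" "j \<le> 1" "\<not> none i j" unfolding none_def by blast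
    then show False using n by (auto simp: le_Suc_eq)
  qed
  with 4 show ?thesis by blast
qed

end

section \<open>Assembling the algorithm\<close>

lemma line_graph_root:
  assumes G: "simple_graph G" "verts G = {..<n}" "is_line_graph G"
  shows "\<exists>f. root n (\<lambda>u v. {u, v} \<in> edges G) f"
proof -
  obtain R :: "nat graph" and f where R: "simple_graph R" and bij: "bij_betw f (verts G) (edges R)"
    and iso: "\<And>u v. u \<in> verts G \<Longrightarrow> v \<in> verts G \<Longrightarrow>
      {u, v} \<in> edges G \<longleftrightarrow> {f u, f v} \<in> edges (line_graph R)"
    using G(3) unfolding is_line_graph_def graph_iso_def by (auto simp: line_graph_def)
  have fR: "f v \<in> edges R" if "v < n" for v using bij that G(2) by (auto simp: bij_betw_def)
  have inj: "f u = f v \<Longrightarrow> u = v" if "u < n" "v < n" for u v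
    using bij that G(2) by (auto simp: bij_betw_def inj_on_def)
  have "root n (\<lambda>u v. {u, v} \<in> edges G) f"
  proof
    fix v assume "v < n"
    then show "\<exists>x y. x \<noteq> y \<and> f v = {x, y}" using R fR[of v] unfolding simple_graph_def by blast
  next
    fix u v assume uv: "u < n" "v < n" "u \<noteq> v"
    then have "f u \<noteq> f v" using inj by blast
    have "{u, v} \<in> edges G \<longleftrightarrow> {f u, f v} \<in> edges (line_graph R)" using iso uv G(2) by simp
    also have "\<dots> \<longleftrightarrow> f u \<inter> f v \<noteq> {}"
      using fR[OF uv(1)] fR[OF uv(2)] \<open>f u \<noteq> f v\<close>
      by (auto simp: line_graph_def doubleton_eq_iff)
    finally show "{u, v} \<in> edges G \<longleftrightarrow> f u \<inter> f v \<noteq> {}" .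
  next
    show "{v, v} \<notin> edges G" for v using G(1) by (auto simp: simple_graph_def doubleton_eq_iff)
  qed (use inj in blast)
  then show ?thesis by blast
qed

lemma sem_main:
  assumes G: "simple_graph G" "verts G = {..<n}" "is_line_graph G"
    and ab: "a < n" "b < n" "a \<noteq> b"
  defines "S \<equiv> set_var ''m'' (Suc (Suc n)) (input_state n G a b)"
  defines "S' \<equiv> sem main_prog S"
  shows "var S' ''len'' \<noteq> 0 \<and>
      (\<exists>p. map (arr S' ''out'' 0) [0..<var S' ''len''] = p \<and> path_joining G a b p \<and> odd (path_length p)) \<or>
    var S' ''len'' = 0 \<and> (\<nexists>p. path_joining G a b p \<and> odd (path_length p))"
proof (cases "{a, b} \<in> edges G")
  case True
  have "is_path G [a, b]"
    unfolding is_path_iff[OF G(1)] using True ab G(2) by (auto simp: less_Suc_eq)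
  then have "path_joining G a b [a, b]" "odd (path_length [a, b])"
    by (auto simp: path_joining_def path_length_def)
  moreover have "var S' ''len'' = 2" "arr S' ''out'' 0 0 = a" "arr S' ''out'' 0 1 = b"
    using True by (simp_all add: S'_def S_def main_prog_def input_state_def)
  ultimately show ?thesis by (simp add: upt_rec numeral_2_eq_2)
next
  case False
  let ?adj = "\<lambda>u v. {u, v} \<in> edges G"
  obtain f where "root n ?adj f" using line_graph_root[OF G] by blast
  then interpret root_search n ?adj f a using ab by (simp add: root_search_def root_search_axioms_def)
  have inp: "input S" using ab by (simp add: input_def S_def input_state_def)
  define R where "R = sem find_root S"
  have cor: "correct R" unfolding R_def by (rule find_root[OF inp])
  interpret labelled_graph G n "Suc (Suc n)" "labels R"
    by unfold_locales (use G cor in \<open>auto simp: correct_def\<close>)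
  have rdy: "ready a b R" and len: "var R ''len'' = 0"
    unfolding ready_def by (simp_all add: R_def S_def input_state_def)
  have "\<not> bval (adjb ''a'' ''b'') S" using False by (simp add: S_def input_state_def)
  then have S': "S' = (if bval (Eq (lab 0 ''b'') (Const 0)) R then R else sem try_all R)"
    by (simp only: S'_def main_prog_def search_path_def sem.simps(1,4,5) R_def[symmetric] if_False)
  have aD: "a \<in> D" using cor ab by (simp add: correct_def D_def)
  show ?thesis
  proof (cases "labels R 0 b = 0")
    case True
    \<comment> \<open>\<open>D\<close> is closed under adjacency, so a path from \<open>a\<close>
      cannot end outside it.\<close>
    have "b \<in> D" if "path_joining G a b p" for p
    proof -
      have "set p \<subseteq> D" "last p = b" "p \<noteq> []"
        using path_subset_D[of p] that aD by (auto simp: path_joining_def is_path_def)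
      then show ?thesis using last_in_set by blast
    qed
    then have "\<nexists>p. path_joining G a b p" using True by (auto simp: D_def)
    moreover have "S' = R" unfolding S' using True rdy by (simp add: ready_def)
    ultimately show ?thesis using len by simp
  next
    case nz: False
    then have "b \<in> D" using ab by (simp add: D_def)
    from try_all[OF rdy len aD this False ab(3)] nz rdy
    show ?thesis unfolding S' by (auto simp: ready_def answered_def)
  qed
qed

lemma answer_of_correct:
  assumes ab: "a \<in> verts G" "b \<in> verts G" "a \<noteq> b"
    and s: "var s ''len'' \<noteq> 0 \<and>
      (\<exists>p. map (arr s ''out'' 0) [0..<var s ''len''] = p \<and> path_joining G a b p \<and> odd (path_length p)) \<or>
    var s ''len'' = 0 \<and> (\<nexists>p. path_joining G a b p \<and> odd (path_length p))"
  shows "if \<exists>p. path_joining G a b p \<and> odd (path_length p)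
    then \<exists>p. answer_of s = Odd_Path p \<and> path_joining G a b p \<and> odd (path_length p)
    else answer_of s = Even_Pair \<and> even_pair G a b"
proof (cases "\<exists>p. path_joining G a b p \<and> odd (path_length p)")
  case True
  with s obtain p where "var s ''len'' \<noteq> 0" "map (arr s ''out'' 0) [0..<var s ''len''] = p"
    "path_joining G a b p" "odd (path_length p)" by blast
  then have "answer_of s = Odd_Path p" by (simp add: answer_of_def)
  with True \<open>path_joining G a b p\<close> \<open>odd (path_length p)\<close> show ?thesis by (simp only: if_True) blast
next
  case False
  with s have "var s ''len'' = 0" by blast
  then have "answer_of s = Even_Pair" by (simp add: answer_of_def)
  moreover have "even_pair G a b" using False ab unfolding even_pair_def by blast
  ultimately show ?thesis using False by (simp only: if_False)
qed

theorem mainTheorem8: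
  "\<exists>(P :: com) (T :: nat \<Rightarrow> nat) (k :: nat).
     (\<lambda>n. real (T n)) \<in> O(\<lambda>n. real n ^ 3) \<and>
     (\<forall>(n :: nat) (G :: nat graph) a b.
        simple_graph G \<longrightarrow> verts G = {..<n} \<longrightarrow> is_line_graph G \<longrightarrow>
        a \<in> verts G \<longrightarrow> b \<in> verts G \<longrightarrow> a \<noteq> b \<longrightarrow>
        (\<exists>t s. exec (n ^ k) P (input_state n G a b) t s \<and> t \<le> T n \<and>
           (if \<exists>p. path_joining G a b p \<and> odd (path_length p)
            then \<exists>p. answer_of s = Odd_Path p \<and> path_joining G a b p \<and> odd (path_length p)
            else answer_of s = Even_Pair \<and> even_pair G a b)))"
proof -
  \<comment> \<open>\<open>n + 2\<close> exceeds every label. It is stored before the main program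
    starts, as that must not write its own loop limits.\<close>
  define M where "M = Assign ''m'' (Plus (Plus (Var ''n'') (Const 1)) (Const 1))"
  \<comment> \<open>The 6 is the cost of \<open>M\<close>; both loop limits are at most
    \<open>n + 2\<close>.\<close>
  define T where "T n = 6 + cost (n + 2) main_prog" for n
  obtain K where "\<And>N. cost N main_prog \<le> K * Suc N ^ 3"
    using cost_le_power[of main_prog] depth_main by auto
  then have K: "cost (n + 2) main_prog \<le> K * (n + 3) ^ 3" for n
    by (metis add_Suc_right numeral_3_eq_3 numeral_2_eq_2)
  have T: "T n \<le> (K + 6) * (n + 3) ^ 3" for n
  proof -
    have "1 \<le> (n + 3) ^ 3" by simp
    then show ?thesis using K[of n] unfolding T_def add_mult_distrib by linarith
  qed
  have "(\<lambda>n. real (T n)) \<in> O(\<lambda>n. real n ^ 3)"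
  \<comment> \<open>For \<open>n \<ge> 1\<close> one has \<open>n + 3 \<le> 4 * n\<close>, and 64 is
    the cube of 4.\<close>
  proof (rule bigoI[where c = "64 * real (K + 6)"], rule eventually_at_top_linorderI[of 1])
    fix n :: nat assume "1 \<le> n"
    then have "(n + 3) ^ 3 \<le> (4 * n) ^ 3" by (intro power_mono) auto
    then have "(K + 6) * (n + 3) ^ 3 \<le> (K + 6) * (4 * n) ^ 3" by (rule mult_le_mono2)
    then have "T n \<le> (K + 6) * (4 * n) ^ 3" using T[of n] by (rule le_trans[rotated])
    also have "\<dots> = 64 * (K + 6) * n ^ 3" by (simp add: power_mult_distrib algebra_simps)
    finally have "T n \<le> 64 * (K + 6) * n ^ 3" .
    then have "real (T n) \<le> real (64 * (K + 6) * n ^ 3)" by (simp only: of_nat_le_iff)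
    then show "norm (real (T n)) \<le> 64 * real (K + 6) * norm (real n ^ 3)" by simp
  qed
  moreover have "\<exists>t s. exec (n ^ (K + 20)) (Seq M (compile main_prog)) (input_state n G a b) t s \<and> t \<le> T n \<and>
      (if \<exists>p. path_joining G a b p \<and> odd (path_length p)
       then \<exists>p. answer_of s = Odd_Path p \<and> path_joining G a b p \<and> odd (path_length p)
       else answer_of s = Even_Pair \<and> even_pair G a b)"
    if G: "simple_graph G" "verts G = {..<n}" "is_line_graph G" and ab: "a < n" "b < n" "a \<noteq> b" for n G a b
  proof -
    let ?W = "n ^ (K + 20)"
    define S where "S = set_var ''m'' (Suc (Suc n)) (input_state n G a b)"
    \<comment> \<open>Only from \<open>n = 2\<close> on can a power of \<open>n\<close> absorb the
      constant \<open>K\<close>.\<close>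
    have n: "2 \<le> n" using ab by linarith
    have W: "n + 2 + cost (n + 2) main_prog \<le> ?W"
    proof -
      have "n + 3 \<le> n ^ 3"
      proof -
        have "2 * 2 * n \<le> n * n * n" using n by (intro mult_le_mono) auto
        then show ?thesis using n unfolding power3_eq_cube by linarith
      qed
      then have "(n + 3) ^ 3 \<le> (n ^ 3) ^ 3" by (intro power_mono) auto
      moreover have "K + 1 \<le> n ^ (K + 1)"
      proof -
        have "K + 1 < 2 ^ (K + 1)" by (rule less_exp)
        also have "\<dots> \<le> n ^ (K + 1)" using n by (intro power_mono) auto
        finally show ?thesis by simp
      qed
      \<comment> \<open>\<open>K + 1\<close> is absorbed by \<open>n ^ (K + 1)\<close> and the cube
        of \<open>n + 3\<close> by \<open>n ^ 9\<close>; the exponent \<open>K + 20\<close> exceeds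
        their total.\<close>
      ultimately have "(K + 1) * (n + 3) ^ 3 \<le> n ^ (K + 1) * (n ^ 3) ^ 3" by (intro mult_le_mono)
      also have "\<dots> = n ^ ((K + 1) + 3 * 3)" by (simp only: power_add power_mult)
      also have "\<dots> \<le> ?W" using n by (intro power_increasing) auto
      finally have "(K + 1) * (n + 3) ^ 3 \<le> ?W" .
      moreover have "n + 2 \<le> (n + 3) ^ 3"
        using self_le_power[of "n + 3" 3] by simp
      ultimately show ?thesis using K[of n] unfolding add_mult_distrib by linarith
    qed
    have bnd: "bounded (n + 2) S"
      using ab n by (auto simp: bounded_def S_def input_state_def)
    have "afits ?W (Plus (Plus (Var ''n'') (Const 1)) (Const 1)) (input_state n G a b)"
      using W n by (auto simp: afits_def input_state_def)
    from exec.Assign[OF this, of "''m''"]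
    have e1: "exec ?W M (input_state n G a b) 6 S"
      by (simp add: M_def S_def input_state_def eval_nat_numeral)
    have "limits main_prog \<inter> wvars main_prog = {}" "\<forall>y\<in>limits main_prog. var S y \<le> n + 2"
      using wvars_main by (auto simp: limits_main S_def input_state_def)
    from exec_compile[OF wf_main this bnd W] obtain t
      where t: "exec ?W (compile main_prog) S t (sem main_prog S)" "t \<le> cost (n + 2) main_prog" by blast
    have "exec ?W (Seq M (compile main_prog)) (input_state n G a b) (6 + t) (sem main_prog S)"
      by (rule exec.Seq[OF e1 t(1)])
    moreover have "6 + t \<le> T n" using t(2) by (simp add: T_def)
    moreover have "if \<exists>p. path_joining G a b p \<and> odd (path_length p)
       then \<exists>p. answer_of (sem main_prog S) = Odd_Path p \<and> path_joining G a b p \<and> odd (path_length p)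
       else answer_of (sem main_prog S) = Even_Pair \<and> even_pair G a b"
      by (rule answer_of_correct[OF _ _ ab(3) sem_main[OF G ab, folded S_def]]) (use ab G(2) in simp_all)
    ultimately show ?thesis by blast
  qed
  ultimately show ?thesis
    by (intro exI[of _ "Seq M (compile main_prog)"] exI[of _ T] exI[of _ "K + 20"]) auto
qed

end
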